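(* (1) For every integer $n\ge 2$, the solvable Baumslag--Solitar group $BS(1,n)=\langle a,t\mid tat^{-1}=a^n\rangle$ has property PH but does not have property QT. (2) Fundamental groups of Anosov mapping tori have property PH but do not have property QT.
   Context: An element $\varphi\in \mathrm{SL}_2(\mathbb{Z})$ is Anosov if it has distinct irrational eigenvalues $\lambda>1$ and $0<\lambda^{-1}<1$. Viewing $\varphi$ as a mapping class of the torus $T^2$, the fundamental group of its mapping torus (an Anosov mapping torus) is $\mathbb{Z}^2\rtimes_\varphi\mathbb{Z}$. A hyperbolic space is a geodesic metric space that is Gromov $\delta$-hyperbolic for some $\delta\ge 0$. A quasi-tree is a metric space quasi-isometric to a tree equipped with the path metric. An isometric action of a group $G$ on a metric space $X$ is proper if for every $x\in X$ and $R>0$ the set $\{g\in G: d(x,gx)\le R\}$ is finite; it is cobounded if some orbit is $\epsilon$-dense in $X$ for some $\epsilon\ge 0$. A group $G$ has property PH if there exist finitely many hyperbolic spaces $X_1,\dots,X_n$ such that $G$ acts properly by isometries on $\prod_{i=1}^n X_i$ with the $\ell^1$-metric, and for each $i$ the stabilizer $\mathrm{Stab}_G(X_i)$ of the factor space $X_i$ (the subgroup of elements preserving that factor) acts coboundedly on $X_i$. A group $G$ has property QT if it is finitely generated and acts isometrically on a finite product of quasi-trees, equipped with the $\ell^1$-metric, such that the orbit map is a quasi-isometric embedding (with respect to a word metric on $G$ from a finite generating set). *)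

theory Defs
  imports "HOL-Analysis.Analysis" "HOL-Algebra.Group_Action" "HOL-Algebra.Elementary_Groups"
begin

section \<open>Metric spaces\<close>

definition geodesic_space :: "'x set \<Rightarrow> ('x \<Rightarrow> 'x \<Rightarrow> real) \<Rightarrow> bool" where
  "geodesic_space X d \<longleftrightarrow> Metric_space X d \<and>
     (\<forall>x\<in>X. \<forall>y\<in>X. \<exists>c. c \<in> {0..d x y} \<rightarrow> X \<and> c 0 = x \<and> c (d x y) = y \<and>
        (\<forall>s\<in>{0..d x y}. \<forall>t\<in>{0..d x y}. d (c s) (c t) = \<bar>s - t\<bar>))"

definition gromov_product :: "('x \<Rightarrow> 'x \<Rightarrow> real) \<Rightarrow> 'x \<Rightarrow> 'x \<Rightarrow> 'x \<Rightarrow> real" where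
  "gromov_product d w x y = (d x w + d y w - d x y) / 2"

definition gromov_hyperbolic :: "real \<Rightarrow> 'x set \<Rightarrow> ('x \<Rightarrow> 'x \<Rightarrow> real) \<Rightarrow> bool" where
  "gromov_hyperbolic \<delta> X d \<longleftrightarrow>
     (\<forall>w\<in>X. \<forall>x\<in>X. \<forall>y\<in>X. \<forall>z\<in>X.
        gromov_product d w x z \<ge> min (gromov_product d w x y) (gromov_product d w y z) - \<delta>)"

text \<open>Spaces are taken to be nonempty, since otherwise every group would act properly on an
  empty product.\<close>

definition hyperbolic_space :: "'x set \<Rightarrow> ('x \<Rightarrow> 'x \<Rightarrow> real) \<Rightarrow> bool" where
  "hyperbolic_space X d \<longleftrightarrow>
     X \<noteq> {} \<and> geodesic_space X d \<and> (\<exists>\<delta>\<ge>0. gromov_hyperbolic \<delta> X d)"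

definition qi_embedding ::
    "'x set \<Rightarrow> ('x \<Rightarrow> 'x \<Rightarrow> real) \<Rightarrow> 'y set \<Rightarrow> ('y \<Rightarrow> 'y \<Rightarrow> real) \<Rightarrow> ('x \<Rightarrow> 'y) \<Rightarrow> bool" where
  "qi_embedding X d Y e f \<longleftrightarrow> f \<in> X \<rightarrow> Y \<and>
     (\<exists>L\<ge>1. \<exists>C\<ge>0. \<forall>x\<in>X. \<forall>y\<in>X.
        d x y / L - C \<le> e (f x) (f y) \<and> e (f x) (f y) \<le> L * d x y + C)"

definition quasi_isometry ::
    "'x set \<Rightarrow> ('x \<Rightarrow> 'x \<Rightarrow> real) \<Rightarrow> 'y set \<Rightarrow> ('y \<Rightarrow> 'y \<Rightarrow> real) \<Rightarrow> ('x \<Rightarrow> 'y) \<Rightarrow> bool" where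
  "quasi_isometry X d Y e f \<longleftrightarrow>
     qi_embedding X d Y e f \<and> (\<exists>D\<ge>0. \<forall>y\<in>Y. \<exists>x\<in>X. e (f x) y \<le> D)"


section \<open>Trees and quasi-trees\<close>

text \<open>A simple graph is a vertex set \<open>V\<close> with a symmetric irreflexive adjacency
  relation \<open>E\<close>. A walk is the nonempty list of its vertices.\<close>

definition walk :: "'v set \<Rightarrow> ('v \<times> 'v) set \<Rightarrow> 'v list \<Rightarrow> bool" where
  "walk V E p \<longleftrightarrow> p \<noteq> [] \<and> set p \<subseteq> V \<and> successively (\<lambda>u v. (u, v) \<in> E) p"

definition cycle :: "'v set \<Rightarrow> ('v \<times> 'v) set \<Rightarrow> 'v list \<Rightarrow> bool" where
  "cycle V E p \<longleftrightarrow> walk V E p \<and> distinct p \<and> length p \<ge> 3 \<and> (last p, hd p) \<in> E"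

definition tree :: "'v set \<Rightarrow> ('v \<times> 'v) set \<Rightarrow> bool" where
  "tree V E \<longleftrightarrow> V \<noteq> {} \<and> E \<subseteq> V \<times> V \<and> sym E \<and> irrefl E \<and>
     (\<forall>u\<in>V. \<forall>v\<in>V. \<exists>p. walk V E p \<and> hd p = u \<and> last p = v) \<and>
     (\<nexists>p. cycle V E p)"

definition path_dist :: "'v set \<Rightarrow> ('v \<times> 'v) set \<Rightarrow> 'v \<Rightarrow> 'v \<Rightarrow> real" where
  "path_dist V E u v =
     real (LEAST k. \<exists>p. walk V E p \<and> hd p = u \<and> last p = v \<and> length p = Suc k)"

text \<open>The tree is represented by its vertex set with the path metric; the inclusion into the
  geometric realization with edges of length one is a quasi-isometry. The first argument of
  \<open>quasi_tree\<close> fixes the type of the vertices of the tree, because a definition in HOL cannot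
  quantify over types.\<close>

definition quasi_tree :: "'v itself \<Rightarrow> 'x set \<Rightarrow> ('x \<Rightarrow> 'x \<Rightarrow> real) \<Rightarrow> bool" where
  "quasi_tree _ X d \<longleftrightarrow> Metric_space X d \<and>
     (\<exists>(V :: 'v set) E f. tree V E \<and> quasi_isometry X d V (path_dist V E) f)"


section \<open>Actions on finite products with the l1-metric\<close>

definition l1_dist :: "nat \<Rightarrow> (nat \<Rightarrow> 'x \<Rightarrow> 'x \<Rightarrow> real) \<Rightarrow> (nat \<Rightarrow> 'x) \<Rightarrow> (nat \<Rightarrow> 'x) \<Rightarrow> real" where
  "l1_dist n d x y = (\<Sum>i<n. d i (x i) (y i))"

definition isometric_action ::
    "('g, 'b) monoid_scheme \<Rightarrow> 'p set \<Rightarrow> ('p \<Rightarrow> 'p \<Rightarrow> real) \<Rightarrow> ('g \<Rightarrow> 'p \<Rightarrow> 'p) \<Rightarrow> bool" where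
  "isometric_action G P D \<phi> \<longleftrightarrow> group_action G P \<phi> \<and>
     (\<forall>g\<in>carrier G. \<forall>x\<in>P. \<forall>y\<in>P. D (\<phi> g x) (\<phi> g y) = D x y)"

definition proper_action ::
    "('g, 'b) monoid_scheme \<Rightarrow> 'p set \<Rightarrow> ('p \<Rightarrow> 'p \<Rightarrow> real) \<Rightarrow> ('g \<Rightarrow> 'p \<Rightarrow> 'p) \<Rightarrow> bool" where
  "proper_action G P D \<phi> \<longleftrightarrow>
     (\<forall>x\<in>P. \<forall>R>0. finite {g \<in> carrier G. D x (\<phi> g x) \<le> R})"

text \<open>An isometry \<open>h\<close> of the product preserves the factor \<open>i\<close> if it covers an isometry \<open>f\<close> of
  that factor, i.e. the \<open>i\<close>-th coordinate of \<open>h x\<close> is \<open>f\<close> of the \<open>i\<close>-th coordinate of \<open>x\<close>. It is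
  through these \<open>f\<close> that the stabilizer of the factor acts on it.\<close>

definition induces_on_factor ::
    "nat \<Rightarrow> (nat \<Rightarrow> 'x set) \<Rightarrow> (nat \<Rightarrow> 'x \<Rightarrow> 'x \<Rightarrow> real) \<Rightarrow> nat \<Rightarrow>
     ((nat \<Rightarrow> 'x) \<Rightarrow> (nat \<Rightarrow> 'x)) \<Rightarrow> ('x \<Rightarrow> 'x) \<Rightarrow> bool" where
  "induces_on_factor n X d i h f \<longleftrightarrow>
     f ` X i = X i \<and> (\<forall>x\<in>X i. \<forall>y\<in>X i. d i (f x) (f y) = d i x y) \<and>
     (\<forall>x\<in>PiE {..<n} X. h x i = f (x i))"

definition factor_stabilizer ::
    "('g, 'b) monoid_scheme \<Rightarrow> nat \<Rightarrow> (nat \<Rightarrow> 'x set) \<Rightarrow> (nat \<Rightarrow> 'x \<Rightarrow> 'x \<Rightarrow> real) \<Rightarrow>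
     ('g \<Rightarrow> (nat \<Rightarrow> 'x) \<Rightarrow> (nat \<Rightarrow> 'x)) \<Rightarrow> nat \<Rightarrow> 'g set" where
  "factor_stabilizer G n X d \<phi> i =
     {g \<in> carrier G. \<exists>f. induces_on_factor n X d i (\<phi> g) f}"

definition stabilizer_cobounded ::
    "('g, 'b) monoid_scheme \<Rightarrow> nat \<Rightarrow> (nat \<Rightarrow> 'x set) \<Rightarrow> (nat \<Rightarrow> 'x \<Rightarrow> 'x \<Rightarrow> real) \<Rightarrow>
     ('g \<Rightarrow> (nat \<Rightarrow> 'x) \<Rightarrow> (nat \<Rightarrow> 'x)) \<Rightarrow> nat \<Rightarrow> bool" where
  "stabilizer_cobounded G n X d \<phi> i \<longleftrightarrow>
     (\<exists>x0\<in>X i. \<exists>\<epsilon>\<ge>0. \<forall>y\<in>X i. \<exists>g\<in>factor_stabilizer G n X d \<phi> i. \<exists>f.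
        induces_on_factor n X d i (\<phi> g) f \<and> d i (f x0) y \<le> \<epsilon>)"


section \<open>Properties PH and QT\<close>

text \<open>The type arguments fix the types of the points of the factors (and of the vertices of the
  trees); within such a type the underlying sets and metrics are arbitrary.\<close>

definition property_PH :: "'x itself \<Rightarrow> ('g, 'b) monoid_scheme \<Rightarrow> bool" where
  "property_PH _ G \<longleftrightarrow>
     (\<exists>n (X :: nat \<Rightarrow> 'x set) d \<phi>.
        (\<forall>i<n. hyperbolic_space (X i) (d i)) \<and>
        isometric_action G (PiE {..<n} X) (l1_dist n d) \<phi> \<and>
        proper_action G (PiE {..<n} X) (l1_dist n d) \<phi> \<and>
        (\<forall>i<n. stabilizer_cobounded G n X d \<phi> i))"

definition finite_generating_set :: "('g, 'b) monoid_scheme \<Rightarrow> 'g set \<Rightarrow> bool" where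
  "finite_generating_set G S \<longleftrightarrow> finite S \<and> S \<subseteq> carrier G \<and> generate G S = carrier G"

definition word_length :: "('g, 'b) monoid_scheme \<Rightarrow> 'g set \<Rightarrow> 'g \<Rightarrow> nat" where
  "word_length G S g = (LEAST k. \<exists>w. set w \<subseteq> S \<union> m_inv G ` S \<and> length w = k \<and>
     foldr (mult G) w (one G) = g)"

definition word_dist :: "('g, 'b) monoid_scheme \<Rightarrow> 'g set \<Rightarrow> 'g \<Rightarrow> 'g \<Rightarrow> real" where
  "word_dist G S g h = real (word_length G S (m_inv G g \<otimes>\<^bsub>G\<^esub> h))"

definition property_QT :: "'x itself \<Rightarrow> 'v itself \<Rightarrow> ('g, 'b) monoid_scheme \<Rightarrow> bool" where
  "property_QT _ _ G \<longleftrightarrow>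
     (\<exists>S n (X :: nat \<Rightarrow> 'x set) d \<phi>.
        finite_generating_set G S \<and>
        (\<forall>i<n. quasi_tree TYPE('v) (X i) (d i)) \<and>
        isometric_action G (PiE {..<n} X) (l1_dist n d) \<phi> \<and>
        (\<exists>p\<in>PiE {..<n} X.
           qi_embedding (carrier G) (word_dist G S) (PiE {..<n} X) (l1_dist n d) (\<lambda>g. \<phi> g p)))"


section \<open>Group presentations and Baumslag--Solitar groups\<close>

text \<open>The letter \<open>(x, True)\<close> is the generator \<open>x\<close>, and \<open>(x, False)\<close> is its formal inverse. The group
  presented by a set \<open>R\<close> of relations \<open>u = v\<close> is the set of all words modulo the
  congruence generated by cancellation of inverse letters and by \<open>R\<close>.\<close>

type_synonym 'a word = "('a \<times> bool) list"

inductive_set word_cong :: "('a word \<times> 'a word) set \<Rightarrow> ('a word \<times> 'a word) set"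
  for R :: "('a word \<times> 'a word) set" where
  rel: "(u, v) \<in> R \<Longrightarrow> (u, v) \<in> word_cong R"
| cancel: "([(x, b), (x, \<not> b)], []) \<in> word_cong R"
| refl: "(u, u) \<in> word_cong R"
| sym: "(u, v) \<in> word_cong R \<Longrightarrow> (v, u) \<in> word_cong R"
| trans: "(u, v) \<in> word_cong R \<Longrightarrow> (v, w) \<in> word_cong R \<Longrightarrow> (u, w) \<in> word_cong R"
| append: "(u, v) \<in> word_cong R \<Longrightarrow> (u', v') \<in> word_cong R \<Longrightarrow> (u @ u', v @ v') \<in> word_cong R"

definition presented_group :: "('a word \<times> 'a word) set \<Rightarrow> 'a word set monoid" where
  "presented_group R =
     \<lparr>carrier = UNIV // word_cong R,
      mult = (\<lambda>A B. \<Union>u\<in>A. \<Union>v\<in>B. word_cong R `` {u @ v}),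
      one = word_cong R `` {[]}\<rparr>"

lemma equiv_word_cong: "equiv UNIV (word_cong R)"
  by (rule equivI) (auto simp: refl_on_def intro!: symI transI
      intro: word_cong.refl word_cong.sym word_cong.trans)

lemma presented_group_mult:
  "word_cong R `` {u} \<otimes>\<^bsub>presented_group R\<^esub> word_cong R `` {v} = word_cong R `` {u @ v}"
proof -
  have "congruent2 (word_cong R) (word_cong R) (\<lambda>u v. word_cong R `` {u @ v})"
    by (rule congruent2I')
      (meson equiv_class_eq equiv_word_cong word_cong.append)
  from UN_equiv_class2[OF equiv_word_cong equiv_word_cong this, of u v]
  show ?thesis by (simp add: presented_group_def)
qed

lemma word_cong_inverse: "\<exists>v. (v @ u, []) \<in> word_cong R"
proof (induction u)
  case Nil
  show ?case by (rule exI[of _ "[]"]) (simp add: word_cong.refl)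
next
  case (Cons l u)
  then obtain v where v: "(v @ u, []) \<in> word_cong R" by blast
  obtain x b where l: "l = (x, b)" by force
  have c: "([(x, \<not> b), l], []) \<in> word_cong R"
    using word_cong.cancel[of x "\<not> b" R] l by simp
  have "((v @ [(x, \<not> b), l]) @ u, (v @ []) @ u) \<in> word_cong R"
    by (intro word_cong.append word_cong.refl c)
  then have "((v @ [(x, \<not> b)]) @ l # u, []) \<in> word_cong R"
    using v by (auto intro: word_cong.trans)
  then show ?case by blast
qed

lemma group_presented_group: "group (presented_group R)"
proof (rule groupI)
  show one: "\<one>\<^bsub>presented_group R\<^esub> \<in> carrier (presented_group R)"
    by (simp add: presented_group_def quotientI)
  have ex: "\<exists>u. A = word_cong R `` {u}" if "A \<in> carrier (presented_group R)" for A
    using that by (auto simp: presented_group_def elim: quotientE)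
  have cl: "word_cong R `` {u} \<in> carrier (presented_group R)" for u
    by (simp add: presented_group_def quotientI)
  have o: "\<one>\<^bsub>presented_group R\<^esub> = word_cong R `` {[]}"
    by (simp add: presented_group_def)
  show "A \<otimes>\<^bsub>presented_group R\<^esub> B \<in> carrier (presented_group R)"
    if "A \<in> carrier (presented_group R)" "B \<in> carrier (presented_group R)" for A B
    using ex[OF that(1)] ex[OF that(2)] by (auto simp: presented_group_mult cl)
  show "A \<otimes>\<^bsub>presented_group R\<^esub> B \<otimes>\<^bsub>presented_group R\<^esub> C =
        A \<otimes>\<^bsub>presented_group R\<^esub> (B \<otimes>\<^bsub>presented_group R\<^esub> C)"
    if "A \<in> carrier (presented_group R)" "B \<in> carrier (presented_group R)"
      "C \<in> carrier (presented_group R)" for A B C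
    using ex[OF that(1)] ex[OF that(2)] ex[OF that(3)] by (auto simp: presented_group_mult)
  show "\<one>\<^bsub>presented_group R\<^esub> \<otimes>\<^bsub>presented_group R\<^esub> A = A"
    if "A \<in> carrier (presented_group R)" for A
    using ex[OF that] by (auto simp: presented_group_mult o)
  show "\<exists>B\<in>carrier (presented_group R). B \<otimes>\<^bsub>presented_group R\<^esub> A = \<one>\<^bsub>presented_group R\<^esub>"
    if A: "A \<in> carrier (presented_group R)" for A
  proof -
    obtain u where u: "A = word_cong R `` {u}" using ex[OF A] by blast
    obtain v where "(v @ u, []) \<in> word_cong R" using word_cong_inverse by blast
    then have "word_cong R `` {v} \<otimes>\<^bsub>presented_group R\<^esub> A = \<one>\<^bsub>presented_group R\<^esub>"
      by (simp add: u o presented_group_mult equiv_class_eq[OF equiv_word_cong])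
    then show ?thesis using cl by blast
  qed
qed

datatype bs_gen = Gen_a | Gen_t

definition BS1 :: "nat \<Rightarrow> bs_gen word set monoid" where
  "BS1 n = presented_group
     {([(Gen_t, True), (Gen_a, True), (Gen_t, False)], replicate n (Gen_a, True))}"


section \<open>Fundamental groups of Anosov mapping tori\<close>

definition real_matrix :: "int ^ 'n ^ 'm \<Rightarrow> real ^ 'n ^ 'm" where
  "real_matrix A = (\<chi> i j. of_int (A $ i $ j))"

definition eigenvalue :: "real ^ 'n ^ 'n \<Rightarrow> real \<Rightarrow> bool" where
  "eigenvalue A l \<longleftrightarrow> (\<exists>v. v \<noteq> 0 \<and> A *v v = l *s v)"

definition SL2Z :: "(int ^ 2 ^ 2) set" where
  "SL2Z = {A. det A = 1}"

definition anosov :: "int ^ 2 ^ 2 \<Rightarrow> bool" where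
  "anosov A \<longleftrightarrow> A \<in> SL2Z \<and>
     (\<exists>l. l > 1 \<and> l \<notin> \<rat> \<and> inverse l \<notin> \<rat> \<and>
        eigenvalue (real_matrix A) l \<and> eigenvalue (real_matrix A) (inverse l))"

definition semidirect_product ::
    "('n, 'b) monoid_scheme \<Rightarrow> ('h, 'c) monoid_scheme \<Rightarrow> ('h \<Rightarrow> 'n \<Rightarrow> 'n) \<Rightarrow> ('n \<times> 'h) monoid" where
  "semidirect_product N H \<theta> =
     \<lparr>carrier = carrier N \<times> carrier H,
      mult = (\<lambda>(x, g) (y, h). (x \<otimes>\<^bsub>N\<^esub> \<theta> g y, g \<otimes>\<^bsub>H\<^esub> h)),
      one = (\<one>\<^bsub>N\<^esub>, \<one>\<^bsub>H\<^esub>)\<rparr>"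

lemma group_semidirect_product:
  assumes N: "group N" and H: "group H" and \<theta>: "\<theta> \<in> hom H (AutoGroup N)"
  shows "group (semidirect_product N H \<theta>)"
proof -
  interpret N: group N by fact
  interpret H: group H by fact
  interpret A: group "AutoGroup N" by (rule N.AutoGroup)
  interpret T: group_hom H "AutoGroup N" \<theta>
    using \<theta> by unfold_locales
  have auto: "\<theta> g \<in> hom N N" "bij_betw (\<theta> g) (carrier N) (carrier N)"
    if "g \<in> carrier H" for g
    using T.hom_closed[OF that] by (auto simp: AutoGroup_def auto_def Bij_def)
  have mem: "\<theta> g x \<in> carrier N" if "g \<in> carrier H" "x \<in> carrier N" for g x
    using auto(1)[OF that(1)] that(2) by (auto simp: hom_def)
  have mul: "\<theta> g (x \<otimes>\<^bsub>N\<^esub> y) = \<theta> g x \<otimes>\<^bsub>N\<^esub> \<theta> g y"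
    if "g \<in> carrier H" "x \<in> carrier N" "y \<in> carrier N" for g x y
    using auto(1)[OF that(1)] that(2,3) by (auto simp: hom_def)
  have one: "\<theta> \<one>\<^bsub>H\<^esub> x = x" if "x \<in> carrier N" for x
    using T.hom_one that by (simp add: AutoGroup_def BijGroup_def)
  have comp: "\<theta> (g \<otimes>\<^bsub>H\<^esub> h) x = \<theta> g (\<theta> h x)"
    if g: "g \<in> carrier H" and h: "h \<in> carrier H" and x: "x \<in> carrier N" for g h x
    using T.hom_mult[OF g h] T.hom_closed[OF g] T.hom_closed[OF h] x
    by (simp add: AutoGroup_def BijGroup_def auto_def compose_def)
  show ?thesis
  proof (rule groupI)
    fix p assume "p \<in> carrier (semidirect_product N H \<theta>)"
    then obtain x g where p: "p = (x, g)" "x \<in> carrier N" "g \<in> carrier H"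
      by (auto simp: semidirect_product_def)
    let ?q = "(\<theta> (inv\<^bsub>H\<^esub> g) (inv\<^bsub>N\<^esub> x), inv\<^bsub>H\<^esub> g)"
    have "\<theta> (inv\<^bsub>H\<^esub> g) (inv\<^bsub>N\<^esub> x) \<otimes>\<^bsub>N\<^esub> \<theta> (inv\<^bsub>H\<^esub> g) x = \<theta> (inv\<^bsub>H\<^esub> g) \<one>\<^bsub>N\<^esub>"
      using p mul[of "inv\<^bsub>H\<^esub> g" "inv\<^bsub>N\<^esub> x" x] by simp
    also have "\<dots> = \<one>\<^bsub>N\<^esub>"
      using auto(1)[of "inv\<^bsub>H\<^esub> g"] p hom_one[of "\<theta> (inv\<^bsub>H\<^esub> g)" N N] by (simp add: N)
    finally show "\<exists>q\<in>carrier (semidirect_product N H \<theta>).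
        q \<otimes>\<^bsub>semidirect_product N H \<theta>\<^esub> p = \<one>\<^bsub>semidirect_product N H \<theta>\<^esub>"
      using p mem[OF H.inv_closed[OF p(3)] N.inv_closed[OF p(2)]]
      by (intro bexI[of _ ?q]) (auto simp: semidirect_product_def simp del: T.hom_inv)
  qed (auto simp: semidirect_product_def mem mul one comp N.m_assoc H.m_assoc
      simp del: T.hom_mult T.hom_one)
qed

definition Z2_group :: "(int ^ 2) monoid" where
  "Z2_group = \<lparr>carrier = UNIV, mult = (+), one = 0\<rparr>"

text \<open>\<open>mapping_torus_group A\<close> is \<open>\<int>\<^sup>2 \<rtimes>\<^sub>A \<int>\<close>, in which the integer \<open>m\<close> acts by the \<open>m\<close>-th power of \<open>A\<close>,
  computed in the automorphism group so that negative \<open>m\<close> makes sense.\<close>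

definition mapping_torus_group :: "int ^ 2 ^ 2 \<Rightarrow> ((int ^ 2) \<times> int) monoid" where
  "mapping_torus_group A = semidirect_product Z2_group integer_group
     (\<lambda>m::int. (\<lambda>v. A *v v) [^]\<^bsub>AutoGroup Z2_group\<^esub> m)"

lemma group_Z2_group: "group Z2_group"
  unfolding Z2_group_def
  by (rule groupI) (auto simp: algebra_simps intro: exI[of _ "- x" for x :: "int ^ 2"])

lemma SL2Z_in_AutoGroup:
  assumes "A \<in> SL2Z"
  shows "(\<lambda>v. A *v v) \<in> carrier (AutoGroup Z2_group)"
proof -
  define B :: "int ^ 2 ^ 2" where
    "B = vector [vector [A$2$2, - A$1$2], vector [- A$2$1, A$1$1]]"
  have d: "A$1$1 * A$2$2 - A$1$2 * A$2$1 = 1"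
    using assms by (simp add: SL2Z_def det_2)
  have AB: "A ** B = mat 1" "B ** A = mat 1"
    using d by (simp_all add: B_def vec_eq_iff matrix_matrix_mult_def mat_def forall_2 sum_2
        algebra_simps)
  have "bij (\<lambda>v. A *v v)"
    by (rule bij_betw_byWitness[where f' = "\<lambda>v. B *v v"])
      (auto simp: matrix_vector_mul_assoc AB)
  then show ?thesis
    by (auto simp: AutoGroup_def auto_def Bij_def hom_def Z2_group_def
        matrix_vector_right_distrib)
qed

lemma group_mapping_torus_group: "A \<in> SL2Z \<Longrightarrow> group (mapping_torus_group A)"
  unfolding mapping_torus_group_def
  by (intro group_semidirect_product group_Z2_group group_integer_group
      group.hom_integer_group_pow group.AutoGroup SL2Z_in_AutoGroup)

end

(*
  PH: BS(1,n) acts properly on the product of the hyperbolic plane and its Bass-Serre tree, and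
  Z^2 x| Z on the product of two hyperbolic planes, one for each eigenline. Each factor is cobounded
  because the translations rescaled by powers of the stable letter are coarsely dense at every scale.

  Not QT: an isometry of an l1-product of quasi-trees maps each fibre of a factor to a set that is
  convex for metric intervals, hence a product set. Rectangles with two long sides do not embed
  quasi-isometrically in a tree, so this set is thin in all directions but one, and the isometry
  permutes the unbounded factors up to bounded error. A power b of an element of infinite order fixes
  all of them and acts coarsely isometrically on each quasi-tree. There its orbits are bounded or
  grow linearly: quasi-trees have no parabolic isometries. Since the orbit map is a quasi-isometric
  embedding, b is undistorted. But a^(n^i) = t^i a t^-i in BS(1,n), and
  A^i v + A^-i v = tr(A^i) v, so both groups contain exponentially distorted elements.
*)
theory Submission
  imports Defs
begin

section \<open>Trees are 0-hyperbolic\<close>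

text \<open>The obstacle is that isometries of an l1-product need not permute the factors exactly
  (bounded pieces can be exchanged between factors), and that quasi-trees are arbitrary metric
  spaces, without geodesics to which a splitting theorem would apply. Two exact facts are available:
  isometries preserve metric intervals, and tree metrics satisfy the four-point condition. All else
  is coarse, so errors must be bounded independently of the isometry (\<open>K0\<close>,
  \<open>B0\<close>); otherwise they would accumulate along the powers of b. Even then these powers
  induce no action on a single factor. What is left is a four-point metric on the integers, pulled
  back along the orbit of b, that all shifts distort by the same constants, and linear growth is
  proved for such metrics alone. That trees are used here is essential: on the hyperbolic planes of
  the PH action the distorted elements act by horizontal translations, whose orbits grow
  logarithmically. The planes and the tree are given by explicit heights, so that the groups act by
  exact isometries; one criterion, the distance being twice a top height minus the two heights up to
  bounded error, shows hyperbolicity of both.\<close>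

locale four_point =
  fixes V :: "'v set" and E :: "'v \<Rightarrow> 'v \<Rightarrow> real"
  assumes sym: "x \<in> V \<Longrightarrow> y \<in> V \<Longrightarrow> E x y = E y x"
    and self: "x \<in> V \<Longrightarrow> E x x = 0"
    and four: "x \<in> V \<Longrightarrow> y \<in> V \<Longrightarrow> z \<in> V \<Longrightarrow> w \<in> V \<Longrightarrow>
      E x z + E y w \<le> max (E x y + E z w) (E x w + E y z)"
begin

lemma nonneg: "x \<in> V \<Longrightarrow> y \<in> V \<Longrightarrow> 0 \<le> E x y"
  using four[of x y x y] self sym[of x y] by auto

lemma triangle: "x \<in> V \<Longrightarrow> y \<in> V \<Longrightarrow> z \<in> V \<Longrightarrow> E x z \<le> E x y + E y z"
  using four[of x y z y] self[of y] sym[of z y] by auto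

lemma gromov_ge:
  assumes "w \<in> V" "x \<in> V" "y \<in> V" "z \<in> V"
  shows "min (gromov_product E w x y) (gromov_product E w y z) \<le> gromov_product E w x z"
  using four[of x y z w] assms by (auto simp: gromov_product_def min_def max_def divide_simps split: if_splits)

lemma gromov_le: "w \<in> V \<Longrightarrow> x \<in> V \<Longrightarrow> y \<in> V \<Longrightarrow> gromov_product E w x y \<le> E w x"
  using triangle[of y x w] sym[of w x] sym[of w y] sym[of x y] by (auto simp: gromov_product_def)

end

lemma walk_Cons:
  "walk V E (u # p) \<longleftrightarrow> u \<in> V \<and> (p = [] \<or> ((u, hd p) \<in> E \<and> walk V E p))"
  by (cases p) (auto simp: walk_def)

lemma walk_append:
  assumes "walk V E p" "walk V E q" "(last p, hd q) \<in> E"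
  shows "walk V E (p @ q)"
  using assms by (auto simp: walk_def successively_append_iff)

lemma walk_rev:
  assumes "walk V E p" "Relation.sym E"
  shows "walk V E (rev p)"
  using assms by (auto simp: walk_def successively_rev sym_def elim!: successively_mono)

locale tree_graph =
  fixes V :: "'v set" and E :: "('v \<times> 'v) set" and r :: 'v
  assumes tree: "tree V E" and root: "r \<in> V"
begin

definition gdist :: "'v \<Rightarrow> 'v \<Rightarrow> nat" where
  "gdist u v = (LEAST k. \<exists>p. walk V E p \<and> hd p = u \<and> last p = v \<and> length p = Suc k)"

lemma edge_sym: "(u, v) \<in> E \<Longrightarrow> (v, u) \<in> E"
  using tree unfolding tree_def by (elim conjE) (rule symD)

lemma edge_in: "(u, v) \<in> E \<Longrightarrow> u \<in> V \<and> v \<in> V \<and> u \<noteq> v"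
  using tree unfolding tree_def irrefl_def by (elim conjE) blast

lemma gdist_walk:
  assumes "u \<in> V" "v \<in> V"
  shows "\<exists>p. walk V E p \<and> hd p = u \<and> last p = v \<and> length p = Suc (gdist u v)"
proof -
  have "\<forall>u\<in>V. \<forall>v\<in>V. \<exists>p. walk V E p \<and> hd p = u \<and> last p = v"
    using tree unfolding tree_def by (elim conjE)
  then obtain p where p: "walk V E p" "hd p = u" "last p = v"
    using assms by blast
  obtain k where "length p = Suc k" using p by (cases p) (auto simp: walk_def)
  with p have "\<exists>k. \<exists>p. walk V E p \<and> hd p = u \<and> last p = v \<and> length p = Suc k" by blast
  then show ?thesis unfolding gdist_def by (rule LeastI_ex)
qed

lemma gdist_le: "walk V E p \<Longrightarrow> hd p = u \<Longrightarrow> last p = v \<Longrightarrow> length p = Suc k \<Longrightarrow> gdist u v \<le> k"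
  unfolding gdist_def by (rule Least_le) blast

lemma gdist_edge:
  assumes "u \<in> V" "(v, w) \<in> E"
  shows "gdist u w \<le> Suc (gdist u v)"
proof -
  obtain p where p: "walk V E p" "hd p = u" "last p = v" "length p = Suc (gdist u v)"
    using gdist_walk assms edge_in by blast
  then have "walk V E (p @ [w])" using assms edge_in[of v w] by (intro walk_append) (auto simp: walk_def)
  with p show ?thesis by (intro gdist_le[of "p @ [w]"]) (auto simp: walk_def)
qed

section \<open>Rooted structure of a tree: depth and parents\<close>

abbreviation depth :: "'v \<Rightarrow> nat" where "depth v \<equiv> gdist r v"

lemma depth_0: "v \<in> V \<Longrightarrow> depth v = 0 \<longleftrightarrow> v = r"
proof
  assume "v \<in> V" "depth v = 0"
  then obtain p where "walk V E p" "hd p = r" "last p = v" "length p = Suc 0"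
    using gdist_walk[OF root] by metis
  then show "v = r" by (cases p) auto
next
  assume "v = r"
  then show "depth v = 0" using gdist_le[of "[r]" r r 0] root by (auto simp: walk_def)
qed

lemma parent_ex:
  assumes "v \<in> V" "depth v = Suc k"
  shows "\<exists>u. (u, v) \<in> E \<and> depth u = k"
proof -
  obtain p where p: "walk V E p" "hd p = r" "last p = v" "length p = Suc (Suc k)"
    using gdist_walk[OF root assms(1)] assms(2) by metis
  define q where "q = butlast p"
  have "p \<noteq> []" using p(4) by auto
  then have pq: "p = q @ [v]" unfolding q_def p(3)[symmetric] by simp
  then have ne: "q \<noteq> []" "length q = Suc k" using p(4) by auto
  have w: "walk V E q" "hd q = r" "(last q, v) \<in> E"
    using p(1,2) ne unfolding pq by (auto simp: walk_def successively_append_iff)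
  have "depth (last q) \<le> k" using gdist_le[OF w(1,2) HOL.refl ne(2)] .
  moreover have "Suc k \<le> Suc (depth (last q))" using gdist_edge[OF root w(3)] assms by simp
  ultimately show ?thesis using w by (intro exI[of _ "last q"]) auto
qed

text \<open>Step from both vertices to parents: if these coincide, three vertices form the path;
  otherwise the path between the parents is extended at both ends. The depth bound keeps the new
  ends, one level deeper, off the old path. Such paths are then closed up to forbidden
  cycles.\<close>

lemma simple_path_below:
  assumes "u \<in> V" "v \<in> V" "u \<noteq> v" "depth u = k" "depth v = k"
  shows "\<exists>p. walk V E p \<and> hd p = u \<and> last p = v \<and> distinct p \<and> length p \<ge> 3 \<and> (\<forall>x\<in>set p. depth x \<le> k)"
  using assms
proof (induction k arbitrary: u v)
  case 0
  then show ?case using depth_0 by auto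
next
  case (Suc k)
  obtain a where a: "(a, u) \<in> E" "depth a = k" using parent_ex Suc by blast
  obtain b where b: "(b, v) \<in> E" "depth b = k" using parent_ex Suc by blast
  show ?case
  proof (cases "a = b")
    case True
    have "walk V E [u, a, v]" "distinct [u, a, v]"
      using a b True edge_in[OF a(1)] edge_in[OF b(1)] edge_sym[OF a(1)] Suc by (auto simp: walk_def)
    then show ?thesis using a Suc by (intro exI[of _ "[u, a, v]"]) auto
  next
    case False
    then obtain p where p: "walk V E p" "hd p = a" "last p = b" "distinct p" "length p \<ge> 3"
        "\<forall>x\<in>set p. depth x \<le> k"
      using Suc.IH[of a b] a b edge_in by blast
    have n: "u \<notin> set p" "v \<notin> set p" using p Suc.prems by auto
    have "walk V E (u # p)" using p a edge_sym[OF a(1)] Suc by (auto simp: walk_Cons)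
    then have "walk V E ((u # p) @ [v])"
      using p b Suc by (intro walk_append) (auto simp: walk_def)
    then show ?thesis using p n Suc.prems
      by (intro exI[of _ "u # p @ [v]"]) (auto simp: le_Suc_eq)
  qed
qed

lemma no_cycle: "\<not> cycle V E p"
  using tree unfolding tree_def by blast

text \<open>An edge between vertices of equal depth would close the path of
  \<open>simple_path_below\<close> into a cycle.\<close>

lemma edge_depth:
  assumes "(u, v) \<in> E"
  shows "depth v = Suc (depth u) \<or> depth u = Suc (depth v)"
proof -
  have "depth u \<noteq> depth v"
  proof
    assume e: "depth u = depth v"
    obtain p where "walk V E p" "hd p = u" "last p = v" "distinct p" "length p \<ge> 3"
      using simple_path_below[OF _ _ _ HOL.refl e[symmetric]] edge_in[OF assms] by blast
    then show False using no_cycle[of p] edge_sym[OF assms] by (auto simp: cycle_def)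
  qed
  then show ?thesis using gdist_edge[OF root assms] gdist_edge[OF root edge_sym[OF assms]] by linarith
qed

text \<open>Two such neighbours of \<open>v\<close> have equal depth, so a simple path joins them
  without reaching the depth of \<open>v\<close>; adding \<open>v\<close> would complete a
  cycle.\<close>

lemma parent_unique:
  assumes "(a, v) \<in> E" "(b, v) \<in> E" "depth v = Suc (depth a)" "depth v = Suc (depth b)"
  shows "a = b"
proof (rule ccontr)
  assume "a \<noteq> b"
  have "depth b = depth a" using assms(3,4) by simp
  then obtain p where p: "walk V E p" "hd p = a" "last p = b" "distinct p" "length p \<ge> 3"
      "\<forall>x\<in>set p. depth x \<le> depth a"
    using simple_path_below[OF _ _ \<open>a \<noteq> b\<close> HOL.refl] edge_in[OF assms(1)] edge_in[OF assms(2)] by blast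
  have "v \<notin> set p" using p(6) assms(3) by auto
  then have "cycle V E (v # p)"
    using p(1-5) edge_sym[OF assms(1)] edge_in[OF assms(1)] assms(2) by (auto simp: cycle_def walk_Cons)
  then show False using no_cycle by blast
qed

text \<open>The root is its own parent, so that iterates stay in \<open>V\<close>.\<close>

definition parent :: "'v \<Rightarrow> 'v" where
  "parent v = (if v = r then r else (SOME u. (u, v) \<in> E \<and> depth v = Suc (depth u)))"

lemma parent:
  assumes "v \<in> V" "v \<noteq> r"
  shows "(parent v, v) \<in> E" "depth v = Suc (depth (parent v))"
proof -
  obtain k where "depth v = Suc k" using depth_0[OF assms(1)] assms(2) by (cases "depth v") auto
  then have "\<exists>u. (u, v) \<in> E \<and> depth v = Suc (depth u)" using parent_ex assms by metis
  from someI_ex[OF this] have "(parent v, v) \<in> E \<and> depth v = Suc (depth (parent v))"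
    unfolding parent_def if_not_P[OF assms(2)] .
  then show "(parent v, v) \<in> E" "depth v = Suc (depth (parent v))" by blast+
qed

lemma edge_parent:
  assumes "(u, v) \<in> E" "depth v = Suc (depth u)"
  shows "parent v = u"
proof -
  have v: "v \<in> V" "v \<noteq> r" using edge_in[OF assms(1)] depth_0[of v] assms(2) by auto
  show ?thesis
    by (rule parent_unique[OF parent(1)[OF v] assms(1) parent(2)[OF v] assms(2)])
qed

section \<open>Ancestors, meets and a formula for the tree distance\<close>

definition ancestor :: "'v \<Rightarrow> nat \<Rightarrow> 'v" where
  "ancestor v k = (parent ^^ (depth v - k)) v"

lemma parent_in: "v \<in> V \<Longrightarrow> parent v \<in> V"
  using edge_in[OF parent(1)[of v]] root by (cases "v = r") (simp_all add: parent_def)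

lemma ancestor_parent:
  assumes "v \<in> V" "v \<noteq> r" "k \<le> depth (parent v)"
  shows "ancestor v k = ancestor (parent v) k"
proof -
  have "depth v - k = Suc (depth (parent v) - k)" using parent(2)[OF assms(1,2)] assms(3) by linarith
  then show ?thesis unfolding ancestor_def by (simp only: funpow_Suc_right comp_apply)
qed

lemma ancestor_self: "ancestor v (depth v) = v"
  by (simp add: ancestor_def)

lemma ancestor_Suc:
  assumes "v \<in> V" "Suc k \<le> depth v"
  shows "parent (ancestor v (Suc k)) = ancestor v k"
proof -
  have *: "depth v - k = Suc (depth v - Suc k)" using assms by linarith
  show ?thesis unfolding ancestor_def * by (simp only: funpow.simps comp_apply)
qed

lemma ancestor_root: "v \<in> V \<Longrightarrow> ancestor v 0 = r"
proof (induction "depth v" arbitrary: v)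
  case 0
  then show ?case using depth_0[of v] by (simp add: ancestor_def)
next
  case (Suc k)
  then have "v \<noteq> r" using depth_0[of v] by auto
  then have "k = depth (parent v)" using Suc.hyps(2) parent(2)[OF Suc.prems] by linarith
  then show ?case using Suc.hyps(1) ancestor_parent[OF Suc.prems \<open>v \<noteq> r\<close>, of 0] parent_in[OF Suc.prems] by simp
qed

text \<open>The depth bounds matter: by truncated subtraction \<open>ancestor v k\<close> is
  \<open>v\<close> itself once \<open>k\<close> exceeds the depth of \<open>v\<close>.\<close>

definition agree :: "'v \<Rightarrow> 'v \<Rightarrow> nat \<Rightarrow> bool" where
  "agree x y k \<longleftrightarrow> k \<le> depth x \<and> k \<le> depth y \<and> ancestor x k = ancestor y k"

text \<open>The depth of the last common ancestor, which is the Gromov product at the root. Its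
  ultrametric inequality \<open>meet_ultra\<close> is the source of 0-hyperbolicity.\<close>

definition meet :: "'v \<Rightarrow> 'v \<Rightarrow> nat" where "meet x y = (GREATEST k. agree x y k)"

lemma agree_meet: "x \<in> V \<Longrightarrow> y \<in> V \<Longrightarrow> agree x y (meet x y)"
  unfolding meet_def
  by (rule GreatestI_nat[of _ 0 "depth x"]) (auto simp: agree_def ancestor_root)

lemma meet_ge: "agree x y k \<Longrightarrow> k \<le> meet x y"
  unfolding meet_def by (rule Greatest_le_nat[of _ _ "depth x"]) (auto simp: agree_def)

lemma agree_down:
  assumes "x \<in> V" "y \<in> V" "agree x y k" "j \<le> k"
  shows "agree x y j"
  using assms(4,3)
proof (induction rule: inc_induct)
  case (step m)
  then have "agree x y (Suc m)" by blast
  then show ?case using ancestor_Suc[OF assms(1), of m] ancestor_Suc[OF assms(2), of m]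
    by (auto simp: agree_def)
qed

lemma agree_iff: "x \<in> V \<Longrightarrow> y \<in> V \<Longrightarrow> agree x y k \<longleftrightarrow> k \<le> meet x y"
  using agree_down agree_meet meet_ge by blast

lemma meet_sym: "meet x y = meet y x"
  unfolding meet_def agree_def by metis

lemma meet_self: "x \<in> V \<Longrightarrow> meet x x = depth x"
  using agree_meet[of x x] meet_ge[of x x "depth x"] by (auto simp: agree_def)

lemma meet_ultra:
  assumes "x \<in> V" "y \<in> V" "z \<in> V"
  shows "min (meet x y) (meet y z) \<le> meet x z"
proof -
  have "agree x y (min (meet x y) (meet y z))" "agree y z (min (meet x y) (meet y z))"
    using assms by (auto simp: agree_iff)
  then show ?thesis by (intro meet_ge) (auto simp: agree_def)
qed

text \<open>Up to the depth of \<open>u\<close> the ancestors of \<open>u\<close> and of its child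
  \<open>v\<close> coincide, so only the level of \<open>v\<close> can be gained, and only if
  \<open>u\<close> is itself an ancestor of \<open>x\<close>.\<close>

lemma meet_edge:
  assumes x: "x \<in> V" and e: "(u, v) \<in> E" and d: "depth v = Suc (depth u)"
  shows "meet x v = meet x u \<or> (meet x v = Suc (meet x u) \<and> meet x u = depth u)"
proof -
  have V: "u \<in> V" "v \<in> V" "parent v = u" "v \<noteq> r"
    using edge_in[OF e] edge_parent[OF e d] d depth_0[of v] by auto
  have *: "agree x v k \<longleftrightarrow> agree x u k" if "k \<le> depth u" for k
    using ancestor_parent[of v k] V that d by (auto simp: agree_def)
  have m: "meet x v \<le> Suc (depth u)" "meet x u \<le> depth u"
    using agree_meet[OF x V(1)] agree_meet[OF x V(2)] d by (auto simp: agree_def)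
  have ge: "meet x u \<le> meet x v"
    using *[OF m(2)] agree_meet[OF x V(1)] meet_ge by blast
  show ?thesis
  proof (cases "meet x v \<le> depth u")
    case True
    then show ?thesis using * agree_meet[OF x V(2)] meet_ge[of x u "meet x v"] ge by auto
  next
    case False
    then have "meet x v = Suc (depth u)" using m by simp
    moreover have "agree x v (depth u)" using agree_down[OF x V(2) agree_meet[OF x V(2)]] False by simp
    ultimately show ?thesis using * meet_ge[of x u "depth u"] m by auto
  qed
qed

text \<open>The length of the route through the last common ancestor, which is a walk and so bounds
  \<open>gdist\<close> above. It bounds \<open>gdist\<close> below because it grows by at most 1
  along an edge.\<close>

definition tdist :: "'v \<Rightarrow> 'v \<Rightarrow> int" where
  "tdist x y = int (depth x) + int (depth y) - 2 * int (meet x y)"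

lemma tdist_edge:
  assumes "x \<in> V" "(u, v) \<in> E"
  shows "tdist x v \<le> tdist x u + 1"
  using edge_depth[OF assms(2)] meet_edge[OF assms] meet_edge[OF assms(1) edge_sym[OF assms(2)]]
  by (auto simp: tdist_def)

lemma tdist_walk:
  assumes "walk V E p" "x = hd p"
  shows "tdist x (last p) \<le> int (length p) - 1"
  using assms
proof (induction p rule: rev_induct)
  case Nil
  then show ?case by (simp add: walk_def)
next
  case (snoc v p)
  show ?case
  proof (cases "p = []")
    case True
    then show ?thesis using snoc by (auto simp: walk_def tdist_def meet_self)
  next
    case False
    then have "walk V E p" "(last p, v) \<in> E" "x = hd p" "x \<in> V"
      using snoc by (auto simp: walk_def successively_append_iff)
    then show ?thesis using snoc.IH tdist_edge[of x "last p" v] by simp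
  qed
qed

lemma gdist_sym:
  assumes "u \<in> V" "v \<in> V"
  shows "gdist u v = gdist v u"
proof -
  have "gdist v u \<le> gdist u v" if uv: "u \<in> V" "v \<in> V" for u v
  proof -
    obtain p where "walk V E p" "hd p = u" "last p = v" "length p = Suc (gdist u v)"
      using gdist_walk[OF uv] by blast
    then show ?thesis using walk_rev[of V E p] edge_sym
      by (intro gdist_le[of "rev p"]) (auto simp: sym_def hd_rev last_rev)
  qed
  then show "gdist u v = gdist v u" using assms by (intro le_antisym)
qed

lemma gdist_triangle:
  assumes "u \<in> V" "v \<in> V" "w \<in> V"
  shows "gdist u w \<le> gdist u v + gdist v w"
proof -
  obtain p where p: "walk V E p" "hd p = u" "last p = v" "length p = Suc (gdist u v)"
    using gdist_walk assms by blast
  obtain q where q: "walk V E q" "hd q = v" "last q = w" "length q = Suc (gdist v w)"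
    using gdist_walk assms by blast
  show ?thesis
  proof (cases "tl q = []")
    case True
    then have "q = [v]" using q by (cases q) (auto simp: walk_def)
    then show ?thesis using q by auto
  next
    case False
    obtain q' where q': "q = v # q'" "q' \<noteq> []" using q False by (cases q) auto
    then have "walk V E (p @ q')"
      using p q q' by (intro walk_append) (auto simp: walk_def neq_Nil_conv)
    then show ?thesis using p q q' by (intro gdist_le[of "p @ q'"]) (auto simp: walk_def)
  qed
qed

lemma gdist_ancestor:
  assumes "v \<in> V" "k \<le> depth v"
  shows "ancestor v k \<in> V \<and> gdist v (ancestor v k) \<le> depth v - k"
  using assms(2)
proof (induction rule: inc_induct)
  case base
  show ?case using assms ancestor_self[of v] gdist_le[of "[v]" v v 0] by (auto simp: walk_def)
next
  case (step m)
  define a where "a = ancestor v (Suc m)"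
  have a: "a \<in> V" "gdist v a \<le> depth v - Suc m" "ancestor v m = parent a"
    using step ancestor_Suc[OF assms(1), of m] by (auto simp: a_def)
  have "gdist v (parent a) \<le> Suc (gdist v a)"
  proof (cases "a = r")
    case True
    then show ?thesis by (simp add: parent_def)
  next
    case False
    then show ?thesis using gdist_edge[OF assms(1) edge_sym[OF parent(1)[OF a(1)]]] by simp
  qed
  then show ?case using a parent_in[OF a(1)] step by auto
qed

lemma gdist_eq_tdist:
  assumes "x \<in> V" "y \<in> V"
  shows "int (gdist x y) = tdist x y"
proof -
  obtain p where "walk V E p" "hd p = x" "last p = y" "length p = Suc (gdist x y)"
    using gdist_walk assms by blast
  then have 1: "tdist x y \<le> int (gdist x y)" using tdist_walk[of p x] by auto
  define k where "k = meet x y"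
  have k: "k \<le> depth x" "k \<le> depth y" "ancestor x k = ancestor y k"
    using agree_meet[OF assms] by (auto simp: agree_def k_def)
  have "gdist x y \<le> gdist x (ancestor x k) + gdist (ancestor x k) y"
    using gdist_triangle gdist_ancestor assms k by blast
  also have "\<dots> \<le> (depth x - k) + (depth y - k)"
    using gdist_ancestor[OF assms(1) k(1)] gdist_ancestor[OF assms(2) k(2)] k(3)
      gdist_sym[OF assms(2), of "ancestor y k"] by simp
  finally show ?thesis using 1 k by (simp add: tdist_def k_def)
qed

lemma four_point_path_dist: "four_point V (path_dist V E)"
proof
  have pd: "path_dist V E x y = of_int (tdist x y)" if "x \<in> V" "y \<in> V" for x y
    unfolding path_dist_def gdist_def[symmetric] gdist_eq_tdist[OF that, symmetric] by simp
  fix x y assume x: "x \<in> V" and y: "y \<in> V"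
  show "path_dist V E x y = path_dist V E y x"
    using x y by (simp add: pd tdist_def meet_sym)
  show "path_dist V E x x = 0" using x by (simp add: pd tdist_def meet_self)
  fix z w assume z: "z \<in> V" and w: "w \<in> V"
  \<comment> \<open>The depths cancel; what remains is that \<open>meet x z + meet y w\<close> is at
    least the smaller of the other two sums of meets, and four ultrametric inequalities give
    it.\<close>
  have "tdist x z + tdist y w \<le> max (tdist x y + tdist z w) (tdist x w + tdist y z)"
    using meet_ultra[OF x y z] meet_ultra[OF x w z] meet_ultra[OF y x w] meet_ultra[OF y z w]
      meet_sym[of w z] meet_sym[of y x]
    unfolding min_le_iff_disj le_max_iff_disj tdist_def by linarith
  then show "path_dist V E x z + path_dist V E y w
      \<le> max (path_dist V E x y + path_dist V E z w) (path_dist V E x w + path_dist V E y z)"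
    using x y z w by (simp add: pd flip: of_int_add of_int_max)
qed

end

lemma tree_four_point:
  assumes "tree V E"
  shows "four_point V (path_dist V E)"
proof -
  obtain r where "r \<in> V" using assms unfolding tree_def by blast
  then interpret tree_graph V E r using assms by unfold_locales
  show ?thesis by (rule four_point_path_dist)
qed

lemma path_dist_edge:
  assumes "tree V E" "(u, v) \<in> E"
  shows "path_dist V E u v \<le> 1"
proof -
  have "u \<in> V" using assms unfolding tree_def by blast
  then interpret tree_graph V E u using assms by unfold_locales
  have "gdist u v \<le> 1" using assms edge_in[OF assms(2)]
    by (intro gdist_le[of "[u, v]"]) (auto simp: walk_def)
  then show ?thesis by (simp add: path_dist_def gdist_def)
qed

section \<open>Coarse paths in 0-hyperbolic spaces\<close>

context four_point
begin

lemma dist_eq_gromov: "E x y = E w x + E w y - 2 * gromov_product E w x y"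
  if "x \<in> V" "y \<in> V" "w \<in> V"
  using that sym[of x w] sym[of y w] by (simp add: gromov_product_def field_simps)

lemma gromov_sym: "x \<in> V \<Longrightarrow> y \<in> V \<Longrightarrow> gromov_product E w x y = gromov_product E w y x"
  using sym[of x y] by (simp add: gromov_product_def)

text \<open>The Gromov product \<open>(z\<^sub>j | z\<^sub>N)\<close> based at \<open>z\<^sub>0\<close> measures how far along \<open>[z\<^sub>0, z\<^sub>N]\<close> the point
  \<open>z\<^sub>j\<close> projects; at the first time it exceeds \<open>r\<close> the path must itself be close to the segment.\<close>

lemma coarse_path_crossing:
  fixes N :: nat
  assumes z: "\<And>k. k \<le> N \<Longrightarrow> z k \<in> V"
    and step: "\<And>k. k < N \<Longrightarrow> E (z k) (z (Suc k)) \<le> s"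
    and r: "r \<le> E (z 0) (z N)" "0 \<le> r" and s: "0 \<le> s"
  shows "\<exists>j\<le>N. r \<le> gromov_product E (z 0) (z j) (z N) \<and> E (z 0) (z j) \<le> r + s"
proof -
  define p where "p j = gromov_product E (z 0) (z j) (z N)" for j
  have pN: "p N = E (z 0) (z N)"
    using z[of 0] z[of N] self[of "z N"] sym[of "z 0" "z N"] by (simp add: p_def gromov_product_def)
  define j where "j = (LEAST j. r \<le> p j)"
  have j: "r \<le> p j" "j \<le> N" unfolding j_def
    by (rule LeastI[of _ N], use pN r in simp) (rule Least_le, use pN r in simp)
  show ?thesis
  proof (cases j)
    case 0
    then show ?thesis using j self[of "z 0"] z[of 0] r s by (intro exI[of _ 0]) (auto simp: p_def)
  next
    case (Suc i)
    have i: "p i < r" using not_less_Least[of i "\<lambda>j. r \<le> p j"] Suc by (auto simp: j_def not_le)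
    have V: "z 0 \<in> V" "z i \<in> V" "z j \<in> V" "z N \<in> V" using z j Suc by auto
    \<comment> \<open>The projection jumps over \<open>r\<close> in one step, so the product of
      \<open>z i\<close> and \<open>z j\<close> is below \<open>r\<close>. As these points are
      within \<open>s\<close> of each other, neither can be farther than \<open>r + s\<close> from
      \<open>z 0\<close>.\<close>
    have "min (gromov_product E (z 0) (z i) (z j)) (p j) \<le> p i"
      unfolding p_def using V by (intro gromov_ge)
    then have "gromov_product E (z 0) (z i) (z j) < r" using i j by linarith
    moreover have "E (z i) (z j) \<le> s" using step[of i] Suc j by simp
    moreover have "E (z 0) (z j) \<le> E (z 0) (z i) + E (z i) (z j)" using V by (intro triangle)
    ultimately have "E (z 0) (z j) \<le> r + s"
      using V dist_eq_gromov[of "z i" "z j" "z 0"] by linarith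
    then show ?thesis using j by (auto simp: p_def)
  qed
qed

text \<open>By 0-hyperbolicity the product of \<open>x\<close> and \<open>y\<close> at
  \<open>a\<close> is at least \<open>r\<close>, and the distance is the sum of the distances from
  \<open>a\<close> minus twice this product.\<close>

lemma close_of_same_projection:
  assumes V: "x \<in> V" "y \<in> V" "a \<in> V" "b \<in> V"
    and x: "r \<le> gromov_product E a x b" "E a x \<le> t"
    and y: "r \<le> gromov_product E a y b" "E a y \<le> t'"
  shows "E x y \<le> t + t' - 2 * r"
  using gromov_ge[of a x b y] gromov_sym[of b y a] dist_eq_gromov[of x y a] assms by linarith

end

text \<open>\<open>s\<close> bounds the steps of the image paths, and \<open>D\<close> the distance
  of points of the rectangle whose images are within \<open>2 * s\<close>. If the image corners are
  more than \<open>M\<close> apart, points within \<open>D\<close> of a corner have images too close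
  to that corner to be near the midpoint. Sides longer than \<open>L * (M + C)\<close> force the
  image corners that far apart.\<close>

definition side_bound :: "real \<Rightarrow> real \<Rightarrow> real \<Rightarrow> real" where
  "side_bound L C c = (let s = L * c + C; D = L * (2 * s + C); M = 2 * (L * D + C + s) in max D (L * (M + C)))"

text \<open>Two coarse paths run along the boundary of a rectangle between opposite corners. In a
  0-hyperbolic space both pass close to the midpoint between the images of these corners, whereas
  points on the two paths are close to each other only near a corner.\<close>

lemma rectangle_side_bound:
  fixes \<alpha> :: "nat \<Rightarrow> 'a" and \<beta> :: "nat \<Rightarrow> 'b" and E :: "'v \<Rightarrow> 'v \<Rightarrow> real"
  assumes LCc: "L \<ge> 1" "C \<ge> 0" "c \<ge> 0"
    and fp: "four_point V E"
    and fV: "\<And>i j. i \<le> P \<Longrightarrow> j \<le> Q \<Longrightarrow> f (\<alpha> i) (\<beta> j) \<in> V"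
    and qi: "\<And>i i' j j'. i \<le> P \<Longrightarrow> i' \<le> P \<Longrightarrow> j \<le> Q \<Longrightarrow> j' \<le> Q \<Longrightarrow>
      (A (\<alpha> i) (\<alpha> i') + B (\<beta> j) (\<beta> j')) / L - C \<le> E (f (\<alpha> i) (\<beta> j)) (f (\<alpha> i') (\<beta> j')) \<and>
      E (f (\<alpha> i) (\<beta> j)) (f (\<alpha> i') (\<beta> j')) \<le> L * (A (\<alpha> i) (\<alpha> i') + B (\<beta> j) (\<beta> j')) + C"
    and A: "\<And>i i'. i \<le> P \<Longrightarrow> i' \<le> P \<Longrightarrow> 0 \<le> A (\<alpha> i) (\<alpha> i')"
      "\<And>i i'. i \<le> P \<Longrightarrow> i' \<le> P \<Longrightarrow> A (\<alpha> i) (\<alpha> i') = A (\<alpha> i') (\<alpha> i)"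
      "\<And>i. i \<le> P \<Longrightarrow> A (\<alpha> i) (\<alpha> i) = 0"
    and B: "\<And>j j'. j \<le> Q \<Longrightarrow> j' \<le> Q \<Longrightarrow> 0 \<le> B (\<beta> j) (\<beta> j')"
      "\<And>j j'. j \<le> Q \<Longrightarrow> j' \<le> Q \<Longrightarrow> B (\<beta> j) (\<beta> j') = B (\<beta> j') (\<beta> j)"
      "\<And>j. j \<le> Q \<Longrightarrow> B (\<beta> j) (\<beta> j) = 0"
    and Ac: "\<And>i. i < P \<Longrightarrow> A (\<alpha> i) (\<alpha> (Suc i)) \<le> c"
    and Bc: "\<And>j. j < Q \<Longrightarrow> B (\<beta> j) (\<beta> (Suc j)) \<le> c"
  shows "A (\<alpha> 0) (\<alpha> P) \<le> side_bound L C c \<or> B (\<beta> 0) (\<beta> Q) \<le> side_bound L C c"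
proof -
  define s where "s = L * c + C"
  define D where "D = L * (2 * s + C)"
  define M where "M = 2 * (L * D + C + s)"
  define K where "K = max D (L * (M + C))"
  have K: "side_bound L C c = K" by (simp add: side_bound_def Let_def K_def M_def D_def s_def)
  have s0: "s \<ge> 0" and D0: "D \<ge> 0" using LCc by (auto simp: s_def D_def)
  have M0: "M \<ge> 0" using LCc s0 D0 by (auto simp: M_def)
  interpret four_point V E by (rule fp)
  show ?thesis
  proof (rule ccontr)
    assume "\<not> ?thesis"
    then have big: "A (\<alpha> 0) (\<alpha> P) > K" "B (\<beta> 0) (\<beta> Q) > K" by (auto simp: K)
    have L: "L > 0" using LCc by simp
    have lower: "A (\<alpha> i) (\<alpha> i') + B (\<beta> j) (\<beta> j') \<le> L * (E (f (\<alpha> i) (\<beta> j)) (f (\<alpha> i') (\<beta> j')) + C)"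
      if "i \<le> P" "i' \<le> P" "j \<le> Q" "j' \<le> Q" for i i' j j'
      using qi[OF that] L by (simp add: field_simps)
    have upper: "E (f (\<alpha> i) (\<beta> j)) (f (\<alpha> i') (\<beta> j')) \<le> L * (A (\<alpha> i) (\<alpha> i') + B (\<beta> j) (\<beta> j')) + C"
      if "i \<le> P" "i' \<le> P" "j \<le> Q" "j' \<le> Q" for i i' j j'
      using qi[OF that] by blast
    \<comment> \<open>Saturation by \<open>min\<close> and truncated subtraction glue the sides:
      \<open>z\<close> runs along \<alpha> and then \<beta>, \<open>y\<close> along \<beta> and then
      \<alpha>, with common ends.\<close>
    define z where "z k = f (\<alpha> (min k P)) (\<beta> (k - P))" for k
    define y where "y k = f (\<alpha> (k - Q)) (\<beta> (min k Q))" for k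
    define N where "N = P + Q"
    have zV: "z k \<in> V" and yV: "y k \<in> V" if "k \<le> N" for k
      using that by (auto simp: z_def y_def N_def intro!: fV)
    have ends: "z 0 = y 0" "z N = y N" by (auto simp: z_def y_def N_def)
    have zs: "E (z k) (z (Suc k)) \<le> s" if "k < N" for k
    proof (cases "k < P")
      case True
      then have "E (z k) (z (Suc k)) \<le> L * (A (\<alpha> k) (\<alpha> (Suc k))) + C"
        using upper[of k "Suc k" 0 0] B(3)[of 0] by (simp add: z_def)
      also have "\<dots> \<le> s" using Ac[OF True] L by (simp add: s_def)
      finally show ?thesis .
    next
      case False
      then have "min k P = P" "min (Suc k) P = P" "Suc k - P = Suc (k - P)" "Suc (k - P) \<le> Q"
        using that by (auto simp: N_def)
      then have "E (z k) (z (Suc k)) \<le> L * (B (\<beta> (k - P)) (\<beta> (Suc (k - P)))) + C"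
        using upper[of P P "k - P" "Suc (k - P)"] A(3)[of P] by (simp add: z_def)
      also have "\<dots> \<le> s" using Bc[of "k - P"] False that L by (simp add: s_def N_def)
      finally show ?thesis .
    qed
    have ys: "E (y k) (y (Suc k)) \<le> s" if "k < N" for k
    proof (cases "k < Q")
      case True
      then have "E (y k) (y (Suc k)) \<le> L * (B (\<beta> k) (\<beta> (Suc k))) + C"
        using upper[of 0 0 k "Suc k"] A(3)[of 0] by (simp add: y_def)
      also have "\<dots> \<le> s" using Bc[OF True] L by (simp add: s_def)
      finally show ?thesis .
    next
      case False
      then have "min k Q = Q" "min (Suc k) Q = Q" "Suc k - Q = Suc (k - Q)" "Suc (k - Q) \<le> P"
        using that by (auto simp: N_def)
      then have "E (y k) (y (Suc k)) \<le> L * (A (\<alpha> (k - Q)) (\<alpha> (Suc (k - Q)))) + C"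
        using upper[of "k - Q" "Suc (k - Q)" Q Q] B(3)[of Q] by (simp add: y_def)
      also have "\<dots> \<le> s" using Ac[of "k - Q"] False that L by (simp add: s_def N_def)
      finally show ?thesis .
    qed
    define m where "m = E (z 0) (z N)"
    have "A (\<alpha> 0) (\<alpha> P) + B (\<beta> 0) (\<beta> Q) \<le> L * (m + C)"
      using lower[of 0 P 0 Q] by (simp add: m_def z_def N_def)
    moreover have "K \<ge> L * (M + C)" by (simp add: K_def)
    moreover have "0 \<le> K" using D0 by (simp add: K_def)
    ultimately have "L * (M + C) < L * (m + C)" using big by linarith
    then have mM: "m > M" using L by simp
    obtain j where j: "j \<le> N" "m / 2 \<le> gromov_product E (z 0) (z j) (z N)" "E (z 0) (z j) \<le> m / 2 + s"
      using coarse_path_crossing[of N z s "m / 2"] zV zs s0 mM M0 by (auto simp: m_def)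
    obtain k where k: "k \<le> N" "m / 2 \<le> gromov_product E (z 0) (y k) (z N)" "E (z 0) (y k) \<le> m / 2 + s"
      using coarse_path_crossing[of N y s "m / 2"] yV ys s0 mM M0 unfolding m_def ends by auto
    have V: "z 0 \<in> V" "z N \<in> V" "z j \<in> V" "y k \<in> V" using zV[of 0] zV[of N] zV[OF j(1)] yV[OF k(1)] by auto
    have "E (z j) (y k) \<le> (m / 2 + s) + (m / 2 + s) - 2 * (m / 2)"
      using V j k by (intro close_of_same_projection[of _ _ "z 0" "z N"])
    then have close: "E (z j) (y k) \<le> 2 * s" by simp
    have start: "m / 2 \<le> E (z 0) (z j)"
      using gromov_le[of "z 0" "z j" "z N"] V j by linarith
    have fin: "m / 2 - s \<le> E (z j) (z N)"
      using triangle[of "z 0" "z j" "z N"] V j by (auto simp: m_def)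
    have far: "D < X" if "m / 2 - s \<le> L * X + C" for X
    proof -
      have "L * D < L * X" using that mM by (simp add: M_def)
      then show ?thesis using L by simp
    qed
    have DE: "A (\<alpha> (min j P)) (\<alpha> (k - Q)) + B (\<beta> (j - P)) (\<beta> (min k Q)) \<le> D"
    proof -
      have "A (\<alpha> (min j P)) (\<alpha> (k - Q)) + B (\<beta> (j - P)) (\<beta> (min k Q)) \<le> L * (E (z j) (y k) + C)"
        using lower[of "min j P" "k - Q" "j - P" "min k Q"] j k by (simp add: z_def y_def N_def)
      also have "\<dots> \<le> D" using close L by (simp add: D_def)
      finally show ?thesis .
    qed
    have KD: "K \<ge> D" by (simp add: K_def)
    \<comment> \<open>If \<open>z j\<close> and \<open>y k\<close> lie on sides that share an end of
      the paths, \<open>z j\<close> is farther than \<open>D\<close> from that corner; on opposite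
      sides, a full side longer than \<open>K\<close> separates them. Either way \<open>DE\<close>
      fails.\<close>
    show False
    proof (cases "j \<le> P")
      case jP: True
      have "m / 2 - s \<le> L * A (\<alpha> 0) (\<alpha> j) + C"
        using upper[of 0 j 0 0] B(3)[of 0] start s0 jP by (simp add: z_def)
      from far[OF this] have 1: "D < A (\<alpha> 0) (\<alpha> j)" .
      show False
      proof (cases "k \<le> Q")
        case True
        then show False using DE 1 jP A(2)[of 0 j] B(1)[of 0 k] by (simp add: min_def)
      next
        case False
        then have "min k Q = Q" "j - P = 0" "min j P = j" "k - Q \<le> P" using jP k(1) by (auto simp: N_def)
        then show False using DE big KD A(1)[of j "k - Q"] jP by simp
      qed
    next
      case jP: False
      then have j': "min j P = P" "j - P \<le> Q" using j by (auto simp: N_def)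
      have "m / 2 - s \<le> L * B (\<beta> (j - P)) (\<beta> Q) + C"
        using upper[of P P "j - P" Q] A(3)[of P] fin j' by (simp add: z_def N_def)
      from far[OF this] have 1: "D < B (\<beta> (j - P)) (\<beta> Q)" .
      show False
      proof (cases "k \<le> Q")
        case True
        then show False using DE big KD A(2)[of 0 P] B(1)[of "j - P" k] j' by (simp add: min_def)
      next
        case False
        then have "min k Q = Q" "k - Q \<le> P" using k by (auto simp: N_def)
        then show False using DE 1 A(1)[of P "k - Q"] j' by simp
      qed
    qed
  qed
qed

lemma side_bound_nonneg: "L \<ge> 1 \<Longrightarrow> C \<ge> 0 \<Longrightarrow> c \<ge> 0 \<Longrightarrow> 0 \<le> side_bound L C c"
  by (simp add: side_bound_def Let_def le_max_iff_disj)

section \<open>Coarsely translation invariant 0-hyperbolic metrics on the integers\<close>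

text \<open>Models the orbit of one group element in a factor, with the metric pulled back from the
  tree. The four-point condition is exact, but an almost isometric shift of the factor becomes a
  quasi-isometry when seen through the map to the tree. Since \<open>k\<close> may be negative, the
  reverse estimate is included.\<close>

locale shift_invariant = four_point "UNIV :: int set" E for E +
  fixes L C :: real
  assumes L: "L \<ge> 1" and C: "C \<ge> 0"
    and shift: "E (i + k) (j + k) \<le> L * E i j + C"
begin

abbreviation gp :: "int \<Rightarrow> int \<Rightarrow> int \<Rightarrow> real" where "gp \<equiv> gromov_product E"

lemmas sym' = sym[OF UNIV_I UNIV_I] and self' = self[OF UNIV_I] and nonneg' = nonneg[OF UNIV_I UNIV_I]
  and triangle' = triangle[OF UNIV_I UNIV_I UNIV_I] and gromov_ge' = gromov_ge[OF UNIV_I UNIV_I UNIV_I UNIV_I]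
  and gromov_le' = gromov_le[OF UNIV_I UNIV_I UNIV_I] and eq' = dist_eq_gromov[OF UNIV_I UNIV_I UNIV_I]

definition s :: real where "s = L * E 0 1 + C + 1"

lemma s_pos: "s > 0" using L C nonneg'[of 0 1] by (simp add: s_def add_nonneg_pos)

lemma s0: "s \<ge> 0" using s_pos by simp

lemma step: "E i (i + 1) \<le> s"
  using shift[of 0 i 1] by (simp add: s_def add.commute)

lemma unshift: "E i j \<le> L * E (i + k) (j + k) + C"
  using shift[of "i + k" "- k" "j + k"] by simp

text \<open>The path of consecutive integers may stray far from the segment between \<open>a\<close>
  and \<open>b\<close>. For each multiple of \<open>s\<close> along the segment the crossing lemma
  picks one integer near it; consecutive picks have nearly the same projection and are therefore
  close.\<close>

lemma near_geodesic_chain: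
  assumes ab: "a \<le> b"
  obtains w :: "nat \<Rightarrow> int" and R where "w 0 = a" "w R = b"
    "\<And>i. i < R \<Longrightarrow> E (w i) (w (Suc i)) \<le> 3 * s"
    "\<And>i. i \<le> R \<Longrightarrow> E a (w i) \<le> gp a (w i) b + s"
proof -
  have s: "s > 0" using s_pos .
  define M where "M = E a b"
  define z where "z k = a + int k" for k
  define N where "N = nat (b - a)"
  have zN: "z N = b" "z 0 = a" using ab by (auto simp: z_def N_def)
  define R where "R = nat \<lfloor>M / s\<rfloor>"
  have M0: "M \<ge> 0" by (simp add: M_def nonneg')
  have "real R = of_int \<lfloor>M / s\<rfloor>" using M0 s by (simp add: R_def)
  then have "real R \<le> M / s" "M / s < real R + 1" by linarith+
  then have R: "real R * s \<le> M" "M < (real R + 1) * s"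
    using s by (simp_all add: field_simps)
  have ex: "\<exists>v. real i * s \<le> gp a v b \<and> E a v \<le> real i * s + s" if "i \<le> R" for i
  proof -
    have "real i * s \<le> real R * s" using that s by (intro mult_right_mono) auto
    then have "real i * s \<le> E (z 0) (z N)" using R by (simp add: zN M_def)
    moreover have "E (z k) (z (Suc k)) \<le> s" for k
      using step[of "z k"] by (simp add: z_def algebra_simps)
    ultimately show ?thesis
      using coarse_path_crossing[of N z s "real i * s"] s unfolding zN by auto
  qed
  define v where "v i = (SOME v. real i * s \<le> gp a v b \<and> E a v \<le> real i * s + s)" for i :: nat
  have v: "real i * s \<le> gp a (v i) b" "E a (v i) \<le> real i * s + s" if "i \<le> R" for i
    using someI_ex[OF ex[OF that]] by (auto simp: v_def)
  \<comment> \<open>The ends are made exactly \<open>a\<close> and \<open>b\<close>; the extra index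
    \<open>Suc R\<close> covers the remainder of the segment, shorter than \<open>s\<close>.\<close>
  define w where "w i = (if i = 0 then a else if i \<le> R then v i else b)" for i
  have w: "real i * s \<le> gp a (w i) b" "E a (w i) \<le> real i * s + s" if "i \<le> R" for i
  proof -
    have "gp a a b = 0" by (simp add: gromov_product_def self' sym'[of b a])
    then show "real i * s \<le> gp a (w i) b" "E a (w i) \<le> real i * s + s"
      using v[OF that] that s by (auto simp: w_def self')
  qed
  have gb: "gp a b b = M" by (simp add: gromov_product_def self' sym'[of b a] M_def)
  show ?thesis
  proof (rule that[of w "Suc R"])
    show "w 0 = a" "w (Suc R) = b" by (auto simp: w_def)
    show "E (w i) (w (Suc i)) \<le> 3 * s" if "i < Suc R" for i
    proof (cases "i = R")
      case True
      have b: "w (Suc i) = b" using True by (simp add: w_def)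
      have i: "i \<le> R" using True by simp
      have "E (w i) b \<le> (real i * s + s) + M - 2 * (real i * s)"
        by (rule close_of_same_projection[OF UNIV_I UNIV_I UNIV_I UNIV_I w[OF i]])
          (use gb R True in \<open>auto simp: M_def\<close>)
      then show ?thesis using R s b unfolding True by (simp add: algebra_simps)
    next
      case False
      then have i: "i \<le> R" "Suc i \<le> R" using that by auto
      have "real i * s \<le> gp a (w (Suc i)) b" using w(1)[OF i(2)] s by (simp add: algebra_simps)
      then have "E (w i) (w (Suc i)) \<le> (real i * s + s) + (real (Suc i) * s + s) - 2 * (real i * s)"
        by (intro close_of_same_projection[OF UNIV_I UNIV_I UNIV_I UNIV_I w[OF i(1)]] w(2)[OF i(2)])
      then show ?thesis by (simp add: algebra_simps)
    qed
    show "E a (w i) \<le> gp a (w i) b + s" if "i \<le> Suc R" for i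
    proof (cases "i \<le> R")
      case True
      then show ?thesis using w[OF True] by linarith
    next
      case False
      then have "w i = b" by (simp add: w_def)
      then show ?thesis using gb s by (simp add: M_def)
    qed
  qed
qed

text \<open>In a tree \<open>gp x a b\<close> is the distance from \<open>x\<close> to the segment
  between \<open>a\<close> and \<open>b\<close>; a bound on it says that \<open>x\<close> is nearly
  between them.\<close>

lemma gp_defect: "E a x - gp a x b = gp x a b"
  using sym'[of a x] sym'[of b x] sym'[of a b] by (simp add: gromov_product_def field_simps)

lemma gp_move: "gp c a b \<le> gp c' a b + E c c'"
  using triangle'[of a c c'] triangle'[of b c c'] sym'[of c c'] by (simp add: gromov_product_def field_simps)

text \<open>A chain close to the segment between the translated endpoints is carried back to a chain
  between \<open>a\<close> and \<open>b\<close>, which crosses the segment near \<open>c\<close>.\<close>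

lemma between_shift:
  assumes ab: "a \<le> b" and h: "gp c a b \<le> h" "0 \<le> h"
  shows "gp (c + k) (a + k) (b + k) \<le> s + L * (L * (3 * s) + C + h) + C"
proof -
  obtain w :: "nat \<Rightarrow> int" and R where w: "w 0 = a + k" "w R = b + k"
    "\<And>i. i < R \<Longrightarrow> E (w i) (w (Suc i)) \<le> 3 * s"
    "\<And>i. i \<le> R \<Longrightarrow> E (a + k) (w i) \<le> gp (a + k) (w i) (b + k) + s"
    using near_geodesic_chain[of "a + k" "b + k"] ab by auto
  define s2 where "s2 = L * (3 * s) + C"
  have s2: "s2 \<ge> 0" using L C s0 by (simp add: s2_def)
  define z where "z i = w i - k" for i
  have z: "z 0 = a" "z R = b" by (auto simp: z_def w)
  have zs: "E (z i) (z (Suc i)) \<le> s2" if "i < R" for i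
  proof -
    have "E (z i) (z (Suc i)) \<le> L * E (w i) (w (Suc i)) + C"
      using shift[of "w i" "- k" "w (Suc i)"] by (simp add: z_def)
    also have "\<dots> \<le> s2" using w(3)[OF that] L by (simp add: s2_def)
    finally show ?thesis .
  qed
  define r where "r = gp a c b"
  have r: "r \<le> E a b" using gromov_le'[of a b c] gromov_sym[OF UNIV_I UNIV_I] by (simp add: r_def)
  have r0: "0 \<le> r" using triangle'[of c b a] sym'[of b a] by (simp add: r_def gromov_product_def)
  obtain j where j: "j \<le> R" "r \<le> gp a (z j) b" "E a (z j) \<le> r + s2"
    using coarse_path_crossing[of R z s2 r] zs s2 r r0 unfolding z by auto
  have "E a c \<le> r + h" using gp_defect[of a c b] h by (simp add: r_def)
  then have "E (z j) c \<le> (r + s2) + (r + h) - 2 * r"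
    using j by (intro close_of_same_projection[of _ _ a b]) (auto simp: r_def)
  then have "E (z j) c \<le> s2 + h" by simp
  then have "L * E (z j) c + C \<le> L * (s2 + h) + C" using L by simp
  then have "E (w j) (c + k) \<le> L * (s2 + h) + C" using shift[of "z j" k c] by (simp add: z_def)
  moreover have "gp (w j) (a + k) (b + k) \<le> s" using gp_defect[of "a + k" "w j" "b + k"] w(4)[OF j(1)] by linarith
  ultimately show ?thesis using gp_move[of "c + k" "a + k" "b + k" "w j"] sym'[of "w j" "c + k"]
    by (simp add: s2_def)
qed

text \<open>This excludes parabolic behaviour. Choose \<open>u\<close> near the segment from 0 to a
  far \<open>N\<close>, at distance about \<open>R\<close> from 0. As \<open>N - u\<close> is close
  to \<open>N\<close>, \<open>u\<close> is also nearly between 0 and \<open>N - u\<close>. Shifting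
  by \<open>u\<close> puts \<open>2 * u\<close> nearly between \<open>u\<close> and
  \<open>N\<close>, so the orbit does not turn back at \<open>u\<close>. Shifts carry this to every
  multiple of \<open>u\<close>, and steps that are long compared with the error then add up.\<close>

lemma linear_growth:
  assumes unbounded: "\<not> (\<exists>B. \<forall>k. E 0 k \<le> B)"
  shows "\<exists>u\<ge>1. \<forall>i::nat. real i \<le> E 0 (int i * u)"
proof -
  \<comment> \<open>The bound of \<open>between_shift\<close> for \<open>h = s\<close>.
    \<open>R\<close> is chosen so large that consecutive multiples of \<open>u\<close> stay
    \<open>2 * h' + 1\<close> apart even after the loss caused by a shift.\<close>
  define h' where "h' = s + L * (L * (3 * s) + C + s) + C"
  have h's: "h' \<ge> s" "h' \<ge> 0" using L C s0 by (auto simp: h'_def)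
  define R where "R = L * (2 * h' + s + 1 + C)"
  have R0: "R \<ge> 0" and Rh: "R \<ge> 2 * h' + s + 1"
  proof -
    show "R \<ge> 0" using L C h's s0 by (simp add: R_def)
    have "1 * (2 * h' + s + 1 + C) \<le> L * (2 * h' + s + 1 + C)" using L C h's s0 by (intro mult_right_mono) auto
    then show "R \<ge> 2 * h' + s + 1" using C by (simp add: R_def)
  qed
  define R' where "R' = L * (R + s) + C"
  have "\<exists>N\<ge>0. E 0 N > R + R' + 2 * s + 1"
  proof -
    define B where "B = R + R' + 2 * s + 1"
    obtain k where k: "E 0 k > L * \<bar>B\<bar> + C + B + \<bar>B\<bar>" using unbounded by (meson not_le)
    show ?thesis
    proof (cases "k \<ge> 0")
      case True
      moreover have "0 \<le> L * \<bar>B\<bar>" using L by simp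
      ultimately show ?thesis using k C unfolding B_def[symmetric] by (intro exI[of _ k]) linarith
    next
      case False
      \<comment> \<open>The orbit might be known to be large at a negative \<open>k\<close> only; a
        shift compares \<open>k\<close> with \<open>- k\<close>.\<close>
      have "E 0 k \<le> L * E 0 (- k) + C" using shift[of "- k" k 0] sym'[of 0 "- k"] by simp
      then have "L * \<bar>B\<bar> < L * E 0 (- k)" using k by linarith
      then have "\<bar>B\<bar> < E 0 (- k)" using L by simp
      then show ?thesis using False unfolding B_def[symmetric] by (intro exI[of _ "- k"]) auto
    qed
  qed
  then obtain N where N: "N \<ge> 0" "E 0 N > R + R' + 2 * s + 1" by blast
  have R'0: "R' \<ge> 0" using L C R0 s0 by (simp add: R'_def)
  have stepn: "E (int k) (int (Suc k)) \<le> s" for k using step[of "int k"] by (simp add: add.commute)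
  obtain j where j: "j \<le> nat N" "R \<le> gp 0 (int j) N" "E 0 (int j) \<le> R + s"
    using coarse_path_crossing[of "nat N" int s R] stepn s0 R0 R'0 N by auto
  define u where "u = int j"
  have u: "0 \<le> u" "u \<le> N" "R \<le> gp 0 u N" "E 0 u \<le> R + s" using j N by (auto simp: u_def)
  have uR: "R \<le> E 0 u" using u gromov_le'[of 0 u N] by linarith
  have u0: "u \<noteq> 0" using uR self'[of 0] Rh h's s0 by auto
  have gu: "gp u 0 N \<le> s" using gp_defect[of 0 u N] u by linarith
  have "E (N - u) N \<le> R'"
  proof -
    have "E (N - u) N \<le> L * E 0 u + C" using shift[of 0 "N - u" u] by simp
    also have "\<dots> \<le> R'" using u L by (simp add: R'_def)
    finally show ?thesis .
  qed
  have gu': "gp u 0 (N - u) \<le> s"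
  proof -
    have "gp u (N - u) N \<ge> E u N - E (N - u) N"
      using triangle'[of u N "N - u"] triangle'[of u "N - u" N] sym'[of u N] sym'[of u "N - u"] sym'[of N "N - u"]
      by (simp add: gromov_product_def)
    moreover have "E u N \<ge> E 0 N - E 0 u" using triangle'[of 0 N u] by linarith
    ultimately have "gp u (N - u) N > s" using N u \<open>E (N - u) N \<le> R'\<close> s0 by linarith
    then show ?thesis using gromov_ge'[of u 0 "N - u" N] gu by linarith
  qed
  have unn: "0 \<le> N - u" using u by simp
  have "gp (2 * u) u N \<le> h'"
    using between_shift[OF unn gu' s0, of u] by (simp add: h'_def)
  have E2: "E u (2 * u) \<ge> 2 * h' + s + 1"
  proof -
    have "R \<le> L * E u (2 * u) + C" using unshift[of 0 u u] uR by simp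
    then have "L * (2 * h' + s + 1) \<le> L * E u (2 * u)" using C L mult_right_mono[of 1 L C] by (simp add: R_def algebra_simps)
    then show ?thesis using L by simp
  qed
  have g2: "gp u 0 (2 * u) \<le> s"
  proof -
    have "gp u (2 * u) N = E u (2 * u) - gp (2 * u) u N" using gp_defect[of u "2 * u" N] by linarith
    then have "gp u (2 * u) N > s" using E2 \<open>gp (2 * u) u N \<le> h'\<close> h's by linarith
    then show ?thesis using gromov_ge'[of u 0 "2 * u" N] gu by linarith
  qed
  define y where "y i = int i * u" for i :: nat
  have yE: "E (y i) (y (Suc i)) \<ge> 2 * h' + 1" for i
  proof -
    have Ls: "0 \<le> L * s" using L s0 by simp
    have "R \<le> L * E (y i) (y (Suc i)) + C" using unshift[of 0 u "y i"] uR by (simp add: y_def algebra_simps)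
    then have "L * (2 * h' + 1) \<le> L * E (y i) (y (Suc i))"
      using C L mult_right_mono[of 1 L C] Ls by (simp add: R_def algebra_simps)
    then show ?thesis using L by simp
  qed
  have yg: "gp (y (Suc i)) (y i) (y (Suc (Suc i))) \<le> h'" for i
    using between_shift[OF _ g2 s0, of "y i"] u by (simp add: y_def h'_def algebra_simps)
  \<comment> \<open>Local to global: the defect at each multiple is at most \<open>h'\<close>
    against steps of at least \<open>2 * h' + 1\<close>, so the ultrametric inequality excludes
    backtracking towards \<open>y 0\<close>, and each step gains at least 1.\<close>
  have main: "gp (y i) (y 0) (y (Suc i)) \<le> h' \<and> real i \<le> E (y 0) (y i)" for i
  proof (induction i)
    case 0
    have "gp (y 0) (y 0) (y (Suc 0)) = 0" using sym' by (simp add: gromov_product_def self')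
    then show ?case using h's by (simp add: self')
  next
    case (Suc i)
    have "gp (y (Suc i)) (y i) (y 0) = E (y i) (y (Suc i)) - gp (y i) (y 0) (y (Suc i))"
      using sym'[of "y i" "y 0"] sym'[of "y (Suc i)" "y 0"] sym'[of "y i" "y (Suc i)"]
      by (simp add: gromov_product_def field_simps)
    then have "gp (y (Suc i)) (y i) (y 0) > h'" using Suc yE[of i] by linarith
    then have 1: "gp (y (Suc i)) (y 0) (y (Suc (Suc i))) \<le> h'"
      using gromov_ge'[of "y (Suc i)" "y i" "y 0" "y (Suc (Suc i))"] yg[of i] by linarith
    have "E (y 0) (y (Suc i)) = E (y i) (y 0) + E (y i) (y (Suc i)) - 2 * gp (y i) (y 0) (y (Suc i))"
      by (rule eq')
    then show ?case using 1 Suc yE[of i] sym'[of "y i" "y 0"] by auto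
  qed
  show ?thesis using main u u0 by (intro exI[of _ u]) (auto simp: y_def)
qed

end

section \<open>Isometries of l1-products of quasi-trees\<close>

text \<open>Quasi-trees need not be geodesic; \<open>chain\<close>, connectedness with a uniform
  step, takes the place of paths and is carried along by isometries. All factors share one set of
  constants.\<close>

locale quasi_tree_product =
  fixes n :: nat and X :: "nat \<Rightarrow> 'x set" and d :: "nat \<Rightarrow> 'x \<Rightarrow> 'x \<Rightarrow> real"
    and V :: "nat \<Rightarrow> 'v set" and E :: "nat \<Rightarrow> 'v \<Rightarrow> 'v \<Rightarrow> real" and f :: "nat \<Rightarrow> 'x \<Rightarrow> 'v"
    and L C c :: real
  assumes const: "L \<ge> 1" "C \<ge> 0" "c \<ge> 0"
    and metric: "i < n \<Longrightarrow> Metric_space (X i) (d i)"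
    and fp: "i < n \<Longrightarrow> four_point (V i) (E i)"
    and fV: "i < n \<Longrightarrow> x \<in> X i \<Longrightarrow> f i x \<in> V i"
    and qi: "i < n \<Longrightarrow> x \<in> X i \<Longrightarrow> y \<in> X i \<Longrightarrow>
      d i x y / L - C \<le> E i (f i x) (f i y) \<and> E i (f i x) (f i y) \<le> L * d i x y + C"
    and chain: "i < n \<Longrightarrow> x \<in> X i \<Longrightarrow> y \<in> X i \<Longrightarrow>
      \<exists>z (N :: nat). z 0 = x \<and> z N = y \<and> (\<forall>k\<le>N. z k \<in> X i) \<and> (\<forall>k<N. d i (z k) (z (Suc k)) \<le> c)"
begin

abbreviation P :: "(nat \<Rightarrow> 'x) set" where "P \<equiv> PiE {..<n} X"
abbreviation D :: "(nat \<Rightarrow> 'x) \<Rightarrow> (nat \<Rightarrow> 'x) \<Rightarrow> real" where "D \<equiv> l1_dist n d"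

definition isom :: "((nat \<Rightarrow> 'x) \<Rightarrow> (nat \<Rightarrow> 'x)) \<Rightarrow> bool" where
  "isom h \<longleftrightarrow> bij_betw h P P \<and> (\<forall>x\<in>P. \<forall>y\<in>P. D (h x) (h y) = D x y)"

lemma isom_in: "isom h \<Longrightarrow> x \<in> P \<Longrightarrow> h x \<in> P"
  by (auto simp: isom_def bij_betw_def)

lemma isom_D: "isom h \<Longrightarrow> x \<in> P \<Longrightarrow> y \<in> P \<Longrightarrow> D (h x) (h y) = D x y"
  by (auto simp: isom_def)

lemma coord: "x \<in> P \<Longrightarrow> i < n \<Longrightarrow> x i \<in> X i"
  by (auto simp: PiE_iff)

lemma d0: "i < n \<Longrightarrow> 0 \<le> d i x y"
  using Metric_space.nonneg[OF metric] .

lemma dsym: "i < n \<Longrightarrow> d i x y = d i y x"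
  using Metric_space.commute[OF metric] .

lemma dself: "i < n \<Longrightarrow> x \<in> X i \<Longrightarrow> d i x x = 0"
  using Metric_space.mdist_zero[OF metric] .

lemma dtri: "i < n \<Longrightarrow> x \<in> P \<Longrightarrow> y \<in> P \<Longrightarrow> z \<in> P \<Longrightarrow> d i (x i) (z i) \<le> d i (x i) (y i) + d i (y i) (z i)"
  using Metric_space.triangle[OF metric] coord by metis

lemma d_le_D: "i < n \<Longrightarrow> d i (x i) (y i) \<le> D x y"
  unfolding l1_dist_def by (rule member_le_sum) (auto intro: d0)

lemma D_split: "i < n \<Longrightarrow> D x y = d i (x i) (y i) + (\<Sum>j\<in>{..<n}-{i}. d j (x j) (y j))"
  unfolding l1_dist_def by (simp add: sum.remove)

lemma D_le_of_others:
  assumes "i < n" "\<And>j. j < n \<Longrightarrow> j \<noteq> i \<Longrightarrow> d j (x j) (y j) \<le> B" "B \<ge> 0"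
  shows "D x y \<le> d i (x i) (y i) + real n * B"
proof -
  have "(\<Sum>j\<in>{..<n}-{i}. d j (x j) (y j)) \<le> real (card ({..<n}-{i})) * B"
    using assms by (intro sum_bounded_above) auto
  also have "\<dots> \<le> real n * B" using assms by (intro mult_right_mono) auto
  finally show ?thesis using D_split[OF assms(1)] by simp
qed

section \<open>Fibres of a factor and their images under isometries\<close>

definition fib :: "nat \<Rightarrow> (nat \<Rightarrow> 'x) \<Rightarrow> (nat \<Rightarrow> 'x) set" where
  "fib i x = {y \<in> P. \<forall>j. j \<noteq> i \<longrightarrow> y j = x j}"

lemma fib_in: "y \<in> fib i x \<Longrightarrow> y \<in> P"
  by (simp add: fib_def)

lemma fun_upd_P: "x \<in> P \<Longrightarrow> i < n \<Longrightarrow> t \<in> X i \<Longrightarrow> x(i := t) \<in> P"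
  by (auto simp: PiE_iff extensional_def)

lemma fun_upd_fib: "x \<in> P \<Longrightarrow> i < n \<Longrightarrow> t \<in> X i \<Longrightarrow> x(i := t) \<in> fib i x"
  by (simp add: fib_def fun_upd_P)

lemma fib_upd: "y \<in> fib i x \<Longrightarrow> i < n \<Longrightarrow> t \<in> X i \<Longrightarrow> y(i := t) \<in> fib i x"
  using fun_upd_P by (auto simp: fib_def)

lemma fib_D:
  assumes "u \<in> fib i x" "v \<in> fib i x" "i < n"
  shows "D u v = d i (u i) (v i)"
proof -
  have "(\<Sum>j\<in>{..<n}-{i}. d j (u j) (v j)) = 0"
  proof (rule sum.neutral, rule ballI)
    fix j assume "j \<in> {..<n} - {i}"
    then have "j < n" "j \<noteq> i" by auto
    then have "u j = v j" "u j \<in> X j"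
      using assms coord[OF fib_in[OF assms(1)] \<open>j < n\<close>] by (simp_all add: fib_def)
    then show "d j (u j) (v j) = 0" using dself[of j] \<open>j < n\<close> by simp
  qed
  then show ?thesis using D_split[OF assms(3), of u v] by simp
qed

text \<open>Equality in the triangle inequality for the sum forces equality in each coordinate; off
  \<open>i\<close> the ends agree, so \<open>z\<close> agrees with them.\<close>

lemma fib_convex:
  assumes u: "u \<in> fib i x" and v: "v \<in> fib i x" and z: "z \<in> P" and e: "D u z + D z v = D u v"
  shows "z \<in> fib i x"
proof -
  have uP: "u \<in> P" and vP: "v \<in> P" using u v fib_in by auto
  have "z j = u j" if "j \<noteq> i" for j
  proof (cases "j < n")
    case True
    have "(\<Sum>j<n. d j (u j) (z j) + d j (z j) (v j) - d j (u j) (v j)) = 0"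
      using e by (simp add: l1_dist_def sum.distrib sum_subtractf)
    then have "d j (u j) (z j) + d j (z j) (v j) - d j (u j) (v j) = 0"
      using True dtri[OF _ uP z vP] by (subst (asm) sum_nonneg_eq_0_iff) (auto simp: algebra_simps)
    moreover have "d j (u j) (v j) = 0"
      using u v that dself[OF True coord[OF uP True]] by (simp add: fib_def)
    ultimately have "d j (u j) (z j) = 0"
      using d0[OF True, of "u j" "z j"] d0[OF True, of "z j" "v j"] by linarith
    then show ?thesis
      using Metric_space.zero[OF metric[OF True] coord[OF uP True] coord[OF z True]] by simp
  next
    case False
    then show ?thesis using uP z by (simp add: PiE_iff extensional_def)
  qed
  then show ?thesis using u z by (simp add: fib_def)
qed

text \<open>Replacing a coordinate of \<open>u\<close> by that of \<open>v\<close> gives a point of the metric interval between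
  them, and fibres are convex for these intervals.\<close>

lemma image_fib_mix:
  assumes h: "isom h" and u: "u \<in> h ` fib i x" and v: "v \<in> h ` fib i x" and j: "j < n"
  shows "u(j := v j) \<in> h ` fib i x"
proof -
  obtain a b where ab: "a \<in> fib i x" "b \<in> fib i x" "u = h a" "v = h b" using u v by blast
  have P: "a \<in> P" "b \<in> P" "u \<in> P" "v \<in> P" using ab fib_in isom_in[OF h] by auto
  define w where "w = u(j := v j)"
  have w: "w \<in> P" using P j coord by (simp add: w_def fun_upd_P)
  obtain z where z: "z \<in> P" "w = h z" using h w unfolding isom_def bij_betw_def by blast
  have 1: "D u w = d j (u j) (v j)"
    using fib_D[of u j u w] fun_upd_fib[OF P(3) j coord[OF P(4) j]] P j by (auto simp: w_def fib_def)
  have "(\<Sum>l\<in>{..<n}-{j}. d l (w l) (v l)) = (\<Sum>l\<in>{..<n}-{j}. d l (u l) (v l))"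
    by (rule sum.cong) (auto simp: w_def)
  then have "D w v = (\<Sum>l\<in>{..<n}-{j}. d l (u l) (v l))"
    using D_split[OF j, of w v] dself[OF j coord[OF P(4) j]] by (simp add: w_def)
  then have "D u w + D w v = D u v" using 1 D_split[OF j, of u v] by simp
  then have "D a z + D z b = D a b" using isom_D[OF h] P z ab by metis
  then show ?thesis using fib_convex[OF ab(1,2) z(1)] z by (auto simp: w_def)
qed

text \<open>Depends on the constants of the factors and not on an isometry; the error bounds derived
  from it inherit this uniformity.\<close>

definition K0 :: real where "K0 = side_bound L C c"

lemma K0: "K0 \<ge> 0"
  unfolding K0_def by (rule side_bound_nonneg[OF const])

text \<open>With two chains the image contains all their mixed points, by
  \<open>image_fib_mix\<close>, and these form a rectangle. Pulled back by \<open>h\<close> the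
  rectangle lies in one fibre, hence in a quasi-tree, where \<open>rectangle_side_bound\<close>
  applies.\<close>

lemma image_fib_thin:
  assumes h: "isom h" and i: "i < n" and j: "j < n" and j': "j' < n" and ne: "j \<noteq> j'"
    and u: "u \<in> h ` fib i x" and v: "v \<in> h ` fib i x" and u': "u' \<in> h ` fib i x" and v': "v' \<in> h ` fib i x"
  shows "d j (u j) (v j) \<le> K0 \<or> d j' (u' j') (v' j') \<le> K0"
proof -
  have image_chain: "\<exists>\<alpha> (N :: nat). \<alpha> 0 = a \<and> \<alpha> N = b \<and> (\<forall>k\<le>N. \<alpha> k \<in> h ` fib i x) \<and>
      (\<forall>l<n. \<forall>k<N. d l (\<alpha> k l) (\<alpha> (Suc k) l) \<le> c)" if ab: "a \<in> h ` fib i x" "b \<in> h ` fib i x" for a b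
  proof -
    obtain a' b' where a': "a' \<in> fib i x" "a = h a'" and b': "b' \<in> fib i x" "b = h b'" using ab by blast
    obtain z and N :: nat where z: "z 0 = a' i" "z N = b' i" "\<forall>k\<le>N. z k \<in> X i" "\<forall>k<N. d i (z k) (z (Suc k)) \<le> c"
      using chain[OF i coord[OF fib_in[OF a'(1)] i] coord[OF fib_in[OF b'(1)] i]] by blast
    define y where "y k = a'(i := z k)" for k
    have y: "y k \<in> fib i x" if "k \<le> N" for k using fib_upd[OF a'(1) i] z(3) that by (simp add: y_def)
    have ends: "y 0 = a'" "y N = b'"
      using z a'(1) b'(1) by (auto simp: y_def fib_def fun_eq_iff)
    have "d l (h (y k) l) (h (y (Suc k)) l) \<le> c" if "l < n" "k < N" for l k
    proof -
      have "d l (h (y k) l) (h (y (Suc k)) l) \<le> D (h (y k)) (h (y (Suc k)))" using d_le_D that by blast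
      also have "\<dots> = D (y k) (y (Suc k))"
        using isom_D[OF h fib_in[OF y] fib_in[OF y], of k "Suc k"] that by simp
      also have "\<dots> = d i (z k) (z (Suc k))"
        using fib_D[OF y y i, of k "Suc k"] that by (simp add: y_def)
      finally show ?thesis using z(4) that by fastforce
    qed
    then show ?thesis using y ends a' b' by (intro exI[of _ "\<lambda>k. h (y k)"] exI[of _ N]) auto
  qed
  obtain \<alpha> and M :: nat where \<alpha>: "\<alpha> 0 = u" "\<alpha> M = v" "\<And>k. k \<le> M \<Longrightarrow> \<alpha> k \<in> h ` fib i x"
      "\<And>l k. l < n \<Longrightarrow> k < M \<Longrightarrow> d l (\<alpha> k l) (\<alpha> (Suc k) l) \<le> c"
    using image_chain[OF u v] by blast
  obtain \<beta> and N :: nat where \<beta>: "\<beta> 0 = u'" "\<beta> N = v'" "\<And>k. k \<le> N \<Longrightarrow> \<beta> k \<in> h ` fib i x"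
      "\<And>l k. l < n \<Longrightarrow> k < N \<Longrightarrow> d l (\<beta> k l) (\<beta> (Suc k) l) \<le> c"
    using image_chain[OF u' v'] by blast
  \<comment> \<open>The point \<open>u\<close> only fills in the remaining coordinates, which
    contribute nothing to distances between mixed points.\<close>
  define q where "q s t = u(j := s j, j' := t j')" for s t :: "nat \<Rightarrow> 'x"
  define g where "g w = inv_into (fib i x) h w" for w
  have q: "q s t \<in> h ` fib i x" if "s \<in> h ` fib i x" "t \<in> h ` fib i x" for s t
    unfolding q_def by (intro image_fib_mix[OF h _ that(2) j'] image_fib_mix[OF h u that(1) j])
  have g: "g w \<in> fib i x" "h (g w) = w" if "w \<in> h ` fib i x" for w
    using that by (auto simp: g_def inv_into_into f_inv_into_f)
  have hP: "w \<in> P" if "w \<in> h ` fib i x" for w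
    using isom_in[OF h fib_in[OF g(1)[OF that]]] by (simp only: g(2)[OF that])
  have Dg: "d i (g (q s t) i) (g (q s' t') i) = d j (s j) (s' j) + d j' (t j') (t' j')"
    if "s \<in> h ` fib i x" "t \<in> h ` fib i x" "s' \<in> h ` fib i x" "t' \<in> h ` fib i x" for s t s' t'
  proof -
    have "d i (g (q s t) i) (g (q s' t') i) = D (g (q s t)) (g (q s' t'))"
      by (rule fib_D[OF g(1)[OF q[OF that(1,2)]] g(1)[OF q[OF that(3,4)]] i, symmetric])
    also have "\<dots> = D (q s t) (q s' t')"
      using isom_D[OF h fib_in[OF g(1)[OF q[OF that(1,2)]]] fib_in[OF g(1)[OF q[OF that(3,4)]]]]
      by (simp only: g(2)[OF q[OF that(1,2)]] g(2)[OF q[OF that(3,4)]])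
    also have "\<dots> = (\<Sum>l\<in>{j, j'}. d l (q s t l) (q s' t' l))"
      unfolding l1_dist_def
      by (rule sum.mono_neutral_right)
        (use j j' dself coord[OF hP[OF u]] in \<open>auto simp: q_def\<close>)
    finally show ?thesis using ne by (simp add: q_def)
  qed
  have "d j (\<alpha> 0 j) (\<alpha> M j) \<le> K0 \<or> d j' (\<beta> 0 j') (\<beta> N j') \<le> K0"
    unfolding K0_def
  proof (rule rectangle_side_bound[OF const fp[OF i], where f = "\<lambda>s t. f i (g (q s t) i)" and A = "\<lambda>s t. d j (s j) (t j)"
        and B = "\<lambda>s t. d j' (s j') (t j')"])
    show "f i (g (q (\<alpha> k) (\<beta> l)) i) \<in> V i" if "k \<le> M" "l \<le> N" for k l
      using fV[OF i] coord[OF fib_in[OF g(1)[OF q[OF \<alpha>(3) \<beta>(3)]]] i] that by blast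
    show "(d j (\<alpha> k j) (\<alpha> k' j) + d j' (\<beta> l j') (\<beta> l' j')) / L - C
          \<le> E i (f i (g (q (\<alpha> k) (\<beta> l)) i)) (f i (g (q (\<alpha> k') (\<beta> l')) i)) \<and>
          E i (f i (g (q (\<alpha> k) (\<beta> l)) i)) (f i (g (q (\<alpha> k') (\<beta> l')) i))
          \<le> L * (d j (\<alpha> k j) (\<alpha> k' j) + d j' (\<beta> l j') (\<beta> l' j')) + C"
      if "k \<le> M" "k' \<le> M" "l \<le> N" "l' \<le> N" for k k' l l'
    proof -
      note m = \<alpha>(3)[OF that(1)] \<beta>(3)[OF that(3)] \<alpha>(3)[OF that(2)] \<beta>(3)[OF that(4)]
      have "g (q (\<alpha> k) (\<beta> l)) i \<in> X i" "g (q (\<alpha> k') (\<beta> l')) i \<in> X i"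
        using coord[OF fib_in[OF g(1)[OF q]] i] m by blast+
      from qi[OF i this] show ?thesis unfolding Dg[OF m] .
    qed
    show "d j (\<alpha> k j) (\<alpha> k j) = 0" if "k \<le> M" for k using dself[OF j coord[OF hP[OF \<alpha>(3)[OF that]] j]] .
    show "d j' (\<beta> k j') (\<beta> k j') = 0" if "k \<le> N" for k using dself[OF j' coord[OF hP[OF \<beta>(3)[OF that]] j']] .
  qed (use \<alpha>(4)[OF j] \<beta>(4)[OF j'] d0[OF j] d0[OF j'] dsym[OF j] dsym[OF j'] in blast)+
  then show ?thesis by (simp add: \<alpha> \<beta>)
qed

section \<open>The permutation of the unbounded factors\<close>

definition unbounded :: "nat set" where
  "unbounded = {i. i < n \<and> \<not> (\<exists>B. \<forall>x\<in>X i. \<forall>y\<in>X i. d i x y \<le> B)}"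

definition unbounded_image :: "((nat \<Rightarrow> 'x) \<Rightarrow> (nat \<Rightarrow> 'x)) \<Rightarrow> nat \<Rightarrow> (nat \<Rightarrow> 'x) \<Rightarrow> nat \<Rightarrow> bool" where
  "unbounded_image h i x j \<longleftrightarrow>
     j < n \<and> \<not> (\<exists>B. \<forall>u\<in>fib i x. \<forall>v\<in>fib i x. d j (h u j) (h v j) \<le> B)"

text \<open>Bounds in all directions would add up to a bound for the fibre itself, because
  \<open>h\<close> preserves \<open>D\<close>.\<close>

lemma unbounded_image_ex:
  assumes h: "isom h" and i: "i \<in> unbounded" and x: "x \<in> P"
  shows "\<exists>j. unbounded_image h i x j"
proof (rule ccontr)
  assume "\<not> ?thesis"
  then have "\<forall>j. \<exists>B. j < n \<longrightarrow> (\<forall>u\<in>fib i x. \<forall>v\<in>fib i x. d j (h u j) (h v j) \<le> B)"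
    by (auto simp: unbounded_image_def)
  then obtain B where B: "\<And>j u v. j < n \<Longrightarrow> u \<in> fib i x \<Longrightarrow> v \<in> fib i x \<Longrightarrow> d j (h u j) (h v j) \<le> B j"
    by metis
  have i': "i < n" using i by (simp add: unbounded_def)
  have "d i s t \<le> (\<Sum>j<n. B j)" if "s \<in> X i" "t \<in> X i" for s t
  proof -
    have m: "x(i := s) \<in> fib i x" "x(i := t) \<in> fib i x" using fun_upd_fib[OF x i'] that by auto
    have "d i s t = D (h (x(i := s))) (h (x(i := t)))"
      using fib_D[OF m i'] isom_D[OF h] fib_in m by simp
    also have "\<dots> \<le> (\<Sum>j<n. B j)" unfolding l1_dist_def using B m by (intro sum_mono) auto
    finally show ?thesis .
  qed
  then show False using i unfolding unbounded_def by blast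
qed

lemma unbounded_image_others:
  assumes h: "isom h" and i: "i < n" and j: "unbounded_image h i x j"
    and j': "j' < n" "j' \<noteq> j" and uv: "u \<in> fib i x" "v \<in> fib i x"
  shows "d j' (h u j') (h v j') \<le> K0"
proof -
  obtain a b where "a \<in> fib i x" "b \<in> fib i x" "\<not> d j (h a j) (h b j) \<le> K0"
    using j unfolding unbounded_image_def by blast
  then show ?thesis using image_fib_thin[OF h i _ j'(1), of j "h a" x "h b" "h u" "h v"] j j' uv
    by (auto simp: unbounded_image_def)
qed

lemma unbounded_image_unique:
  assumes h: "isom h" and i: "i < n" and "unbounded_image h i x j" "unbounded_image h i x j'"
  shows "j = j'"
proof (rule ccontr)
  assume "j \<noteq> j'"
  then have "\<forall>u\<in>fib i x. \<forall>v\<in>fib i x. d j' (h u j') (h v j') \<le> K0"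
    using unbounded_image_others[OF h i assms(3)] assms(4) by (auto simp: unbounded_image_def)
  then show False using assms(4) unfolding unbounded_image_def by blast
qed

text \<open>Parallel fibres have images at finite Hausdorff distance.\<close>

lemma unbounded_image_parallel:
  assumes h: "isom h" and i: "i < n" and x: "x \<in> P" and y: "y \<in> P" and j: "unbounded_image h i x j"
  shows "unbounded_image h i y j"
proof (rule ccontr)
  assume "\<not> ?thesis"
  then obtain B where B: "\<And>u v. u \<in> fib i y \<Longrightarrow> v \<in> fib i y \<Longrightarrow> d j (h u j) (h v j) \<le> B"
    using j by (auto simp: unbounded_image_def)
  have jn: "j < n" using j by (simp add: unbounded_image_def)
  define T where "T u = y(i := u i)" for u :: "nat \<Rightarrow> 'x"
  have T: "T u \<in> fib i y" if "u \<in> fib i x" for u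
    using fun_upd_fib[OF y i coord[OF fib_in[OF that] i]] by (simp add: T_def)
  have DT: "D u (T u) \<le> D x y" if "u \<in> fib i x" for u
    unfolding l1_dist_def
  proof (rule sum_mono)
    fix l assume l: "l \<in> {..<n}"
    show "d l (u l) (T u l) \<le> d l (x l) (y l)"
      using that l d0[of l] dself[of l "u l"] coord[OF fib_in[OF that], of l] by (auto simp: T_def fib_def)
  qed
  have "d j (h u j) (h v j) \<le> B + 2 * D x y" if uv: "u \<in> fib i x" "v \<in> fib i x" for u v
  proof -
    note m = fib_in[OF uv(1)] fib_in[OF uv(2)] fib_in[OF T[OF uv(1)]] fib_in[OF T[OF uv(2)]]
    note hm = isom_in[OF h m(1)] isom_in[OF h m(2)] isom_in[OF h m(3)] isom_in[OF h m(4)]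
    have "d j (h u j) (h (T u) j) \<le> D x y"
      using d_le_D[OF jn, of "h u" "h (T u)"] isom_D[OF h m(1,3)] DT[OF uv(1)] by linarith
    moreover have "d j (h (T v) j) (h v j) \<le> D x y"
      using d_le_D[OF jn, of "h v" "h (T v)"] isom_D[OF h m(2,4)] DT[OF uv(2)]
        dsym[OF jn, of "h v j" "h (T v) j"] by linarith
    moreover have "d j (h (T u) j) (h (T v) j) \<le> B" using B T uv by blast
    ultimately show ?thesis
      using dtri[OF jn hm(1) hm(3) hm(2)] dtri[OF jn hm(3) hm(4) hm(2)] by linarith
  qed
  then show False using j unfolding unbounded_image_def by blast
qed

text \<open>Up to bounded error, \<open>h\<close> maps fibres of the factor \<open>i\<close> into fibres of the factor \<open>perm h i\<close>.\<close>

definition perm :: "((nat \<Rightarrow> 'x) \<Rightarrow> (nat \<Rightarrow> 'x)) \<Rightarrow> nat \<Rightarrow> nat" where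
  "perm h i = (SOME j. \<forall>x\<in>P. unbounded_image h i x j)"

lemma perm:
  assumes h: "isom h" and i: "i \<in> unbounded" and x: "x \<in> P"
  shows "unbounded_image h i x (perm h i)"
proof -
  have i': "i < n" using i by (simp add: unbounded_def)
  obtain j where "unbounded_image h i x j" using unbounded_image_ex[OF h i x] by blast
  then have "\<forall>y\<in>P. unbounded_image h i y j" using unbounded_image_parallel[OF h i' x] by blast
  then have "\<forall>y\<in>P. unbounded_image h i y (perm h i)" unfolding perm_def by (rule someI)
  then show ?thesis using x by blast
qed

lemma perm_eqI:
  assumes "isom h" "i \<in> unbounded" "x \<in> P" "unbounded_image h i x j"
  shows "perm h i = j"
proof -
  have "i < n" using assms(2) by (simp add: unbounded_def)
  from unbounded_image_unique[OF assms(1) this perm[OF assms(1-3)] assms(4)] show ?thesis .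
qed

lemma perm_unbounded:
  assumes h: "isom h" and i: "i \<in> unbounded" and x: "x \<in> P"
  shows "perm h i \<in> unbounded"
proof -
  have j: "unbounded_image h i x (perm h i)" by (rule perm[OF assms])
  have "False" if "\<forall>s\<in>X (perm h i). \<forall>t\<in>X (perm h i). d (perm h i) s t \<le> B" for B
    using j that isom_in[OF h] fib_in coord unfolding unbounded_image_def by metis
  then show ?thesis using j unfolding unbounded_def unbounded_image_def by blast
qed

text \<open>Along a fibre the total distance is preserved, and each direction other than
  \<open>perm h i\<close> absorbs at most \<open>K0\<close> of it.\<close>

lemma perm_fib_dist:
  assumes h: "isom h" and i: "i \<in> unbounded" and u: "u \<in> P" and v: "v \<in> fib i u"
  shows "d i (u i) (v i) - real n * K0 \<le> d (perm h i) (h u (perm h i)) (h v (perm h i))"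
    and "d (perm h i) (h u (perm h i)) (h v (perm h i)) \<le> d i (u i) (v i)"
    and "j < n \<Longrightarrow> j \<noteq> perm h i \<Longrightarrow> d j (h u j) (h v j) \<le> K0"
proof -
  have i': "i < n" using i by (simp add: unbounded_def)
  have uu: "u \<in> fib i u" using u by (simp add: fib_def)
  have b: "unbounded_image h i u (perm h i)" using perm[OF h i u] .
  then have pn: "perm h i < n" by (simp add: unbounded_image_def)
  show 1: "d j (h u j) (h v j) \<le> K0" if "j < n" "j \<noteq> perm h i" for j
    using unbounded_image_others[OF h i' b that uu v] .
  have D: "D (h u) (h v) = d i (u i) (v i)" using isom_D[OF h u fib_in[OF v]] fib_D[OF uu v i'] by simp
  show "d (perm h i) (h u (perm h i)) (h v (perm h i)) \<le> d i (u i) (v i)"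
    using d_le_D[OF pn, of "h u" "h v"] D by simp
  show "d i (u i) (v i) - real n * K0 \<le> d (perm h i) (h u (perm h i)) (h v (perm h i))"
    using D_le_of_others[OF pn, of "h u" "h v" K0] 1 K0 D by simp
qed

lemma perm_comp:
  assumes g: "isom g" and h: "isom h" and k: "isom k" and kgh: "\<And>x. x \<in> P \<Longrightarrow> k x = g (h x)"
    and i: "i \<in> unbounded" and x: "x \<in> P"
  shows "perm k i = perm g (perm h i)"
proof -
  define j where "j = perm h i"
  define l where "l = perm g j"
  have i': "i < n" using i by (simp add: unbounded_def)
  have j: "j \<in> unbounded" using perm_unbounded[OF h i x] by (simp add: j_def)
  then have jn: "j < n" by (simp add: unbounded_def)
  have "l \<in> unbounded" using perm_unbounded[OF g j x] by (simp add: l_def)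
  then have ln: "l < n" by (simp add: unbounded_def)
  have "unbounded_image k i x l"
  proof (rule ccontr)
    assume "\<not> ?thesis"
    then obtain B where B: "\<And>u v. u \<in> fib i x \<Longrightarrow> v \<in> fib i x \<Longrightarrow> d l (k u l) (k v l) \<le> B"
      using ln by (auto simp: unbounded_image_def)
    have "unbounded_image h i x j" using perm[OF h i x] by (simp add: j_def)
    then obtain u v where uv: "u \<in> fib i x" "v \<in> fib i x" "\<not> d j (h u j) (h v j) \<le> B + 2 * (real n * K0)"
      unfolding unbounded_image_def by blast
    note m = fib_in[OF uv(1)] fib_in[OF uv(2)]
    note hm = isom_in[OF h m(1)] isom_in[OF h m(2)]
    have vu: "v \<in> fib i u" using uv by (simp add: fib_def)
    \<comment> \<open>\<open>h v\<close> lies only near the fibre of \<open>h u\<close>. It is moved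
      to a point \<open>w\<close> of this fibre, at a cost of at most \<open>real n * K0\<close>, so
      that the fibre estimate for \<open>g\<close> applies.\<close>
    define w where "w = (h u)(j := h v j)"
    have w: "w \<in> fib j (h u)" "w j = h v j" "w \<in> P"
      using fun_upd_fib[OF hm(1) jn coord[OF hm(2) jn]] fib_in by (auto simp: w_def)
    have "D w (h v) \<le> d j (w j) (h v j) + real n * K0"
    proof (rule D_le_of_others[OF jn _ K0])
      fix a assume "a < n" "a \<noteq> j"
      then show "d a (w a) (h v a) \<le> K0"
        using perm_fib_dist(3)[OF h i m(1) vu, of a] by (simp add: w_def j_def)
    qed
    then have "D w (h v) \<le> real n * K0" using w dself[OF jn coord[OF hm(2) jn]] by simp
    then have 1: "d l (g w l) (g (h v) l) \<le> real n * K0"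
      using d_le_D[OF ln, of "g w" "g (h v)"] isom_D[OF g w(3) hm(2)] by linarith
    have 2: "d j (h u j) (h v j) - real n * K0 \<le> d l (g (h u) l) (g w l)"
      using perm_fib_dist(1)[OF g j hm(1) w(1)] w(2) by (simp add: l_def)
    have "d l (g (h u) l) (g w l) \<le> d l (g (h u) l) (g (h v) l) + d l (g (h v) l) (g w l)"
      using dtri[OF ln isom_in[OF g hm(1)] isom_in[OF g hm(2)] isom_in[OF g w(3)]] .
    then have "d j (h u j) (h v j) - 2 * (real n * K0) \<le> d l (k u l) (k v l)"
      using 1 2 dsym[OF ln, of "g w l"] kgh m by simp
    then show False using B[OF uv(1,2)] uv(3) by simp
  qed
  from perm_eqI[OF k i x this] show ?thesis by (simp only: l_def j_def)
qed

lemma perm_id: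
  assumes h: "isom h" "\<And>x. x \<in> P \<Longrightarrow> h x = x" and i: "i \<in> unbounded" and x: "x \<in> P"
  shows "perm h i = i"
proof (rule perm_eqI[OF h(1) i x])
  have i': "i < n" using i by (simp add: unbounded_def)
  have "\<not> (\<forall>u\<in>fib i x. \<forall>v\<in>fib i x. d i (h u i) (h v i) \<le> B)" for B
  proof
    assume B: "\<forall>u\<in>fib i x. \<forall>v\<in>fib i x. d i (h u i) (h v i) \<le> B"
    have "d i s t \<le> B" if "s \<in> X i" "t \<in> X i" for s t
      using B fun_upd_fib[OF x i' that(1)] fun_upd_fib[OF x i' that(2)] h(2) fib_in
      by (metis fun_upd_same)
    then show False using i unfolding unbounded_def by blast
  qed
  then show "unbounded_image h i x i" using i' by (auto simp: unbounded_image_def)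
qed

definition B0 :: real where
  "B0 = (SOME B. 0 \<le> B \<and> (\<forall>i<n. i \<notin> unbounded \<longrightarrow> (\<forall>x\<in>X i. \<forall>y\<in>X i. d i x y \<le> B)))"

lemma B0: "0 \<le> B0" "i < n \<Longrightarrow> i \<notin> unbounded \<Longrightarrow> x \<in> X i \<Longrightarrow> y \<in> X i \<Longrightarrow> d i x y \<le> B0"
proof -
  have "\<forall>i. \<exists>B. i < n \<longrightarrow> i \<notin> unbounded \<longrightarrow> (\<forall>x\<in>X i. \<forall>y\<in>X i. d i x y \<le> B)"
    by (auto simp: unbounded_def)
  then obtain b where b: "\<And>i x y. i < n \<Longrightarrow> i \<notin> unbounded \<Longrightarrow> x \<in> X i \<Longrightarrow> y \<in> X i \<Longrightarrow> d i x y \<le> b i"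
    by metis
  have "\<exists>B. 0 \<le> B \<and> (\<forall>i<n. i \<notin> unbounded \<longrightarrow> (\<forall>x\<in>X i. \<forall>y\<in>X i. d i x y \<le> B))"
  proof (intro exI conjI allI impI ballI)
    show "0 \<le> (\<Sum>i<n. \<bar>b i\<bar>)" by (simp add: sum_nonneg)
    fix i x y assume i: "i < n" "i \<notin> unbounded" "x \<in> X i" "y \<in> X i"
    have "d i x y \<le> \<bar>b i\<bar>" using b[OF i] by linarith
    also have "\<dots> \<le> (\<Sum>i<n. \<bar>b i\<bar>)" using i by (intro member_le_sum) auto
    finally show "d i x y \<le> (\<Sum>i<n. \<bar>b i\<bar>)" .
  qed
  from someI_ex[OF this] show "0 \<le> B0" "i < n \<Longrightarrow> i \<notin> unbounded \<Longrightarrow> x \<in> X i \<Longrightarrow> y \<in> X i \<Longrightarrow> d i x y \<le> B0"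
    unfolding B0_def by blast+
qed

text \<open>Pass from \<open>x\<close> to \<open>y\<close> one coordinate at a time. The change of
  coordinate \<open>i\<close> costs at most its own distance in direction \<open>i\<close>; another
  unbounded coordinate contributes at most \<open>K0\<close> there, a bounded one at most
  \<open>B0\<close>. Along the orbit of a group element, inverse powers supply the reverse
  estimate.\<close>

lemma almost_isometry_on_factor:
  assumes h: "isom h" and p: "\<And>j. j \<in> unbounded \<Longrightarrow> perm h j = j"
    and x: "x \<in> P" and y: "y \<in> P" and i: "i \<in> unbounded"
  shows "d i (h x i) (h y i) \<le> d i (x i) (y i) + 2 * real n * (K0 + B0)"
proof -
  have i': "i < n" using i by (simp add: unbounded_def)
  define z where "z m = (\<lambda>j. if j < m then y j else x j)" for m :: nat
  have z: "z m \<in> P" for m using x y by (auto simp: z_def PiE_iff extensional_def)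
  have zs: "z (Suc m) \<in> fib m (z m)" for m using z by (auto simp: fib_def z_def)
  have ends: "z 0 = x" "z n = y"
    using x y by (auto simp: z_def PiE_iff extensional_def fun_eq_iff)
  let ?K = "K0 + B0"
  have step: "d i (h (z m) i) (h (z (Suc m)) i) \<le> ?K" if "m < n" "m \<noteq> i" for m
  proof (cases "m \<in> unbounded")
    case True
    then show ?thesis using perm_fib_dist(3)[OF h True z zs i'] p[OF True] that B0(1) by auto
  next
    case False
    have "d i (h (z m) i) (h (z (Suc m)) i) \<le> D (z m) (z (Suc m))"
      using d_le_D[OF i', of "h (z m)" "h (z (Suc m))"] isom_D[OF h z z] by simp
    also have "\<dots> = d m (z m m) (z (Suc m) m)"
      using fib_D[of "z m" m "z m" "z (Suc m)"] zs z that by (simp add: fib_def)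
    also have "\<dots> \<le> B0" using B0(2)[OF that(1) False] coord[OF z that(1)] by blast
    finally show ?thesis using K0 by simp
  qed
  have chain: "d i (h (z a) i) (h (z (a + k)) i) \<le> real k * ?K"
    if "\<And>m. a \<le> m \<Longrightarrow> m < a + k \<Longrightarrow> m < n \<and> m \<noteq> i" for a k
    using that
  proof (induction k)
    case 0
    then show ?case using dself[OF i' coord[OF isom_in[OF h z] i']] by simp
  next
    case (Suc k)
    have "d i (h (z a) i) (h (z (a + k)) i) \<le> real k * ?K" using Suc by auto
    moreover have "d i (h (z (a + k)) i) (h (z (Suc (a + k))) i) \<le> ?K" using step Suc.prems[of "a + k"] by auto
    ultimately show ?case
      using dtri[OF i' isom_in[OF h z] isom_in[OF h z] isom_in[OF h z], of a "a + Suc k" "a + k"]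
      by (simp add: algebra_simps)
  qed
  have 1: "d i (h x i) (h (z i) i) \<le> real i * ?K" using chain[of 0 i] i' by (simp add: ends)
  have 2: "d i (h (z (Suc i)) i) (h y i) \<le> real (n - Suc i) * ?K"
    using chain[of "Suc i" "n - Suc i"] i' by (simp add: ends)
  have 3: "d i (h (z i) i) (h (z (Suc i)) i) \<le> d i (x i) (y i)"
    using perm_fib_dist(2)[OF h i z zs] p[OF i] by (simp add: z_def)
  have "d i (h x i) (h y i) \<le> real i * ?K + d i (x i) (y i) + real (n - Suc i) * ?K"
    using 1 2 3 dtri[OF i' isom_in[OF h x] isom_in[OF h z] isom_in[OF h y], of i]
      dtri[OF i' isom_in[OF h z] isom_in[OF h z] isom_in[OF h y], of i "Suc i"] by linarith
  moreover have "real i * ?K \<le> real n * ?K" "real (n - Suc i) * ?K \<le> real n * ?K"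
    using i' K0 B0(1) by (auto intro!: mult_right_mono)
  ultimately show ?thesis by (simp add: algebra_simps)
qed

end

section \<open>Distorted elements obstruct property QT\<close>

text \<open>\<open>four_point\<close> does not ask that distinct points have positive distance, so
  it survives maps that are not injective.\<close>

lemma four_point_pullback:
  assumes "four_point V E" "\<And>x. f x \<in> V"
  shows "four_point UNIV (\<lambda>x y. E (f x) (f y))"
proof -
  interpret four_point V E by fact
  show ?thesis by unfold_locales (use assms(2) sym self four in auto)
qed

definition coarse_tree_data ::
    "'x set \<Rightarrow> ('x \<Rightarrow> 'x \<Rightarrow> real) \<Rightarrow> 'v set \<Rightarrow> ('v \<Rightarrow> 'v \<Rightarrow> real) \<Rightarrow> ('x \<Rightarrow> 'v) \<Rightarrow> real \<Rightarrow> bool" where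
  "coarse_tree_data X d V E f M \<longleftrightarrow> M \<ge> 1 \<and> four_point V E \<and> (\<forall>x\<in>X. f x \<in> V) \<and>
    (\<forall>x\<in>X. \<forall>y\<in>X. d x y / M - M \<le> E (f x) (f y) \<and> E (f x) (f y) \<le> M * d x y + M) \<and>
    (\<forall>x\<in>X. \<forall>y\<in>X. \<exists>z (N :: nat). z 0 = x \<and> z N = y \<and> (\<forall>k\<le>N. z k \<in> X) \<and> (\<forall>k<N. d (z k) (z (Suc k)) \<le> M))"

text \<open>A walk in the tree between two image points is lifted vertex by vertex, each vertex to a
  point of \<open>X\<close> whose image is within \<open>D\<close> of it.\<close>

lemma quasi_tree_coarse_data:
  assumes "quasi_tree TYPE('v) X d"
  shows "\<exists>(V :: 'v set) E f M. coarse_tree_data X d V E f M"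
proof -
  from assms obtain V :: "'v set" and G f where m: "Metric_space X d" and t: "tree V G"
    and qi: "quasi_isometry X d V (path_dist V G) f"
    unfolding quasi_tree_def by blast
  interpret Metric_space X d by (rule m)
  define E where "E = path_dist V G"
  interpret T: four_point V E unfolding E_def by (rule tree_four_point[OF t])
  have "qi_embedding X d V E f" and "\<exists>D\<ge>0. \<forall>v\<in>V. \<exists>x\<in>X. E (f x) v \<le> D"
    using qi unfolding quasi_isometry_def E_def by blast+
  then obtain L C D where fV: "\<And>x. x \<in> X \<Longrightarrow> f x \<in> V" and L: "L \<ge> 1" and C: "C \<ge> 0" and D: "D \<ge> 0"
    and lo: "\<And>x y. x \<in> X \<Longrightarrow> y \<in> X \<Longrightarrow> d x y / L - C \<le> E (f x) (f y)"
    and up: "\<And>x y. x \<in> X \<Longrightarrow> y \<in> X \<Longrightarrow> E (f x) (f y) \<le> L * d x y + C"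
    and dense: "\<And>v. v \<in> V \<Longrightarrow> \<exists>x\<in>X. E (f x) v \<le> D"
    unfolding qi_embedding_def by (metis Pi_mem)
  define c where "c = L * (2 * D + 1 + C)"
  define M where "M = L + C + c"
  have c: "c \<ge> 0" using L C D by (simp add: c_def)
  have M: "M \<ge> 1" "L \<le> M" "C \<le> M" "c \<le> M" using L C c by (auto simp: M_def)
  have lo': "d x y \<le> L * (E (f x) (f y) + C)" if "x \<in> X" "y \<in> X" for x y
    using lo[OF that] L by (simp add: field_simps)
  have chain: "\<exists>z (N :: nat). z 0 = x \<and> z N = y \<and> (\<forall>k\<le>N. z k \<in> X) \<and> (\<forall>k<N. d (z k) (z (Suc k)) \<le> M)"
    if x: "x \<in> X" and y: "y \<in> X" for x y
  proof -
    have "\<forall>u\<in>V. \<forall>v\<in>V. \<exists>p. walk V G p \<and> hd p = u \<and> last p = v"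
      using t unfolding tree_def by (elim conjE)
    then obtain p where p: "walk V G p" "hd p = f x" "last p = f y" using fV[OF x] fV[OF y] by blast
    define N where "N = length p"
    have N: "N > 0" using p by (auto simp: walk_def N_def)
    obtain s where s: "\<And>v. v \<in> V \<Longrightarrow> s v \<in> X \<and> E (f (s v)) v \<le> D" using dense by metis
    \<comment> \<open>The walk has the vertices \<open>p ! 0\<close> to \<open>p ! (N - 1)\<close>;
      the chain has one point more, so that \<open>x\<close> and \<open>y\<close> are its exact ends
      and its last step leads from a point with image near \<open>f y\<close> to
      \<open>y\<close>.\<close>
    define z where "z k = (if k = 0 then x else if k < N then s (p ! k) else y)" for k
    have pV: "p ! k \<in> V" if "k < N" for k using p(1) that by (auto simp: walk_def N_def)
    have zX: "z k \<in> X" for k using x y s pV by (auto simp: z_def)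
    have near: "E (f (z k)) (p ! k) \<le> D" if "k < N" for k
    proof (cases "k = 0")
      case True
      then have "p ! k = f x" using p N by (simp add: hd_conv_nth N_def)
      then show ?thesis using True D T.self[OF fV[OF x]] by (simp add: z_def)
    qed (use s[OF pV[OF that]] that in \<open>simp add: z_def\<close>)
    have step: "d (z k) (z (Suc k)) \<le> M" if "k < N" for k
    proof -
      have "E (f (z k)) (f (z (Suc k))) \<le> 2 * D + 1"
      proof (cases "Suc k < N")
        case True
        have "(p ! k, p ! Suc k) \<in> G"
          using p(1) True successively_conv_nth[of "\<lambda>u v. (u, v) \<in> G" p] by (auto simp: walk_def N_def)
        then have "E (p ! k) (p ! Suc k) \<le> 1" unfolding E_def by (rule path_dist_edge[OF t])
        moreover note near[OF that] near[OF True]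
        moreover have "E (f (z k)) (f (z (Suc k))) \<le> E (f (z k)) (p ! k) + E (p ! k) (f (z (Suc k)))"
          using fV[OF zX] pV that by (intro T.triangle) auto
        moreover have "E (p ! k) (f (z (Suc k))) \<le> E (p ! k) (p ! Suc k) + E (p ! Suc k) (f (z (Suc k)))"
          using fV[OF zX] pV that True by (intro T.triangle) auto
        moreover have "E (p ! Suc k) (f (z (Suc k))) = E (f (z (Suc k))) (p ! Suc k)"
          using fV[OF zX] pV True by (intro T.sym) auto
        ultimately show ?thesis by linarith
      next
        case False
        then have "Suc k = N" using that by simp
        then have k: "k = length p - 1" "z (Suc k) = y" by (auto simp: N_def z_def)
        have "p ! k = f y" using p(3) N last_conv_nth[of p] unfolding k(1) N_def by auto
        note \<open>z (Suc k) = y\<close> \<open>p ! k = f y\<close>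
        then show ?thesis using near[OF that] D by simp
      qed
      then have "L * (E (f (z k)) (f (z (Suc k))) + C) \<le> c" using L by (simp add: c_def)
      then show ?thesis using lo'[OF zX zX, of k "Suc k"] M by linarith
    qed
    show ?thesis
    proof (intro exI[of _ z] exI[of _ N] conjI allI impI)
      show "z 0 = x" "z N = y" using N by (auto simp: z_def)
    qed (use zX step in auto)
  qed
  have "d x y / M - M \<le> E (f x) (f y)" "E (f x) (f y) \<le> M * d x y + M" if "x \<in> X" "y \<in> X" for x y
  proof -
    have "d x y / M \<le> d x y / L" using L M by (intro divide_left_mono) auto
    then show "d x y / M - M \<le> E (f x) (f y)" using lo[OF that] M by linarith
    have "L * d x y \<le> M * d x y" using M by (intro mult_right_mono) auto
    then show "E (f x) (f y) \<le> M * d x y + M" using up[OF that] M by linarith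
  qed
  note bounds = this
  show ?thesis unfolding coarse_tree_data_def
    by (intro exI[of _ V] exI[of _ E] exI[of _ f] exI[of _ M] conjI ballI
        M(1) T.four_point_axioms fV bounds chain)
qed

lemma quasi_tree_product_ex:
  assumes "\<forall>i<n. quasi_tree TYPE('v) (X i) (d i)"
  shows "\<exists>(V :: nat \<Rightarrow> 'v set) E f M. quasi_tree_product n X d V E f M M M"
proof -
  have "\<forall>i. \<exists>V E f M. i < n \<longrightarrow> coarse_tree_data (X i) (d i) (V :: 'v set) E f M"
    using assms quasi_tree_coarse_data by blast
  then obtain V :: "nat \<Rightarrow> 'v set" and E f M
    where data: "\<And>i. i < n \<Longrightarrow> coarse_tree_data (X i) (d i) (V i) (E i) (f i) (M i)" by metis
  note Q = data[unfolded coarse_tree_data_def]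
  define K where "K = 1 + (\<Sum>i<n. M i)"
  have M1: "M i \<ge> 1" if "i < n" for i using Q[OF that] by blast
  have "0 \<le> (\<Sum>i<n. M i)" using M1 by (intro sum_nonneg) force
  then have K1: "K \<ge> 1" by (simp add: K_def)
  have MK: "M i \<le> K" if "i < n" for i
  proof -
    have "M i \<le> (\<Sum>i<n. M i)" using that M1 by (intro member_le_sum) force+
    then show ?thesis by (simp add: K_def)
  qed
  have met: "Metric_space (X i) (d i)" if "i < n" for i using assms that by (auto simp: quasi_tree_def)
  have "quasi_tree_product n X d V E f K K K"
  proof (rule quasi_tree_product.intro)
    fix i assume i: "i < n"
    note q = Q[OF i]
    show "Metric_space (X i) (d i)" using met[OF i] .
    show "four_point (V i) (E i)" using q by blast
    show "f i x \<in> V i" if "x \<in> X i" for x using q that by blast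
    fix x y assume xy: "x \<in> X i" "y \<in> X i"
    have d0: "0 \<le> d i x y" using Metric_space.nonneg[OF met[OF i]] .
    have "d i x y / K \<le> d i x y / M i" using MK[OF i] M1[OF i] d0 by (intro divide_left_mono) auto
    moreover have "M i * d i x y \<le> K * d i x y" using MK[OF i] d0 by (intro mult_right_mono) auto
    moreover have "d i x y / M i - M i \<le> E i (f i x) (f i y)" "E i (f i x) (f i y) \<le> M i * d i x y + M i"
      using q xy by blast+
    ultimately show "d i x y / K - K \<le> E i (f i x) (f i y) \<and> E i (f i x) (f i y) \<le> K * d i x y + K"
      using MK[OF i] by linarith
    obtain z and N :: nat where z: "z 0 = x" "z N = y" "\<forall>k\<le>N. z k \<in> X i" "\<forall>k<N. d i (z k) (z (Suc k)) \<le> M i"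
      using q xy by blast
    then show "\<exists>z (N :: nat). z 0 = x \<and> z N = y \<and> (\<forall>k\<le>N. z k \<in> X i) \<and> (\<forall>k<N. d i (z k) (z (Suc k)) \<le> K)"
      using MK[OF i] order_trans by blast
  qed (use K1 in auto)
  then show ?thesis by blast
qed

section \<open>Word length and finiteness of balls\<close>

context group
begin

lemma foldr_mult_closed: "set w \<subseteq> carrier G \<Longrightarrow> foldr (\<otimes>) w \<one> \<in> carrier G"
  by (induction w) auto

lemma foldr_mult_append:
  "set v \<subseteq> carrier G \<Longrightarrow> set w \<subseteq> carrier G \<Longrightarrow>
   foldr (\<otimes>) (v @ w) \<one> = foldr (\<otimes>) v \<one> \<otimes> foldr (\<otimes>) w \<one>"
  by (induction v) (auto simp: m_assoc foldr_mult_closed)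

lemma generate_word:
  assumes "S \<subseteq> carrier G" "g \<in> generate G S"
  shows "\<exists>w. set w \<subseteq> S \<union> m_inv G ` S \<and> foldr (\<otimes>) w \<one> = g"
  using assms(2)
proof (induction rule: generate.induct)
  case one
  show ?case by (intro exI[of _ "[]"]) auto
next
  case (incl h)
  then show ?case using assms by (intro exI[of _ "[h]"]) auto
next
  case (inv h)
  then show ?case using assms by (intro exI[of _ "[inv h]"]) auto
next
  case (eng h1 h2)
  then obtain v w where "set v \<subseteq> S \<union> m_inv G ` S" "foldr (\<otimes>) v \<one> = h1"
    "set w \<subseteq> S \<union> m_inv G ` S" "foldr (\<otimes>) w \<one> = h2" by blast
  moreover have "S \<union> m_inv G ` S \<subseteq> carrier G" using assms by auto
  ultimately show ?case using foldr_mult_append[of v w] by (intro exI[of _ "v @ w"]) auto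
qed

context
  fixes S assumes S: "finite_generating_set G S"
begin

lemma word_length_attained:
  assumes "g \<in> carrier G"
  shows "\<exists>w. set w \<subseteq> S \<union> m_inv G ` S \<and> length w = word_length G S g \<and> foldr (\<otimes>) w \<one> = g"
proof -
  have "\<exists>w. set w \<subseteq> S \<union> m_inv G ` S \<and> foldr (\<otimes>) w \<one> = g"
    using generate_word[of S g] S assms by (auto simp: finite_generating_set_def)
  then have "\<exists>k w. set w \<subseteq> S \<union> m_inv G ` S \<and> length w = k \<and> foldr (\<otimes>) w \<one> = g" by blast
  then show ?thesis unfolding word_length_def by (rule LeastI_ex)
qed

lemma word_length_le:
  "set w \<subseteq> S \<union> m_inv G ` S \<Longrightarrow> foldr (\<otimes>) w \<one> = g \<Longrightarrow> word_length G S g \<le> length w"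
  unfolding word_length_def by (rule Least_le) blast

lemma word_length_mult:
  assumes "g \<in> carrier G" "h \<in> carrier G"
  shows "word_length G S (g \<otimes> h) \<le> word_length G S g + word_length G S h"
proof -
  obtain v where v: "set v \<subseteq> S \<union> m_inv G ` S" "length v = word_length G S g" "foldr (\<otimes>) v \<one> = g"
    using word_length_attained[OF assms(1)] by blast
  obtain w where w: "set w \<subseteq> S \<union> m_inv G ` S" "length w = word_length G S h" "foldr (\<otimes>) w \<one> = h"
    using word_length_attained[OF assms(2)] by blast
  have "S \<union> m_inv G ` S \<subseteq> carrier G" using S by (auto simp: finite_generating_set_def)
  then have "foldr (\<otimes>) (v @ w) \<one> = g \<otimes> h" using foldr_mult_append[of v w] v w by auto
  then show ?thesis using word_length_le[of "v @ w"] v w by auto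
qed

lemma word_length_pow:
  assumes "g \<in> carrier G"
  shows "word_length G S (g [^] (k :: nat)) \<le> k * word_length G S g"
proof (induction k)
  case 0
  show ?case using word_length_le[of "[]" \<one>] by simp
next
  case (Suc k)
  then show ?case using word_length_mult[of "g [^] k" g] assms by simp
qed

lemma finite_word_ball: "finite {g \<in> carrier G. word_length G S g \<le> R}"
proof -
  have "finite (S \<union> m_inv G ` S)" using S by (auto simp: finite_generating_set_def)
  then have "finite {w. set w \<subseteq> S \<union> m_inv G ` S \<and> length w \<le> R}" by (rule finite_lists_length_le)
  moreover have "{g \<in> carrier G. word_length G S g \<le> R} \<subseteq>
      (\<lambda>w. foldr (\<otimes>) w \<one>) ` {w. set w \<subseteq> S \<union> m_inv G ` S \<and> length w \<le> R}"
  proof clarify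
    fix g assume g: "g \<in> carrier G" "word_length G S g \<le> R"
    then obtain w where "set w \<subseteq> S \<union> m_inv G ` S" "length w = word_length G S g" "foldr (\<otimes>) w \<one> = g"
      using word_length_attained by blast
    then show "g \<in> (\<lambda>w. foldr (\<otimes>) w \<one>) ` {w. set w \<subseteq> S \<union> m_inv G ` S \<and> length w \<le> R}"
      using g by (intro image_eqI[of _ _ w]) auto
  qed
  ultimately show ?thesis by (blast intro: finite_surj)
qed

end

text \<open>Through the orbit map, linear growth in a single factor would force linear word length,
  against the distortion, for which arbitrarily large \<open>k\<close> are enough. Bounded orbits in
  all factors would place infinitely many powers of \<open>a\<close> in a finite ball.\<close>

theorem not_property_QT_of_distorted:
  assumes a: "a \<in> carrier G" and inf: "inj (\<lambda>k :: nat. a [^] k)"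
    and distorted: "\<And>S \<epsilon> M. finite_generating_set G S \<Longrightarrow> \<epsilon> > 0 \<Longrightarrow>
      \<exists>k\<ge>M. real (word_length G S (a [^] (k :: nat))) \<le> \<epsilon> * real k"
  shows "\<not> property_QT TYPE('x) TYPE('v) G"
proof
  assume "property_QT TYPE('x) TYPE('v) G"
  then obtain S n and X :: "nat \<Rightarrow> 'x set" and d \<phi> p where S: "finite_generating_set G S"
    and qt: "\<forall>i<n. quasi_tree TYPE('v) (X i) (d i)"
    and act: "isometric_action G (PiE {..<n} X) (l1_dist n d) \<phi>"
    and p: "p \<in> PiE {..<n} X"
    and emb: "qi_embedding (carrier G) (word_dist G S) (PiE {..<n} X) (l1_dist n d) (\<lambda>g. \<phi> g p)"
    unfolding property_QT_def by blast
  obtain V :: "nat \<Rightarrow> 'v set" and E f M where "quasi_tree_product n X d V E f M M M"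
    using quasi_tree_product_ex[OF qt] by blast
  then interpret Q: quasi_tree_product n X d V E f M M M .
  interpret A: group_action G Q.P \<phi> using act by (simp add: isometric_action_def)
  have iso: "Q.isom (\<phi> g)" if "g \<in> carrier G" for g
    using act that A.bij_prop0[OF that] by (auto simp: Q.isom_def isometric_action_def Bij_def)
  have comp: "\<phi> (g \<otimes> h) x = \<phi> g (\<phi> h x)" if "g \<in> carrier G" "h \<in> carrier G" "x \<in> Q.P" for g h x
    using A.composition_rule that by blast
  have id: "\<phi> \<one> x = x" if "x \<in> Q.P" for x using A.id_eq_one that by (metis restrict_apply')
  obtain L C where L: "L \<ge> 1" "C \<ge> 0" and qi: "\<And>g. g \<in> carrier G \<Longrightarrow>
      real (word_length G S g) / L - C \<le> Q.D p (\<phi> g p) \<and> Q.D p (\<phi> g p) \<le> L * real (word_length G S g) + C"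
  proof -
    from emb obtain L C where LC: "L \<ge> 1" "C \<ge> 0" and q: "\<And>g h. g \<in> carrier G \<Longrightarrow> h \<in> carrier G \<Longrightarrow>
        word_dist G S g h / L - C \<le> Q.D (\<phi> g p) (\<phi> h p) \<and> Q.D (\<phi> g p) (\<phi> h p) \<le> L * word_dist G S g h + C"
      unfolding qi_embedding_def by metis
    show ?thesis using LC q[OF one_closed] id[OF p] by (intro that[of L C]) (auto simp: word_dist_def)
  qed
  define I where "I = Q.unbounded"
  have I: "finite I" "\<And>i. i \<in> I \<Longrightarrow> i < n" by (auto simp: I_def Q.unbounded_def)
  \<comment> \<open>Restriction to \<open>I\<close> places these maps in the finite set
    \<open>PiE I (\<lambda>_. I)\<close>, so two powers of \<open>a\<close> share one, and their
    quotient fixes all unbounded factors.\<close>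
  define \<sigma> where "\<sigma> g = restrict (Q.perm (\<phi> g)) I" for g
  have \<sigma>I: "\<sigma> g i \<in> I" if "g \<in> carrier G" "i \<in> I" for g i
    using Q.perm_unbounded[OF iso[OF that(1)] _ p] that by (simp add: \<sigma>_def I_def)
  have \<sigma>_mult: "\<sigma> (g \<otimes> h) i = \<sigma> g (\<sigma> h i)" if "g \<in> carrier G" "h \<in> carrier G" "i \<in> I" for g h i
  proof -
    have "Q.perm (\<phi> (g \<otimes> h)) i = Q.perm (\<phi> g) (Q.perm (\<phi> h) i)"
      using that by (intro Q.perm_comp[OF iso iso iso comp _ p]) (auto simp: I_def)
    then show ?thesis using that \<sigma>I[OF that(2,3)] by (simp add: \<sigma>_def)
  qed
  have \<sigma>_one: "\<sigma> \<one> i = i" if "i \<in> I" for i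
    using Q.perm_id[OF iso[OF one_closed] id _ p] that by (simp add: \<sigma>_def I_def)
  obtain N :: nat where N: "N > 0" "\<And>i. i \<in> I \<Longrightarrow> \<sigma> (a [^] N) i = i"
  proof -
    have "range (\<lambda>k :: nat. \<sigma> (a [^] k)) \<subseteq> PiE I (\<lambda>_. I)"
      using \<sigma>I[OF nat_pow_closed[OF a]] by (auto simp: \<sigma>_def)
    moreover have "finite (PiE I (\<lambda>_. I))" using I by (intro finite_PiE) auto
    ultimately have "finite (range (\<lambda>k :: nat. \<sigma> (a [^] k)))" by (rule finite_subset)
    then have "\<not> inj (\<lambda>k :: nat. \<sigma> (a [^] k))" using finite_imageD infinite_UNIV_nat by blast
    then obtain k l :: nat where kl: "k < l" "\<sigma> (a [^] k) = \<sigma> (a [^] l)"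
      unfolding inj_def by (metis linorder_neqE_nat)
    have "\<sigma> (a [^] (l - k)) i = i" if i: "i \<in> I" for i
    proof -
      have ak: "a [^] k \<in> carrier G" "a [^] (l - k) \<in> carrier G" using a by auto
      have "a [^] l = a [^] k \<otimes> a [^] (l - k)" using kl a by (simp add: nat_pow_mult)
      then have "\<sigma> (a [^] k) (\<sigma> (a [^] (l - k)) i) = \<sigma> (a [^] k) i" using \<sigma>_mult[OF ak i] kl by simp
      then have "\<sigma> (inv (a [^] k) \<otimes> a [^] k) (\<sigma> (a [^] (l - k)) i) = \<sigma> (inv (a [^] k) \<otimes> a [^] k) i"
        using \<sigma>_mult[OF inv_closed[OF ak(1)] ak(1)] i \<sigma>I[OF ak(2) i] by simp
      then show ?thesis using \<sigma>_one i \<sigma>I[OF ak(2) i] ak by simp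
    qed
    then show ?thesis using kl by (intro that[of "l - k"]) auto
  qed
  define b where "b = a [^] N"
  have b: "b \<in> carrier G" using a by (simp add: b_def)
  have bk: "b [^] k \<in> carrier G" for k :: int using b by simp
  have \<sigma>b1: "\<sigma> b i = i" if "i \<in> I" for i using N(2)[OF that] by (simp only: b_def)
  have \<sigma>_nat: "\<sigma> (b [^] k) i = i" if i: "i \<in> I" for i and k :: nat
  proof (induction k)
    case 0
    show ?case using \<sigma>_one[OF i] by (simp only: nat_pow_0)
  next
    case (Suc k)
    show ?case unfolding nat_pow_Suc \<sigma>_mult[OF nat_pow_closed[OF b] b i] \<sigma>b1[OF i] by (rule Suc)
  qed
  have \<sigma>_b: "\<sigma> (b [^] k) i = i" if i: "i \<in> I" for i and k :: int
  proof (cases k rule: int_cases4)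
    case (nonneg m)
    then show ?thesis using \<sigma>_nat[OF i, of m] by (simp only: int_pow_int)
  next
    case (neg m)
    define c where "c = b [^] m"
    have c: "c \<in> carrier G" using b by (simp add: c_def)
    have k: "b [^] k = inv c" using neg int_pow_neg_int[OF b, of m] by (simp only: c_def)
    have "\<sigma> (inv c \<otimes> c) i = \<sigma> (inv c) i"
      using \<sigma>_mult[OF inv_closed[OF c] c i] \<sigma>_nat[OF i, of m] by (simp only: c_def)
    then show ?thesis unfolding k l_inv[OF c] using \<sigma>_one[OF i] by (simp only:)
  qed
  define x where "x k = \<phi> (b [^] k) p" for k :: int
  have xP: "x k \<in> Q.P" for k using Q.isom_in[OF iso[OF bk] p] by (simp add: x_def)
  have x_add: "x (i + k) = \<phi> (b [^] k) (x i)" for i k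
    using comp[OF bk bk p] int_pow_mult[OF b, of k i] by (simp add: x_def add.commute)
  have x0: "x 0 = p" using id[OF p] by (simp add: x_def)
  define K where "K = 2 * real n * (Q.K0 + Q.B0)"
  have K: "K \<ge> 0" using Q.K0 Q.B0(1) by (simp add: K_def)
  have shift: "d m (x (i + k) m) (x (j + k) m) \<le> d m (x i m) (x j m) + K" if m: "m \<in> I" for i j k m
    unfolding x_add K_def
    using \<sigma>_b m by (intro Q.almost_isometry_on_factor[OF iso[OF bk] _ xP xP]) (auto simp: \<sigma>_def I_def)
  have M: "M \<ge> 1" using Q.const by simp
  define e where "e m i j = E m (f m (x i m)) (f m (x j m))" for m i j
  have xX: "x i m \<in> X m" if "m \<in> I" for i m using Q.coord[OF xP I(2)[OF that]] .
  have e_up: "e m i j \<le> M * d m (x i m) (x j m) + M" if m: "m \<in> I" for i j m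
    using Q.qi[OF I(2)[OF m] xX[OF m] xX[OF m]] by (simp add: e_def)
  have e_lo: "d m (x i m) (x j m) \<le> M * (e m i j + M)" if m: "m \<in> I" for i j m
    using Q.qi[OF I(2)[OF m] xX[OF m] xX[OF m], of i j] M by (simp add: e_def field_simps)
  \<comment> \<open>From the tree to the factor and back: \<open>e_lo\<close> and
    \<open>e_up\<close> cost a factor \<open>M\<close> each, and the shift of the factor in between
    adds \<open>K\<close>.\<close>
  have si: "shift_invariant (e m) (M * M) (M * (M * M) + M * K + M)" if m: "m \<in> I" for m
  proof (intro shift_invariant.intro shift_invariant_axioms.intro)
    show "four_point UNIV (e m)" unfolding e_def
      using four_point_pullback[OF Q.fp[OF I(2)[OF m]], of "\<lambda>i. f m (x i m)"] Q.fV[OF I(2)[OF m] xX[OF m]] by blast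
    show "1 \<le> M * M" using mult_mono[of 1 M 1 M] M by simp
    show "0 \<le> M * (M * M) + M * K + M" using M K by simp
    fix i j k
    have "e m (i + k) (j + k) \<le> M * d m (x (i + k) m) (x (j + k) m) + M" by (rule e_up[OF m])
    also have "\<dots> \<le> M * (d m (x i m) (x j m) + K) + M" using shift[OF m] M by simp
    also have "\<dots> \<le> M * (M * (e m i j + M) + K) + M" using e_lo[OF m, of i j] M by simp
    also have "\<dots> = M * M * e m i j + (M * (M * M) + M * K + M)" by (simp add: algebra_simps)
    finally show "e m (i + k) (j + k) \<le> M * M * e m i j + (M * (M * M) + M * K + M)" .
  qed
  show False
  proof (cases "\<exists>m\<in>I. \<not> (\<exists>B. \<forall>k. e m 0 k \<le> B)")
    case True
    then obtain m where m: "m \<in> I" "\<not> (\<exists>B. \<forall>k. e m 0 k \<le> B)" by blast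
    obtain u where u: "u \<ge> 1" "\<And>i :: nat. real i \<le> e m 0 (int i * u)"
      using shift_invariant.linear_growth[OF si[OF m(1)] m(2)] by blast
    \<comment> \<open>\<open>b [^] (int k * u)\<close> equals \<open>(a [^] k) [^] w\<close>, so
      growth along the multiples of \<open>u\<close> bounds the word length of every power of
      \<open>a\<close> from below.\<close>
    define w where "w = N * nat u"
    have w: "w > 0" using u N by (simp add: w_def)
    have lin: "real k \<le> M * (L * (real w * real (word_length G S (a [^] k))) + C) + M" for k :: nat
    proof -
      have "b [^] (int k * u) = b [^] int (k * nat u)" using u by simp
      also have "\<dots> = b [^] (k * nat u)" by (rule int_pow_int)
      also have "\<dots> = a [^] (N * (k * nat u))" using a by (simp add: b_def nat_pow_pow)
      also have "N * (k * nat u) = k * w" by (simp add: w_def algebra_simps)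
      also have "a [^] (k * w) = (a [^] k) [^] w" using a by (simp add: nat_pow_pow)
      finally have bw: "b [^] (int k * u) = (a [^] k) [^] w" .
      have "real k \<le> M * d m (x 0 m) (x (int k * u) m) + M" using u(2)[of k] e_up[OF m(1), of 0 "int k * u"] by linarith
      also have "\<dots> \<le> M * Q.D p (x (int k * u)) + M"
        using Q.d_le_D[OF I(2)[OF m(1)], of p "x (int k * u)"] M by (simp add: x0)
      also have "\<dots> \<le> M * (L * real (word_length G S ((a [^] k) [^] w)) + C) + M"
        using qi[OF bk, of "int k * u"] M by (simp add: x_def bw)
      also have "\<dots> \<le> M * (L * (real w * real (word_length G S (a [^] k))) + C) + M"
        using word_length_pow[OF S, of "a [^] k" w] a M L by (simp flip: of_nat_mult)
      finally show ?thesis .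
    qed
    \<comment> \<open>Makes the part of \<open>lin\<close> that contains the word length at most
      \<open>real k / 2\<close>; the rest is constant.\<close>
    define \<epsilon> where "\<epsilon> = 1 / (2 * M * L * real w)"
    have \<epsilon>: "\<epsilon> > 0" using M L w by (simp add: \<epsilon>_def)
    obtain k where k: "k \<ge> nat \<lceil>2 * (M * C + M) + 1\<rceil>" "real (word_length G S (a [^] k)) \<le> \<epsilon> * real k"
      using distorted[OF S \<epsilon>] by blast
    have "M * (L * (real w * real (word_length G S (a [^] k)))) \<le> M * (L * (real w * (\<epsilon> * real k)))"
      using k M L by (intro mult_left_mono) auto
    also have "\<dots> = real k / 2" using M L w by (simp add: \<epsilon>_def field_simps)
    finally have "real k \<le> 2 * (M * C + M)" using lin[of k] by (simp add: algebra_simps)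
    moreover have "real k \<ge> 2 * (M * C + M) + 1" using k(1) by linarith
    ultimately show False by simp
  next
    case False
    then have "\<forall>m. \<exists>B. m \<in> I \<longrightarrow> (\<forall>k. e m 0 k \<le> B)" by blast
    then obtain B where B: "\<And>m k. m \<in> I \<Longrightarrow> e m 0 k \<le> B m" by metis
    define R where "R = (\<Sum>m<n. if m \<in> I then M * (B m + M) else Q.B0)"
    have DR: "Q.D p (x k) \<le> R" for k
      unfolding l1_dist_def R_def
    proof (rule sum_mono)
      fix m assume mn: "m \<in> {..<n}"
      show "d m (p m) (x k m) \<le> (if m \<in> I then M * (B m + M) else Q.B0)"
      proof (cases "m \<in> I")
        case True
        have "M * (e m 0 k + M) \<le> M * (B m + M)" using B[OF True] M by simp
        then show ?thesis using e_lo[OF True, of 0 k] True by (simp add: x0)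
      next
        case False
        then show ?thesis using Q.B0(2)[of m "p m" "x k m"] mn Q.coord[OF p] Q.coord[OF xP] by (simp add: I_def)
      qed
    qed
    have "word_length G S (a [^] (N * k)) \<le> nat \<lceil>L * (R + C)\<rceil>" for k :: nat
    proof -
      have "a [^] (N * k) = b [^] int k" using a by (simp add: b_def nat_pow_pow int_pow_int)
      then have "real (word_length G S (a [^] (N * k))) / L - C \<le> R"
        using qi[OF bk, of "int k"] DR[of "int k"] by (simp add: x_def)
      then have "real (word_length G S (a [^] (N * k))) \<le> L * (R + C)" using L by (simp add: field_simps)
      then show ?thesis by linarith
    qed
    then have "range (\<lambda>k. a [^] (N * k)) \<subseteq> {g \<in> carrier G. word_length G S g \<le> nat \<lceil>L * (R + C)\<rceil>}"
      using a by auto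
    then have "finite (range (\<lambda>k. a [^] (N * k)))" using finite_word_ball[OF S] finite_subset by blast
    moreover have "inj (\<lambda>k. a [^] (N * k))"
    proof (rule injI)
      fix k l assume "a [^] (N * k) = a [^] (N * l)"
      from injD[OF inf this] show "k = l" using N(1) by simp
    qed
    ultimately show False using finite_imageD infinite_UNIV_nat by blast
  qed
qed

end

section \<open>Actions on pseudometric spaces\<close>

text \<open>Pseudometrics are used because the points of the Baumslag-Solitar tree are represented
  by complex numbers in many ways.\<close>

locale pseudo_metric =
  fixes P :: "'x set" and d :: "'x \<Rightarrow> 'x \<Rightarrow> real"
  assumes nonneg: "0 \<le> d x y" and sym: "d x y = d y x" and self: "x \<in> P \<Longrightarrow> d x x = 0"
    and triangle: "x \<in> P \<Longrightarrow> y \<in> P \<Longrightarrow> z \<in> P \<Longrightarrow> d x z \<le> d x y + d y z"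
begin

definition geodesic_pair :: "'x \<Rightarrow> 'x \<Rightarrow> bool" where
  "geodesic_pair x y \<longleftrightarrow> (\<exists>c. (\<forall>s\<in>{0..d x y}. c s \<in> P) \<and> d (c 0) x = 0 \<and> d (c (d x y)) y = 0 \<and>
     (\<forall>s\<in>{0..d x y}. \<forall>t\<in>{0..d x y}. d (c s) (c t) = \<bar>s - t\<bar>))"

lemma geodesic_pair_sym:
  assumes "geodesic_pair x y"
  shows "geodesic_pair y x"
proof -
  obtain c where c: "\<forall>s\<in>{0..d x y}. c s \<in> P" "d (c 0) x = 0" "d (c (d x y)) y = 0"
     "\<forall>s\<in>{0..d x y}. \<forall>t\<in>{0..d x y}. d (c s) (c t) = \<bar>s - t\<bar>"
    using assms unfolding geodesic_pair_def by blast
  show ?thesis unfolding geodesic_pair_def sym[of y x]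
    by (rule exI[of _ "\<lambda>s. c (d x y - s)"]) (use c in auto)
qed

lemma geodesic_pair_zero: "x \<in> P \<Longrightarrow> y \<in> P \<Longrightarrow> d x y = 0 \<Longrightarrow> geodesic_pair x y"
  unfolding geodesic_pair_def by (rule exI[of _ "\<lambda>_. x"]) (auto simp: self)

lemma geodesic_pair_concat:
  assumes P: "x \<in> P" "y \<in> P" "z \<in> P" and add: "d x y + d y z = d x z"
    and xy: "geodesic_pair x y" and yz: "geodesic_pair y z"
  shows "geodesic_pair x z"
proof -
  define a b where "a = d x y" and "b = d y z"
  have ab: "a \<ge> 0" "b \<ge> 0" "d x z = a + b" using add nonneg by (auto simp: a_def b_def)
  obtain c1 where c1': "\<forall>s\<in>{0..a}. c1 s \<in> P" "d (c1 0) x = 0" "d (c1 a) y = 0"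
     "\<forall>s\<in>{0..a}. \<forall>t\<in>{0..a}. d (c1 s) (c1 t) = \<bar>s - t\<bar>"
    using xy unfolding geodesic_pair_def a_def[symmetric] by blast
  have c1: "0 \<le> s \<Longrightarrow> s \<le> a \<Longrightarrow> c1 s \<in> P" "d (c1 0) x = 0" "d (c1 a) y = 0"
     "0 \<le> s \<Longrightarrow> s \<le> a \<Longrightarrow> 0 \<le> t \<Longrightarrow> t \<le> a \<Longrightarrow> d (c1 s) (c1 t) = \<bar>s - t\<bar>" for s t
    using c1' by auto
  obtain c2 where c2': "\<forall>s\<in>{0..b}. c2 s \<in> P" "d (c2 0) y = 0" "d (c2 b) z = 0"
     "\<forall>s\<in>{0..b}. \<forall>t\<in>{0..b}. d (c2 s) (c2 t) = \<bar>s - t\<bar>"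
    using yz unfolding geodesic_pair_def b_def[symmetric] by blast
  have c2: "0 \<le> s \<Longrightarrow> s \<le> b \<Longrightarrow> c2 s \<in> P" "d (c2 0) y = 0" "d (c2 b) z = 0"
     "0 \<le> s \<Longrightarrow> s \<le> b \<Longrightarrow> 0 \<le> t \<Longrightarrow> t \<le> b \<Longrightarrow> d (c2 s) (c2 t) = \<bar>s - t\<bar>" for s t
    using c2' by auto
  define c where "c s = (if s \<le> a then c1 s else c2 (s - a))" for s
  have cP: "c s \<in> P" if "0 \<le> s" "s \<le> a + b" for s using that c1(1) c2(1) by (auto simp: c_def)
  \<comment> \<open>The upper bound goes through \<open>y\<close>. The lower bound subtracts the two
    end pieces from \<open>d x z\<close>, which is \<open>a + b\<close> by the hypothesis
    \<open>add\<close>.\<close>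
  have mixed: "d (c1 s) (c2 t) = a - s + t" if s: "0 \<le> s" "s \<le> a" and t: "0 \<le> t" "t \<le> b" for s t
  proof -
    have m: "c1 s \<in> P" "c1 a \<in> P" "c1 0 \<in> P" "c2 t \<in> P" "c2 0 \<in> P" "c2 b \<in> P"
      using c1(1) c2(1) s t ab by auto
    have "d (c1 s) (c1 a) = a - s" "d (c2 0) (c2 t) = t" "d (c1 0) (c1 s) = s" "d (c2 t) (c2 b) = b - t"
      using c1(4)[of s a] c2(4)[of 0 t] c1(4)[of 0 s] c2(4)[of t b] s t ab by auto
    moreover have "d x (c1 0) = 0" "d y (c2 0) = 0" using c1(2) c2(2) sym by metis+
    moreover have "d (c1 s) (c2 t) \<le> d (c1 s) (c1 a) + d (c1 a) (c2 t)" using m by (intro triangle)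
    moreover have "d (c1 a) (c2 t) \<le> d (c1 a) y + d y (c2 t)" using m P by (intro triangle)
    moreover have "d y (c2 t) \<le> d y (c2 0) + d (c2 0) (c2 t)" using m P by (intro triangle)
    moreover have "d x z \<le> d x (c1 s) + d (c1 s) z" using m P by (intro triangle)
    moreover have "d x (c1 s) \<le> d x (c1 0) + d (c1 0) (c1 s)" using m P by (intro triangle)
    moreover have "d (c1 s) z \<le> d (c1 s) (c2 t) + d (c2 t) z" using m P by (intro triangle)
    moreover have "d (c2 t) z \<le> d (c2 t) (c2 b) + d (c2 b) z" using m P by (intro triangle)
    ultimately show ?thesis using c1(3) c2(3) ab by linarith
  qed
  have iso: "d (c s) (c t) = t - s" if st: "0 \<le> s" "s \<le> t" "t \<le> a + b" for s t
  proof (cases "t \<le> a")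
    case True
    then show ?thesis using c1(4)[of s t] st by (simp add: c_def)
  next
    case t: False
    show ?thesis
    proof (cases "s \<le> a")
      case True
      then show ?thesis using mixed[of s "t - a"] st t by (simp add: c_def)
    next
      case False
      then show ?thesis using c2(4)[of "s - a" "t - a"] st t by (simp add: c_def)
    qed
  qed
  have abs: "d (c s) (c t) = \<bar>s - t\<bar>" if "0 \<le> s" "s \<le> a + b" "0 \<le> t" "t \<le> a + b" for s t
    using iso[of s t] iso[of t s] sym[of "c s" "c t"] that by (cases "s \<le> t") auto
  \<comment> \<open>For \<open>b = 0\<close> the curve never enters \<open>c2\<close>, as
    \<open>c\<close> follows \<open>c1\<close> at \<open>s = a\<close>.\<close>
  have end_z: "d (c (a + b)) z = 0"
  proof (cases "b = 0")
    case True
    then have "d (c1 a) z \<le> 0"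
      using triangle[of "c1 a" y z] P c1(1)[of a] c1(3) ab by (simp add: b_def)
    then show ?thesis using True nonneg[of "c1 a" z] by (simp add: c_def)
  next
    case False
    then show ?thesis using c2(3) ab by (simp add: c_def)
  qed
  have start_x: "d (c 0) x = 0" using c1(2) ab by (simp add: c_def)
  show ?thesis unfolding geodesic_pair_def ab(3)
    by (intro exI[of _ c] conjI ballI start_x end_z cP abs) (simp_all only: atLeastAtMost_iff)
qed

text \<open>Choosing a representative among the points at distance 0 turns a pseudometric space into a
  metric space.\<close>

definition rep :: "'x \<Rightarrow> 'x" where "rep x = (SOME y. y \<in> P \<and> d x y = 0)"

lemma rep: "x \<in> P \<Longrightarrow> rep x \<in> P \<and> d x (rep x) = 0"
  unfolding rep_def by (rule someI[of _ x]) (simp add: self)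

lemma zero_trans: "x \<in> P \<Longrightarrow> y \<in> P \<Longrightarrow> z \<in> P \<Longrightarrow> d x y = 0 \<Longrightarrow> d x z = d y z"
  using triangle[of x y z] triangle[of y x z] sym[of x y] by force

lemma rep_eq:
  assumes "x \<in> P" "y \<in> P" "d x y = 0"
  shows "rep x = rep y"
proof -
  have "(\<lambda>z. z \<in> P \<and> d x z = 0) = (\<lambda>z. z \<in> P \<and> d y z = 0)"
    using zero_trans assms by (intro ext) metis
  then show ?thesis by (simp add: rep_def)
qed

lemma rep_rep: "x \<in> P \<Longrightarrow> rep (rep x) = rep x"
  using rep_eq[of x "rep x"] rep by simp

lemma d_rep: "x \<in> P \<Longrightarrow> y \<in> P \<Longrightarrow> d x (rep y) = d x y"
  using rep[of y] zero_trans[of y "rep y" x] sym[of x y] sym[of x "rep y"] by simp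

lemma d_rep_rep: "x \<in> P \<Longrightarrow> y \<in> P \<Longrightarrow> d (rep x) (rep y) = d x y"
  using d_rep[of "rep x" y] rep d_rep[of y x] sym by metis

lemma Metric_space_rep: "Metric_space (rep ` P) d"
proof
  show "0 \<le> d x y" for x y by (rule nonneg)
  show "d x y = d y x" for x y by (rule sym)
  show "d x y = 0 \<longleftrightarrow> x = y" if "x \<in> rep ` P" "y \<in> rep ` P" for x y
  proof -
    obtain a b where ab: "a \<in> P" "b \<in> P" "x = rep a" "y = rep b" using \<open>x \<in> rep ` P\<close> \<open>y \<in> rep ` P\<close> by blast
    show ?thesis
    proof
      assume "d x y = 0"
      then have "d a b = 0" using d_rep_rep[OF ab(1,2)] by (simp only: ab)
      then show "x = y" using rep_eq[OF ab(1,2)] by (simp only: ab)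
    next
      assume "x = y"
      then show "d x y = 0" using self[of x] rep[OF ab(1)] by (simp only: ab)
    qed
  qed
  show "d x z \<le> d x y + d y z" if "x \<in> rep ` P" "y \<in> rep ` P" "z \<in> rep ` P" for x y z
    using that rep by (intro triangle) blast+
qed

lemma hyperbolic_space_rep:
  assumes "P \<noteq> {}" "\<And>x y. x \<in> P \<Longrightarrow> y \<in> P \<Longrightarrow> geodesic_pair x y" "\<exists>\<delta>\<ge>0. gromov_hyperbolic \<delta> P d"
  shows "hyperbolic_space (rep ` P) d"
  unfolding hyperbolic_space_def geodesic_space_def
proof (intro conjI ballI)
  show "rep ` P \<noteq> {}" using assms by simp
  show "Metric_space (rep ` P) d" by (rule Metric_space_rep)
  have "rep ` P \<subseteq> P" using rep by auto
  then show "\<exists>\<delta>\<ge>0. gromov_hyperbolic \<delta> (rep ` P) d"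
    using assms(3) unfolding gromov_hyperbolic_def by blast
  fix x y assume "x \<in> rep ` P" "y \<in> rep ` P"
  then have xy: "x \<in> P" "y \<in> P" "rep x = x" "rep y = y" using rep rep_rep by auto
  obtain c where c: "\<forall>s\<in>{0..d x y}. c s \<in> P" "d (c 0) x = 0" "d (c (d x y)) y = 0"
     "\<forall>s\<in>{0..d x y}. \<forall>t\<in>{0..d x y}. d (c s) (c t) = \<bar>s - t\<bar>"
    using assms(2)[OF xy(1,2)] unfolding geodesic_pair_def by blast
  have z: "0 \<in> {0..d x y}" "d x y \<in> {0..d x y}" using nonneg by auto
  show "\<exists>c. c \<in> {0..d x y} \<rightarrow> rep ` P \<and> c 0 = x \<and> c (d x y) = y \<and>
        (\<forall>s\<in>{0..d x y}. \<forall>t\<in>{0..d x y}. d (c s) (c t) = \<bar>s - t\<bar>)"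
  proof (intro exI[of _ "\<lambda>s. rep (c s)"] conjI ballI)
    show "rep (c 0) = x" using rep_eq[OF _ xy(1) c(2)] c(1) z xy by simp
    show "rep (c (d x y)) = y" using rep_eq[OF _ xy(2) c(3)] c(1) z xy by simp
  qed (use c d_rep_rep in auto)
qed

end

text \<open>Each factor carries its own action, so every element stabilizes every factor. An action
  need not respect the chosen representatives and is followed by \<open>rep\<close>; being isometric
  it respects distance 0, and so the composite is again an action. Properness is tested at the base
  points only.\<close>

lemma property_PH_of_pseudometric_actions:
  fixes P :: "nat \<Rightarrow> 'x set" and d :: "nat \<Rightarrow> 'x \<Rightarrow> 'x \<Rightarrow> real" and \<alpha> :: "nat \<Rightarrow> 'g \<Rightarrow> 'x \<Rightarrow> 'x"
    and G :: "('g, 'b) monoid_scheme" (structure)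
  assumes G: "group G"
    and pm: "\<And>i. i < n \<Longrightarrow> pseudo_metric (P i) (d i)"
    and base: "\<And>i. i < n \<Longrightarrow> p i \<in> P i"
    and geo: "\<And>i x y. i < n \<Longrightarrow> x \<in> P i \<Longrightarrow> y \<in> P i \<Longrightarrow> pseudo_metric.geodesic_pair (P i) (d i) x y"
    and hyp: "\<And>i. i < n \<Longrightarrow> \<exists>\<delta>\<ge>0. gromov_hyperbolic \<delta> (P i) (d i)"
    and closed: "\<And>i g x. i < n \<Longrightarrow> g \<in> carrier G \<Longrightarrow> x \<in> P i \<Longrightarrow> \<alpha> i g x \<in> P i"
    and mult: "\<And>i g h x. i < n \<Longrightarrow> g \<in> carrier G \<Longrightarrow> h \<in> carrier G \<Longrightarrow> x \<in> P i \<Longrightarrow>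
      \<alpha> i (g \<otimes> h) x = \<alpha> i g (\<alpha> i h x)"
    and one: "\<And>i x. i < n \<Longrightarrow> x \<in> P i \<Longrightarrow> \<alpha> i \<one> x = x"
    and iso: "\<And>i g x y. i < n \<Longrightarrow> g \<in> carrier G \<Longrightarrow> x \<in> P i \<Longrightarrow> y \<in> P i \<Longrightarrow>
      d i (\<alpha> i g x) (\<alpha> i g y) = d i x y"
    and cobounded: "\<And>i. i < n \<Longrightarrow> \<exists>\<epsilon>. \<forall>y\<in>P i. \<exists>g\<in>carrier G. d i (\<alpha> i g (p i)) y \<le> \<epsilon>"
    and proper: "\<And>R. finite {g \<in> carrier G. \<forall>i<n. d i (p i) (\<alpha> i g (p i)) \<le> R}"
  shows "property_PH TYPE('x) G"
proof -
  interpret group G by (rule G)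
  define rep where "rep i = pseudo_metric.rep (P i) (d i)" for i
  define X where "X i = rep i ` P i" for i
  define Q where "Q = PiE {..<n} X"
  define \<phi> where "\<phi> g = (\<lambda>x\<in>Q. \<lambda>i\<in>{..<n}. rep i (\<alpha> i g (x i)))" for g
  note rep = pseudo_metric.rep[OF pm, folded rep_def]
    and rep_eq = pseudo_metric.rep_eq[OF pm, folded rep_def]
    and rep_rep = pseudo_metric.rep_rep[OF pm, folded rep_def]
    and d_rep = pseudo_metric.d_rep[OF pm, folded rep_def]
    and d_rep_rep = pseudo_metric.d_rep_rep[OF pm, folded rep_def]
    and tri = pseudo_metric.triangle[OF pm] and nonneg = pseudo_metric.nonneg[OF pm]
    and dsym = pseudo_metric.sym[OF pm]
  have XP: "x \<in> P i" "rep i x = x" if "i < n" "x \<in> X i" for i x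
    using that rep rep_rep by (auto simp: X_def)
  have QX: "x i \<in> X i" if "x \<in> Q" "i < n" for x i using that by (auto simp: Q_def)
  have \<phi>i: "\<phi> g x i = rep i (\<alpha> i g (x i))" if "x \<in> Q" "i < n" for g x i using that by (simp add: \<phi>_def)
  have QP: "x i \<in> P i" if "x \<in> Q" "i < n" for x i using XP QX that by blast
  have \<phi>_in: "\<phi> g x \<in> Q" if "g \<in> carrier G" "x \<in> Q" for g x
    using that closed[OF _ that(1) QP[OF that(2)]] by (auto simp: \<phi>_def Q_def X_def)
  have ext: "x = y" if "x \<in> Q" "y \<in> Q" "\<And>i. i < n \<Longrightarrow> x i = y i" for x y
    using that unfolding Q_def by (intro PiE_ext[of x "{..<n}" X y]) auto
  have \<phi>_one: "\<phi> \<one> x = x" if "x \<in> Q" for x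
    using that \<phi>_in by (intro ext) (auto simp: \<phi>i one QP XP(2) QX)
  have \<phi>_mult: "\<phi> (g \<otimes> h) x = \<phi> g (\<phi> h x)" if g: "g \<in> carrier G" and h: "h \<in> carrier G" and x: "x \<in> Q" for g h x
  proof (rule ext)
    fix i assume i: "i < n"
    have y: "\<alpha> i h (x i) \<in> P i" using closed[OF i h QP[OF x i]] .
    have r: "rep i (\<alpha> i h (x i)) \<in> P i" "d i (\<alpha> i h (x i)) (rep i (\<alpha> i h (x i))) = 0" using rep[OF i y] by auto
    have "rep i (\<alpha> i g (\<alpha> i h (x i))) = rep i (\<alpha> i g (rep i (\<alpha> i h (x i))))"
      using iso[OF i g y r(1)] r(2) by (intro rep_eq[OF i closed[OF i g y] closed[OF i g r(1)]]) simp
    then show "\<phi> (g \<otimes> h) x i = \<phi> g (\<phi> h x) i"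
      using i x \<phi>_in[OF h x] by (simp add: \<phi>i mult[OF i g h QP[OF x i]])
  qed (use g h x \<phi>_in in auto)
  have bij: "\<phi> g \<in> Bij Q" if g: "g \<in> carrier G" for g
  proof -
    have "bij_betw (\<phi> g) Q Q"
      by (rule bij_betw_byWitness[where f' = "\<phi> (inv g)"])
        (use \<phi>_mult[of "inv g" g] \<phi>_mult[of g "inv g"] \<phi>_one \<phi>_in g in auto)
    then show ?thesis by (simp add: Bij_def \<phi>_def)
  qed
  have act: "group_action G Q \<phi>"
    unfolding group_action_def group_hom_def group_hom_axioms_def
  proof (intro conjI G group_BijGroup homI)
    show "\<phi> g \<in> carrier (BijGroup Q)" if "g \<in> carrier G" for g using bij[OF that] by (simp add: BijGroup_def)
    show "\<phi> (g \<otimes> h) = \<phi> g \<otimes>\<^bsub>BijGroup Q\<^esub> \<phi> h" if gh: "g \<in> carrier G" "h \<in> carrier G" for g h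
    proof -
      have "\<phi> (g \<otimes> h) = compose Q (\<phi> g) (\<phi> h)"
        by (rule extensionalityI[of _ Q]) (use \<phi>_mult[OF gh] in \<open>auto simp: \<phi>_def compose_def\<close>)
      then show ?thesis using bij gh by (simp add: BijGroup_def)
    qed
  qed
  have d_\<phi>: "d i (\<phi> g x i) (\<phi> g y i) = d i (x i) (y i)"
    if "i < n" "g \<in> carrier G" "x \<in> Q" "y \<in> Q" for i g x y
    using that d_rep_rep[OF that(1) closed[OF that(1,2) QP] closed[OF that(1,2) QP]] iso[OF that(1,2) QP QP]
    by (simp add: \<phi>i)
  have isoact: "isometric_action G Q (l1_dist n d) \<phi>"
    unfolding isometric_action_def using act d_\<phi> by (auto simp: l1_dist_def intro!: sum.cong)
  have properness: "proper_action G Q (l1_dist n d) \<phi>"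
    unfolding proper_action_def
  proof (intro ballI allI impI)
    fix x R assume x: "x \<in> Q"
    \<comment> \<open>Moving the test point from \<open>x\<close> to \<open>p\<close> changes a
      displacement by at most twice the distance between them.\<close>
    define R' where "R' = R + 2 * (\<Sum>i<n. d i (p i) (x i))"
    have "{g \<in> carrier G. l1_dist n d x (\<phi> g x) \<le> R} \<subseteq> {g \<in> carrier G. \<forall>i<n. d i (p i) (\<alpha> i g (p i)) \<le> R'}"
    proof clarify
      fix g i assume g: "g \<in> carrier G" and le: "l1_dist n d x (\<phi> g x) \<le> R" and i: "i < n"
      note m = QP[OF x i] base[OF i]
      note am = closed[OF i g m(1)] closed[OF i g m(2)]
      have "d i (x i) (\<phi> g x i) \<le> l1_dist n d x (\<phi> g x)"
        unfolding l1_dist_def using i nonneg by (intro member_le_sum) auto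
      then have "d i (x i) (\<alpha> i g (x i)) \<le> R" using le i x d_rep[OF i m(1) am(1)] by (simp add: \<phi>i)
      moreover have "d i (p i) (x i) \<le> (\<Sum>i<n. d i (p i) (x i))"
        using i nonneg by (intro member_le_sum[of i "{..<n}" "\<lambda>i. d i (p i) (x i)"]) auto
      moreover have "d i (\<alpha> i g (x i)) (\<alpha> i g (p i)) = d i (p i) (x i)" using iso[OF i g m] dsym[OF i] by simp
      ultimately show "d i (p i) (\<alpha> i g (p i)) \<le> R'"
        using tri[OF i m(2) m(1) am(2)] tri[OF i m(1) am(1) am(2)] by (simp add: R'_def)
    qed
    then show "finite {g \<in> carrier G. l1_dist n d x (\<phi> g x) \<le> R}" using proper finite_subset by blast
  qed
  have cob: "stabilizer_cobounded G n X d \<phi> i" if i: "i < n" for i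
  proof -
    have ind: "induces_on_factor n X d i (\<phi> g) (\<lambda>t. rep i (\<alpha> i g t))" if g: "g \<in> carrier G" for g
      unfolding induces_on_factor_def
    proof (intro conjI ballI)
      have inX: "rep i (\<alpha> i h t) \<in> X i" if "h \<in> carrier G" "t \<in> X i" for h t
        using closed[OF i that(1) XP(1)[OF i that(2)]] by (simp add: X_def)
      have cancel: "rep i (\<alpha> i g (rep i (\<alpha> i (inv g) t))) = t" if t: "t \<in> X i" for t
      proof -
        note tP = XP(1)[OF i t]
        have y: "\<alpha> i (inv g) t \<in> P i" using closed[OF i inv_closed[OF g] tP] .
        note r = rep[OF i y]
        have "rep i (\<alpha> i g (\<alpha> i (inv g) t)) = rep i (\<alpha> i g (rep i (\<alpha> i (inv g) t)))"
          using iso[OF i g y] r by (intro rep_eq[OF i closed[OF i g y] closed[OF i g]]) auto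
        then show ?thesis
          using mult[OF i g inv_closed[OF g] tP] one[OF i tP] g XP(2)[OF i t] by simp
      qed
      show "(\<lambda>t. rep i (\<alpha> i g t)) ` X i = X i"
      proof
        show "(\<lambda>t. rep i (\<alpha> i g t)) ` X i \<subseteq> X i" using inX g by auto
        show "X i \<subseteq> (\<lambda>t. rep i (\<alpha> i g t)) ` X i"
        proof
          fix t assume t: "t \<in> X i"
          show "t \<in> (\<lambda>t. rep i (\<alpha> i g t)) ` X i"
            by (rule image_eqI[where x = "rep i (\<alpha> i (inv g) t)"])
              (use cancel[OF t] inX[OF inv_closed[OF g] t] in simp_all)
        qed
      qed
      show "d i (rep i (\<alpha> i g x)) (rep i (\<alpha> i g y)) = d i x y" if "x \<in> X i" "y \<in> X i" for x y
        using d_rep_rep[OF i closed[OF i g] closed[OF i g]] iso[OF i g] XP(1)[OF i] that by simp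
      show "\<phi> g x i = rep i (\<alpha> i g (x i))" if "x \<in> PiE {..<n} X" for x
        using \<phi>i i that by (simp add: Q_def)
    qed
    obtain \<epsilon> where \<epsilon>: "\<And>y. y \<in> P i \<Longrightarrow> \<exists>g\<in>carrier G. d i (\<alpha> i g (p i)) y \<le> \<epsilon>" using cobounded[OF i] by blast
    note pP = base[OF i]
    note rp = rep[OF i pP]
    have \<epsilon>0: "\<epsilon> \<ge> 0" using \<epsilon>[OF pP] nonneg[OF i] by (meson order_trans)
    show ?thesis unfolding stabilizer_cobounded_def
    proof (intro bexI[of _ "rep i (p i)"] exI[of _ \<epsilon>] conjI ballI \<epsilon>0)
      show "rep i (p i) \<in> X i" using pP by (simp add: X_def)
      fix y assume "y \<in> X i"
      then have yP: "y \<in> P i" using XP i by blast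
      obtain g where g: "g \<in> carrier G" "d i (\<alpha> i g (p i)) y \<le> \<epsilon>" using \<epsilon>[OF yP] by blast
      have m: "\<alpha> i g (p i) \<in> P i" "\<alpha> i g (rep i (p i)) \<in> P i" using closed[OF i g(1)] pP rp by auto
      have "d i (rep i (\<alpha> i g (rep i (p i)))) y = d i (\<alpha> i g (rep i (p i))) y"
        using d_rep[OF i yP m(2)] dsym[OF i] by metis
      also have "\<dots> \<le> d i (\<alpha> i g (rep i (p i))) (\<alpha> i g (p i)) + d i (\<alpha> i g (p i)) y" using tri[OF i m(2) m(1) yP] .
      also have "d i (\<alpha> i g (rep i (p i))) (\<alpha> i g (p i)) = 0" using iso[OF i g(1)] rp pP dsym[OF i] by metis
      finally have "d i (rep i (\<alpha> i g (rep i (p i)))) y \<le> \<epsilon>" using g by simp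
      then show "\<exists>g\<in>factor_stabilizer G n X d \<phi> i. \<exists>f. induces_on_factor n X d i (\<phi> g) f \<and> d i (f (rep i (p i))) y \<le> \<epsilon>"
        using ind[OF g(1)] g(1) by (auto simp: factor_stabilizer_def)
    qed
  qed
  have "hyperbolic_space (X i) (d i)" if i: "i < n" for i
    unfolding X_def rep_def
    using base[OF i] geo[OF i] hyp[OF i] by (intro pseudo_metric.hyperbolic_space_rep[OF pm[OF i]]) auto
  then show ?thesis unfolding property_PH_def
    using isoact properness cob unfolding Q_def by blast
qed

text \<open>\<open>h\<close> is a height and \<tau> the height to which a path between two points
  climbs. In the four-point condition the heights cancel, and the coarse ultrametric inequality for
  \<tau> remains; - \<tau> acts as a Gromov product seen from the point at infinity above.\<close>

lemma gromov_hyperbolic_of_quasi_ultrametric: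
  fixes D \<tau> :: "'x \<Rightarrow> 'x \<Rightarrow> real" and h :: "'x \<Rightarrow> real"
  assumes b: "b \<ge> 0" and c: "c \<ge> 0"
    and D: "\<And>x y. x \<in> P \<Longrightarrow> y \<in> P \<Longrightarrow> \<bar>D x y - (2 * \<tau> x y - h x - h y)\<bar> \<le> b"
    and sym: "\<And>x y. x \<in> P \<Longrightarrow> y \<in> P \<Longrightarrow> \<tau> x y = \<tau> y x"
    and ultra: "\<And>x y z. x \<in> P \<Longrightarrow> y \<in> P \<Longrightarrow> z \<in> P \<Longrightarrow> \<tau> x z \<le> max (\<tau> x y) (\<tau> y z) + c"
  shows "\<exists>\<delta>\<ge>0. gromov_hyperbolic \<delta> P D"
proof (intro exI[of _ "3 * b + 2 * c"] conjI)
  show "0 \<le> 3 * b + 2 * c" using b c by simp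
  show "gromov_hyperbolic (3 * b + 2 * c) P D"
    unfolding gromov_hyperbolic_def
  proof (intro ballI)
    fix w x y z assume m: "w \<in> P" "x \<in> P" "y \<in> P" "z \<in> P"
    have lo: "2 * \<tau> p q - h p - h q - b \<le> D p q" and up: "D p q \<le> 2 * \<tau> p q - h p - h q + b"
      if "p \<in> P" "q \<in> P" for p q using D[OF that] by linarith+
    have u: "\<tau> p r \<le> \<tau> p q + c \<or> \<tau> p r \<le> \<tau> q r + c" if "p \<in> P" "q \<in> P" "r \<in> P" for p q r
      using ultra[OF that] by (simp add: max_def split: if_splits)
    have "\<tau> x z + \<tau> y w \<le> \<tau> x y + \<tau> z w + 2 * c \<or> \<tau> x z + \<tau> y w \<le> \<tau> y z + \<tau> x w + 2 * c"
      using u[OF m(2,3,4)] u[OF m(2,1,4)] u[OF m(3,2,1)] u[OF m(3,4,1)]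
        sym[OF m(1,4)] sym[OF m(2,3)] by linarith
    then have "gromov_product D w x y - (3 * b + 2 * c) \<le> gromov_product D w x z \<or>
        gromov_product D w y z - (3 * b + 2 * c) \<le> gromov_product D w x z"
      using lo[OF m(2,1)] lo[OF m(4,1)] up[OF m(2,4)] up[OF m(3,1)] lo[OF m(2,3)] lo[OF m(3,4)]
        up[OF m(2,1)] up[OF m(4,1)] b unfolding gromov_product_def by (elim disjE) (simp_all add: field_simps)
    then show "gromov_product D w x z \<ge> min (gromov_product D w x y) (gromov_product D w y z) - (3 * b + 2 * c)"
      by linarith
  qed
qed

section \<open>A model of the hyperbolic plane\<close>

text \<open>Points \<open>x + i h\<close> of the plane carry the path metric of \<open>\<bar>dh\<bar> + e\<^sup>-\<^sup>h \<bar>dx\<bar>\<close>: a geodesic climbs to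
  the height \<open>hp_top\<close>, moves horizontally and descends. The height minimizes
  \<open>2 t - h - k + \<bar>x - y\<bar> e\<^sup>-\<^sup>t\<close>. The space is quasi-isometric to the hyperbolic plane, with
  \<open>x + i e\<^sup>h\<close> in the upper half-plane for \<open>x + i h\<close>.\<close>

lemma mult_exp_cancel: "x * exp t * exp (- t) = (x :: real)" "x * exp (- t) * exp t = x"
  by (simp_all add: mult.assoc flip: exp_add)

definition hp_top :: "complex \<Rightarrow> complex \<Rightarrow> real" where
  "hp_top p q = (let u = \<bar>Re p - Re q\<bar>; m = max (Im p) (Im q)
                 in if u \<le> 2 * exp m then m else ln (u / 2))"

definition hp_cost :: "complex \<Rightarrow> complex \<Rightarrow> real \<Rightarrow> real" where
  "hp_cost p q t = 2 * t - Im p - Im q + \<bar>Re p - Re q\<bar> * exp (- t)"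

definition hp_dist :: "complex \<Rightarrow> complex \<Rightarrow> real" where
  "hp_dist p q = hp_cost p q (hp_top p q)"

lemma hp_top_ge: "max (Im p) (Im q) \<le> hp_top p q"
proof -
  have "m \<le> ln (u / 2)" if "\<not> u \<le> 2 * exp m" for u m :: real
  proof -
    have "u > 0" using that exp_gt_zero[of m] by linarith
    then show ?thesis using that by (subst ln_ge_iff) auto
  qed
  from this[of "\<bar>Re p - Re q\<bar>" "max (Im p) (Im q)"] show ?thesis
    by (simp only: hp_top_def Let_def split: if_split) blast
qed

text \<open>Crossing length 2 is the critical point equation of \<open>hp_cost p q\<close>, whose
  derivative in \<open>t\<close> is 2 minus that length. If no height at or above both points
  satisfies it, the top is the higher point and the crossing is shorter.\<close>

lemma hp_top_cross: "\<bar>Re p - Re q\<bar> * exp (- hp_top p q) \<le> 2"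
  and hp_top_cross_eq: "hp_top p q \<noteq> max (Im p) (Im q) \<Longrightarrow> \<bar>Re p - Re q\<bar> * exp (- hp_top p q) = 2"
proof -
  define u where "u = \<bar>Re p - Re q\<bar>"
  define m where "m = max (Im p) (Im q)"
  have top: "hp_top p q = (if u \<le> 2 * exp m then m else ln (u / 2))"
    by (simp add: hp_top_def Let_def u_def m_def)
  have "(u \<le> 2 * exp m \<and> hp_top p q = m \<and> u * exp (- m) \<le> 2) \<or> u * exp (- hp_top p q) = 2"
  proof (cases "u \<le> 2 * exp m")
    case True
    then have "u * exp (- m) \<le> 2 * exp m * exp (- m)" by (intro mult_right_mono) auto
    then show ?thesis using True by (simp add: top mult_exp_cancel)
  next
    case False
    then have "u > 0" using exp_gt_zero[of m] by linarith
    then show ?thesis using False by (simp add: top exp_minus)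
  qed
  then show "\<bar>Re p - Re q\<bar> * exp (- hp_top p q) \<le> 2"
    and "hp_top p q \<noteq> max (Im p) (Im q) \<Longrightarrow> \<bar>Re p - Re q\<bar> * exp (- hp_top p q) = 2"
    unfolding u_def m_def by auto
qed

text \<open>If the crossing has length \<open>w\<close> at the top \<open>T\<close>, it has length
  \<open>w * exp (- (t - T))\<close> at height \<open>t\<close>, and
  \<open>1 - x \<le> exp (- x)\<close> compares the costs. Above \<open>T\<close> the bound
  \<open>w \<le> 2\<close> suffices; below it \<open>w = 2\<close> is needed, which holds since the
  top then exceeds both points.\<close>

lemma hp_dist_le_cost:
  assumes t: "Im p \<le> t" "Im q \<le> t"
  shows "hp_dist p q \<le> hp_cost p q t"
proof -
  define T where "T = hp_top p q"
  define w where "w = \<bar>Re p - Re q\<bar> * exp (- T)"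
  have w: "0 \<le> w" "w \<le> 2" using hp_top_cross by (auto simp: w_def T_def)
  have e: "\<bar>Re p - Re q\<bar> * exp (- t) = w * exp (- (t - T))"
    by (simp add: w_def mult.assoc flip: exp_add)
  have x: "1 - (t - T) \<le> exp (- (t - T))" using exp_ge_add_one_self[of "- (t - T)"] by linarith
  have "2 * T + w \<le> 2 * t + w * exp (- (t - T))"
  proof (cases "T \<le> t")
    case True
    have "w * (1 - exp (- (t - T))) \<le> 2 * (1 - exp (- (t - T)))"
      using w True by (intro mult_right_mono) auto
    then show ?thesis using x by (simp add: algebra_simps)
  next
    case False
    then have "w = 2" using t hp_top_cross_eq[of p q] by (auto simp: w_def T_def)
    then show ?thesis using x by simp
  qed
  then show ?thesis by (simp add: hp_dist_def hp_cost_def e flip: T_def w_def)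
qed

lemma hp_dist_ge: "\<bar>Im p - Im q\<bar> \<le> hp_dist p q"
  using hp_top_ge[of p q] by (simp add: hp_dist_def hp_cost_def) (smt (verit) abs_ge_zero exp_gt_zero mult_nonneg_nonneg)

lemma hp_top_sym: "hp_top p q = hp_top q p"
  by (simp add: hp_top_def Let_def abs_minus_commute max.commute)

lemma hp_dist_sym: "hp_dist p q = hp_dist q p"
  by (simp add: hp_dist_def hp_cost_def hp_top_sym[of p q] abs_minus_commute)

text \<open>Both crossings are moved up to the higher of the two tops, where they are no longer than
  before. The lower top is at least \<open>Im q\<close>, which pays for the climb.\<close>

lemma hp_dist_triangle: "hp_dist p r \<le> hp_dist p q + hp_dist q r"
proof -
  define T1 where "T1 = hp_top p q"
  define T2 where "T2 = hp_top q r"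
  define t where "t = max T1 T2"
  have m: "Im p \<le> T1" "Im q \<le> T1" "Im q \<le> T2" "Im r \<le> T2"
    using hp_top_ge[of p q] hp_top_ge[of q r] by (auto simp: T1_def T2_def)
  have "hp_dist p r \<le> hp_cost p r t" using m by (intro hp_dist_le_cost) (auto simp: t_def)
  also have "\<dots> \<le> hp_cost p q T1 + hp_cost q r T2"
  proof -
    have "\<bar>Re p - Re r\<bar> * exp (- t) \<le> (\<bar>Re p - Re q\<bar> + \<bar>Re q - Re r\<bar>) * exp (- t)"
      by (intro mult_right_mono) auto
    moreover have "\<bar>Re p - Re q\<bar> * exp (- t) \<le> \<bar>Re p - Re q\<bar> * exp (- T1)"
      by (intro mult_left_mono) (auto simp: t_def)
    moreover have "\<bar>Re q - Re r\<bar> * exp (- t) \<le> \<bar>Re q - Re r\<bar> * exp (- T2)"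
      by (intro mult_left_mono) (auto simp: t_def)
    moreover have "2 * t \<le> 2 * T1 + 2 * T2 - 2 * Im q" using m by (auto simp: t_def)
    ultimately show ?thesis by (simp add: hp_cost_def algebra_simps)
  qed
  finally show ?thesis by (simp add: hp_dist_def T1_def T2_def)
qed

lemma hp_dist_vertical:
  assumes "Re p = Re q"
  shows "hp_dist p q = \<bar>Im p - Im q\<bar>"
  using assms by (auto simp: hp_dist_def hp_cost_def hp_top_def Let_def max_def)

lemma hp_dist_horizontal:
  assumes "Im p = Im q" "\<bar>Re p - Re q\<bar> \<le> 2 * exp (Im p)"
  shows "hp_dist p q = \<bar>Re p - Re q\<bar> * exp (- Im p)"
  using assms by (simp add: hp_dist_def hp_cost_def hp_top_def Let_def)

interpretation hp: pseudo_metric UNIV hp_dist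
proof
  show "0 \<le> hp_dist x y" for x y using hp_dist_ge[of x y] by linarith
  show "hp_dist x y = hp_dist y x" for x y by (rule hp_dist_sym)
  show "hp_dist x x = 0" for x using hp_dist_vertical[of x x] by simp
  show "hp_dist x z \<le> hp_dist x y + hp_dist y z" for x y z by (rule hp_dist_triangle)
qed

lemma hp_geodesic_up:
  assumes "h \<le> k"
  shows "hp.geodesic_pair (Complex x h) (Complex x k)"
proof -
  have d: "hp_dist (Complex x s) (Complex x t) = \<bar>s - t\<bar>" for s t by (simp add: hp_dist_vertical)
  show ?thesis unfolding hp.geodesic_pair_def d
    by (rule exI[of _ "\<lambda>s. Complex x (h + s)"]) (use assms in \<open>auto simp: d\<close>)
qed

lemma hp_geodesic_horizontal:
  assumes le: "\<bar>x - y\<bar> \<le> 2 * exp t"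
  shows "hp.geodesic_pair (Complex x t) (Complex y t)"
proof -
  define l where "l = \<bar>x - y\<bar> * exp (- t)"
  have l: "hp_dist (Complex x t) (Complex y t) = l" using hp_dist_horizontal[of "Complex x t" "Complex y t"] le by (simp add: l_def)
  have l2: "l \<le> 2"
  proof -
    have "\<bar>x - y\<bar> * exp (- t) \<le> 2 * exp t * exp (- t)" using le by (intro mult_right_mono) auto
    then show ?thesis by (simp add: l_def mult_exp_cancel)
  qed
  have et: "exp t * exp (- t) = 1" by (simp flip: exp_add)
  define c where "c s = Complex (x + sgn (y - x) * s * exp t) t" for s
  have end_y: "c l = Complex y t"
    using et by (simp add: c_def l_def sgn_if abs_if mult.assoc mult.commute[of "exp (- t)"])
  have iso: "hp_dist (c s) (c r) = \<bar>s - r\<bar>" if "0 \<le> s" "s \<le> l" "0 \<le> r" "r \<le> l" for s r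
  proof (cases "x = y")
    case True
    then have "s = r" using that by (simp add: l_def)
    then show ?thesis by (simp add: hp.self)
  next
    case False
    then have sg: "\<bar>sgn (y - x)\<bar> = 1" by (simp add: abs_sgn_eq)
    have "\<bar>Re (c s) - Re (c r)\<bar> = \<bar>sgn (y - x) * ((s - r) * exp t)\<bar>" by (simp add: c_def algebra_simps)
    also have "\<dots> = \<bar>s - r\<bar> * exp t" unfolding abs_mult sg by simp
    finally have re: "\<bar>Re (c s) - Re (c r)\<bar> = \<bar>s - r\<bar> * exp t" .
    have "\<bar>s - r\<bar> \<le> 2" using that l2 by linarith
    then have "\<bar>s - r\<bar> * exp t \<le> 2 * exp t" by (intro mult_right_mono) auto
    then have "hp_dist (c s) (c r) = \<bar>Re (c s) - Re (c r)\<bar> * exp (- t)"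
      using hp_dist_horizontal[of "c s" "c r"] re by (simp add: c_def)
    then show ?thesis using re et by (simp add: mult.assoc)
  qed
  show ?thesis unfolding hp.geodesic_pair_def l
    by (intro exI[of _ c] conjI ballI iso) (auto simp: end_y hp.self, simp add: c_def hp.self)
qed

lemma hp_geodesic: "hp.geodesic_pair p q"
proof -
  define T where "T = hp_top p q"
  define p' where "p' = Complex (Re p) T"
  define q' where "q' = Complex (Re q) T"
  define w where "w = \<bar>Re p - Re q\<bar> * exp (- T)"
  have T: "Im p \<le> T" "Im q \<le> T" using hp_top_ge[of p q] by (auto simp: T_def)
  have "w \<le> 2" using hp_top_cross by (simp add: w_def T_def)
  then have "w * exp T \<le> 2 * exp T" by (intro mult_right_mono) auto
  then have le: "\<bar>Re p - Re q\<bar> \<le> 2 * exp T" by (simp add: w_def mult.assoc flip: exp_add)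
  have g1: "hp.geodesic_pair p p'" using hp_geodesic_up[OF T(1), of "Re p"] by (simp add: p'_def)
  have g2: "hp.geodesic_pair p' q'" using hp_geodesic_horizontal[OF le] by (simp add: p'_def q'_def)
  have g3: "hp.geodesic_pair q' q"
    using hp.geodesic_pair_sym[OF hp_geodesic_up[OF T(2), of "Re q"]] by (simp add: q'_def)
  have d1: "hp_dist p p' = T - Im p" and d3: "hp_dist q' q = T - Im q"
    using T by (simp_all add: p'_def q'_def hp_dist_vertical)
  have d2: "hp_dist p' q' = w" using hp_dist_horizontal[of p' q'] le by (simp add: p'_def q'_def w_def)
  have d: "hp_dist p q = 2 * T - Im p - Im q + w" by (simp add: hp_dist_def hp_cost_def T_def w_def)
  have d13: "hp_dist p' q = w + T - Im q"
    using d hp_dist_triangle[of p q p'] hp_dist_triangle[of p' q q'] d1 d2 d3 by linarith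
  have g4: "hp.geodesic_pair p' q"
    by (rule hp.geodesic_pair_concat[OF _ _ _ _ g2 g3]) (use d2 d3 d13 in auto)
  show ?thesis
    by (rule hp.geodesic_pair_concat[OF _ _ _ _ g1 g4]) (use d d1 d13 in auto)
qed

text \<open>Crossings have length at most 2, hence \<open>b = 2\<close>. Points with top at most
  \<open>M\<close> have horizontal distance at most \<open>2 * exp M\<close>; two such distances add
  up to at most \<open>4 * exp M\<close>, which raises the top by at most
  \<open>ln 2\<close>.\<close>

lemma hp_hyperbolic: "\<exists>\<delta>\<ge>0. gromov_hyperbolic \<delta> UNIV hp_dist"
proof (rule gromov_hyperbolic_of_quasi_ultrametric[of 2 "ln 2" UNIV hp_dist hp_top Im])
  show "\<bar>hp_dist x y - (2 * hp_top x y - Im x - Im y)\<bar> \<le> 2" for x y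
    using hp_top_cross[of x y] by (simp add: hp_dist_def hp_cost_def abs_mult)
  show "hp_top x y = hp_top y x" for x y by (rule hp_top_sym)
  show "hp_top x z \<le> max (hp_top x y) (hp_top y z) + ln 2" for x y z
  proof -
    define M where "M = max (hp_top x y) (hp_top y z)"
    have h: "Im x \<le> M" "Im z \<le> M" using hp_top_ge[of x y] hp_top_ge[of y z] by (auto simp: M_def)
    show ?thesis
    proof (cases "hp_top x z = max (Im x) (Im z)")
      case True
      have "0 \<le> ln (2 :: real)" by simp
      then show ?thesis using h True unfolding M_def[symmetric] by linarith
    next
      case False
      have bnd: "\<bar>Re p - Re q\<bar> \<le> 2 * exp M" if "hp_top p q \<le> M" for p q
      proof -
        have "\<bar>Re p - Re q\<bar> * exp (- hp_top p q) * exp (hp_top p q) \<le> 2 * exp (hp_top p q)"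
          using hp_top_cross[of p q] by (intro mult_right_mono) auto
        then have "\<bar>Re p - Re q\<bar> \<le> 2 * exp (hp_top p q)" by (simp add: mult.assoc flip: exp_add)
        also have "\<dots> \<le> 2 * exp M" using that by simp
        finally show ?thesis .
      qed
      have "\<bar>Re x - Re z\<bar> \<le> 4 * exp M" using bnd[of x y] bnd[of y z] by (simp add: M_def)
      moreover have "hp_top x z = ln (\<bar>Re x - Re z\<bar> / 2)" "\<not> \<bar>Re x - Re z\<bar> \<le> 2 * exp (max (Im x) (Im z))"
        using False by (auto simp: hp_top_def Let_def split: if_splits)
      moreover have "\<bar>Re x - Re z\<bar> > 0" using calculation(3) exp_gt_zero[of "max (Im x) (Im z)"] by linarith
      ultimately have "hp_top x z \<le> ln (2 * exp M)" by simp
      then show ?thesis by (simp add: ln_mult M_def)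
    qed
  qed
qed auto

text \<open>The affine map that takes \<open>w\<close> to \<open>exp \<sigma> * w + \<beta>\<close>
  on the upper half-plane, written with the logarithm of the imaginary part as height.\<close>

definition hp_act :: "real \<Rightarrow> real \<Rightarrow> complex \<Rightarrow> complex" where
  "hp_act \<sigma> \<beta> z = Complex (exp \<sigma> * Re z + \<beta>) (Im z + \<sigma>)"

lemma hp_act_isometry: "hp_dist (hp_act \<sigma> \<beta> p) (hp_act \<sigma> \<beta> q) = hp_dist p q"
proof -
  define u where "u = \<bar>Re p - Re q\<bar>"
  define m where "m = max (Im p) (Im q)"
  have m': "max (Im p + \<sigma>) (Im q + \<sigma>) = m + \<sigma>" by (simp add: m_def max_def)
  have "exp \<sigma> * Re p + \<beta> - (exp \<sigma> * Re q + \<beta>) = exp \<sigma> * (Re p - Re q)" by (simp add: algebra_simps)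
  then have u': "\<bar>exp \<sigma> * Re p + \<beta> - (exp \<sigma> * Re q + \<beta>)\<bar> = exp \<sigma> * u" by (simp add: abs_mult u_def)
  have c: "exp \<sigma> * u \<le> 2 * exp (m + \<sigma>) \<longleftrightarrow> u \<le> 2 * exp m" by (simp add: exp_add)
  have "u > 0" if "\<not> u \<le> 2 * exp m" using that exp_gt_zero[of m] by linarith
  then have l: "ln (exp \<sigma> * u / 2) = ln (u / 2) + \<sigma>" if "\<not> u \<le> 2 * exp m"
    using that by (simp add: ln_mult ln_div)
  have t1: "hp_top p q = (if u \<le> 2 * exp m then m else ln (u / 2))"
    by (simp add: hp_top_def Let_def u_def m_def)
  have t2: "hp_top (hp_act \<sigma> \<beta> p) (hp_act \<sigma> \<beta> q) = (if exp \<sigma> * u \<le> 2 * exp (m + \<sigma>) then m + \<sigma> else ln (exp \<sigma> * u / 2))"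
    by (simp only: hp_top_def Let_def hp_act_def complex.sel u' m')
  have t: "hp_top (hp_act \<sigma> \<beta> p) (hp_act \<sigma> \<beta> q) = hp_top p q + \<sigma>"
    unfolding t1 t2 c using l by auto
  have "exp \<sigma> * exp (- (hp_top p q + \<sigma>)) = exp (- hp_top p q)" by (simp flip: exp_add)
  then have "exp \<sigma> * u * exp (- (hp_top p q + \<sigma>)) = u * exp (- hp_top p q)"
    by (metis mult.assoc mult.commute)
  then show ?thesis unfolding hp_dist_def hp_cost_def t
    by (simp only: hp_act_def complex.sel u' flip: u_def) simp
qed

lemma hp_act_comp: "hp_act (\<sigma> + \<sigma>') (\<beta> + exp \<sigma> * \<beta>') z = hp_act \<sigma> \<beta> (hp_act \<sigma>' \<beta>' z)"
  by (simp add: hp_act_def exp_add algebra_simps)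

lemma hp_act_id: "hp_act 0 0 z = z"
  by (simp add: hp_act_def)

lemma hp_dist_origin_bound:
  assumes "hp_dist 0 q \<le> R"
  shows "\<bar>Im q\<bar> \<le> R" "\<bar>Re q\<bar> \<le> 2 * exp R"
proof -
  show 1: "\<bar>Im q\<bar> \<le> R" using hp_dist_ge[of 0 q] assms by simp
  define T where "T = hp_top 0 q"
  have "hp_dist 0 q = 2 * T - Im q + \<bar>Re q\<bar> * exp (- T)" by (simp add: hp_dist_def hp_cost_def T_def)
  moreover have "0 \<le> \<bar>Re q\<bar> * exp (- T)" by simp
  ultimately have T: "T \<le> R" using 1 assms by linarith
  have "\<bar>Re q\<bar> * exp (- T) * exp T \<le> 2 * exp T"
    using hp_top_cross[of 0 q] by (intro mult_right_mono) (auto simp: T_def)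
  then have "\<bar>Re q\<bar> \<le> 2 * exp T" by (simp add: mult.assoc flip: exp_add)
  also have "\<dots> \<le> 2 * exp R" using T by simp
  finally show "\<bar>Re q\<bar> \<le> 2 * exp R" .
qed

text \<open>At height \<open>of_int m * \<rho>\<close> the points are
  \<open>\<bar>b\<bar> * exp (of_int m * \<rho>)\<close> apart, so the gaps, measured at their own
  height, have length \<open>\<bar>b\<bar>\<close> throughout; \<open>\<rho>\<close> covers the
  vertical gap.\<close>

lemma hp_lattice_cobounded:
  assumes \<rho>: "\<rho> > 0" and b: "b \<noteq> 0"
  shows "\<exists>m j :: int. hp_dist (Complex (of_int j * (b * exp (of_int m * \<rho>))) (of_int m * \<rho>)) y \<le> \<rho> + \<bar>b\<bar>"
proof -
  define m where "m = \<lfloor>Im y / \<rho>\<rfloor>"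
  define e where "e = b * exp (of_int m * \<rho>)"
  define j where "j = \<lfloor>Re y / e\<rfloor>"
  have "of_int m \<le> Im y / \<rho>" "Im y / \<rho> < of_int m + 1" by (auto simp: m_def)
  then have m: "of_int m * \<rho> \<le> Im y" "Im y \<le> of_int m * \<rho> + \<rho>" using \<rho> by (auto simp: field_simps)
  have e0: "e \<noteq> 0" using b by (simp add: e_def)
  have "\<bar>Re y / e - of_int j\<bar> \<le> 1" unfolding j_def by linarith
  then have "\<bar>Re y / e - of_int j\<bar> * \<bar>e\<bar> \<le> 1 * \<bar>e\<bar>" by (intro mult_right_mono) auto
  moreover have "\<bar>Re y / e - of_int j\<bar> * \<bar>e\<bar> = \<bar>Re y - of_int j * e\<bar>"
    using e0 by (simp add: field_simps flip: abs_mult)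
  ultimately have j: "\<bar>of_int j * e - Re y\<bar> \<le> \<bar>e\<bar>" by (simp add: abs_minus_commute)
  have "\<bar>e\<bar> = \<bar>b\<bar> * exp (of_int m * \<rho>)" by (simp add: e_def abs_mult)
  also have "\<dots> \<le> \<bar>b\<bar> * exp (Im y)" using m by (intro mult_left_mono) auto
  finally have j: "\<bar>of_int j * e - Re y\<bar> \<le> \<bar>b\<bar> * exp (Im y)" using j by linarith
  have j': "\<bar>of_int j * e - Re y\<bar> * exp (- Im y) \<le> \<bar>b\<bar> * exp (Im y) * exp (- Im y)"
    by (rule mult_right_mono[OF j]) simp
  have "hp_dist (Complex (of_int j * e) (of_int m * \<rho>)) y
      \<le> hp_cost (Complex (of_int j * e) (of_int m * \<rho>)) y (Im y)"
    using m by (intro hp_dist_le_cost) auto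
  also have "\<dots> \<le> \<rho> + \<bar>b\<bar> * exp (Im y) * exp (- Im y)"
    unfolding hp_cost_def complex.sel using m j' by linarith
  also have "\<dots> = \<rho> + \<bar>b\<bar>" by (simp add: mult.assoc flip: exp_add)
  finally show ?thesis unfolding e_def by blast
qed

section \<open>The tree of a solvable Baumslag-Solitar group\<close>

text \<open>The points of the tree are the balls of the \<open>n\<close>-adic metric on \<open>\<int>[1/n]\<close>: the complex number
  \<open>x + i h\<close> stands for the coset of \<open>n\<close> to the power \<open>- \<lfloor>h\<rfloor>\<close> times \<open>\<int>\<close> that contains \<open>x\<close>, at height \<open>h\<close>.
  Two vertical rays coincide above the height \<open>tr_top\<close>.\<close>

locale nadic_tree =
  fixes n :: nat
  assumes n: "n \<ge> 2"
begin

definition nadic :: "int \<Rightarrow> real \<Rightarrow> bool" where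
  "nadic j u \<longleftrightarrow> (\<exists>k :: int. u = of_int k * real n powi (- j))"

definition nadics :: "real set" where "nadics = {u. \<exists>j. nadic j u}"

lemma n0: "real n \<noteq> 0" using n by simp

lemma nadic_0: "nadic j 0"
  unfolding nadic_def by (rule exI[of _ 0]) simp

lemma nadic_minus: "nadic j (- u) \<longleftrightarrow> nadic j u"
proof -
  have "nadic j (- u)" if u: "nadic j u" for u
  proof -
    obtain k :: int where "u = of_int k * real n powi (- j)" using u unfolding nadic_def by blast
    then show ?thesis unfolding nadic_def by (intro exI[of _ "- k"]) simp
  qed
  from this[of u] this[of "- u"] show ?thesis by auto
qed

lemma nadic_add:
  assumes "nadic j u" "nadic j v"
  shows "nadic j (u + v)"
proof -
  obtain k l :: int where "u = of_int k * real n powi (- j)" "v = of_int l * real n powi (- j)"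
    using assms unfolding nadic_def by blast
  then show ?thesis unfolding nadic_def by (intro exI[of _ "k + l"]) (simp add: algebra_simps)
qed

lemma nadic_mono:
  assumes "nadic i u" "i \<le> j"
  shows "nadic j u"
proof -
  obtain k :: int where k: "u = of_int k * real n powi (- i)" using assms unfolding nadic_def by blast
  define m where "m = nat (j - i)"
  have "real n powi (- i) = real n powi (int m + (- j))" using assms(2) by (simp add: m_def)
  also have "\<dots> = real n ^ m * real n powi (- j)" using n0 by (subst power_int_add) auto
  finally show ?thesis unfolding nadic_def k by (intro exI[of _ "k * int n ^ m"]) simp
qed

lemma nadic_scale: "nadic j (real n powi m * u) \<longleftrightarrow> nadic (j + m) u"
proof
  assume "nadic j (real n powi m * u)"
  then obtain k :: int where "real n powi m * u = of_int k * real n powi (- j)" unfolding nadic_def by blast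
  moreover have "real n powi (- m) * (real n powi m * u) = u"
    using n0 by (simp add: power_int_minus)
  moreover have "real n powi (- m) * real n powi (- j) = real n powi (- (j + m))"
    using n0 by (subst power_int_add[symmetric]) (auto simp: algebra_simps)
  ultimately have "u = of_int k * real n powi (- (j + m))" by (metis mult.assoc mult.commute)
  then show "nadic (j + m) u" unfolding nadic_def by blast
next
  assume "nadic (j + m) u"
  then obtain k :: int where k: "u = of_int k * real n powi (- (j + m))" unfolding nadic_def by blast
  have "real n powi m * real n powi (- (j + m)) = real n powi (- j)"
    using n0 by (subst power_int_add[symmetric]) auto
  then show "nadic j (real n powi m * u)" unfolding nadic_def k
    by (intro exI[of _ k]) (simp add: algebra_simps)
qed

lemma nadics_diff: "x \<in> nadics \<Longrightarrow> y \<in> nadics \<Longrightarrow> x - y \<in> nadics"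
proof -
  assume "x \<in> nadics" "y \<in> nadics"
  then obtain i j where "nadic i x" "nadic j y" by (auto simp: nadics_def)
  then have "nadic (max i j) x" "nadic (max i j) (- y)" using nadic_mono nadic_minus by auto
  then have "nadic (max i j) (x - y)" using nadic_add by fastforce
  then show ?thesis by (auto simp: nadics_def)
qed

lemma nadics_minus: "- u \<in> nadics \<longleftrightarrow> u \<in> nadics"
  by (simp add: nadics_def nadic_minus)

lemma nadics_scale: "u \<in> nadics \<Longrightarrow> real n powi m * u \<in> nadics"
proof -
  assume "u \<in> nadics"
  then obtain j where "nadic (j - m + m) u" by (auto simp: nadics_def)
  then have "nadic (j - m) (real n powi m * u)" using nadic_scale by blast
  then show ?thesis by (auto simp: nadics_def)
qed

text \<open>A nonzero integer multiple of \<open>real n powi (- j)\<close> has at least that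
  absolute value, so \<open>j\<close> cannot be arbitrarily negative. The least \<open>j\<close> is
  the lowest height from which on vertical rays with horizontal difference \<open>u\<close>
  coincide.\<close>

lemma nadic_least:
  assumes "u \<in> nadics" "u \<noteq> 0"
  shows "\<exists>w. \<forall>j. nadic j u \<longleftrightarrow> w \<le> j"
proof -
  obtain j0 where j0: "nadic j0 u" using assms by (auto simp: nadics_def)
  have lower: "real n powi (- j) \<le> \<bar>u\<bar>" if j: "nadic j u" for j
  proof -
    obtain k :: int where k: "u = of_int k * real n powi (- j)" using j unfolding nadic_def by blast
    then have "k \<noteq> 0" using assms by auto
    then have "1 \<le> \<bar>real_of_int k\<bar>" by linarith
    then have "1 * real n powi (- j) \<le> \<bar>real_of_int k\<bar> * real n powi (- j)" by (intro mult_right_mono) auto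
    then show ?thesis by (simp add: k abs_mult)
  qed
  obtain M where M: "\<bar>u\<bar> < real n ^ M" using real_arch_pow[of "real n" "\<bar>u\<bar>"] n by auto
  have bound: "- int M < j" if "nadic j u" for j
  proof (rule ccontr)
    assume "\<not> - int M < j"
    then have "real n ^ M \<le> real n powi (- j)"
      using n power_int_increasing[of "int M" "- j" "real n"] by simp
    then show False using lower[OF that] M by linarith
  qed
  define f where "f k = int k - int M" for k :: nat
  have "nadic (f (nat (j0 + int M))) u" using bound[OF j0] j0 by (simp add: f_def)
  then have ex: "\<exists>k. nadic (f k) u" by blast
  define k where "k = (LEAST k. nadic (f k) u)"
  have k: "nadic (f k) u" unfolding k_def by (rule LeastI_ex[OF ex])
  have "nadic j u \<longleftrightarrow> f k \<le> j" for j
  proof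
    assume j: "nadic j u"
    then have jf: "j = f (nat (j + int M))" using bound[OF j] by (simp add: f_def)
    then have "k \<le> nat (j + int M)" unfolding k_def using j by (intro Least_le) simp
    then show "f k \<le> j" using bound[OF j] by (simp add: f_def)
  qed (use nadic_mono[OF k] in blast)
  then show ?thesis by blast
qed

text \<open>Off \<open>nadics\<close> the value of \<open>tr_top\<close> is irrelevant, but metrics have to be symmetric and
  nonnegative on the whole type.\<close>

definition tr_top :: "complex \<Rightarrow> complex \<Rightarrow> real" where
  "tr_top p q = (if Re p - Re q \<in> nadics
     then (SOME \<tau>. \<forall>t. \<tau> \<le> t \<longleftrightarrow> Im p \<le> t \<and> Im q \<le> t \<and> nadic \<lfloor>t\<rfloor> (Re p - Re q))
     else max (Im p) (Im q))"

lemma tr_top_le_iff: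
  assumes "Re p - Re q \<in> nadics"
  shows "tr_top p q \<le> t \<longleftrightarrow> Im p \<le> t \<and> Im q \<le> t \<and> nadic \<lfloor>t\<rfloor> (Re p - Re q)"
proof -
  have "\<exists>\<tau>. \<forall>t. \<tau> \<le> t \<longleftrightarrow> Im p \<le> t \<and> Im q \<le> t \<and> nadic \<lfloor>t\<rfloor> (Re p - Re q)"
  proof (cases "Re p - Re q = 0")
    case True
    then show ?thesis by (intro exI[of _ "max (Im p) (Im q)"]) (auto simp: nadic_0)
  next
    case False
    then obtain w where "\<And>j. nadic j (Re p - Re q) \<longleftrightarrow> w \<le> j" using nadic_least[OF assms] by blast
    then show ?thesis
      by (intro exI[of _ "max (max (Im p) (Im q)) (of_int w)"]) (auto simp: le_floor_iff)
  qed
  from someI_ex[OF this] show ?thesis using assms by (simp add: tr_top_def)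
qed

definition tr_points :: "complex set" where "tr_points = {z. Re z \<in> nadics}"

definition tr_dist :: "complex \<Rightarrow> complex \<Rightarrow> real" where
  "tr_dist p q = 2 * tr_top p q - Im p - Im q"

lemma tr_top_ge: "Im p \<le> tr_top p q \<and> Im q \<le> tr_top p q"
proof (cases "Re p - Re q \<in> nadics")
    case True
    then show ?thesis using tr_top_le_iff[OF True, of "tr_top p q"] by simp
  next
    case False
    then show ?thesis by (simp add: tr_top_def)
qed

lemma tr_top_sym: "tr_top p q = tr_top q p"
proof (cases "Re p - Re q \<in> nadics")
  case True
  then have T: "Re q - Re p \<in> nadics" using nadics_minus[of "Re p - Re q"] by simp
  have "tr_top p q \<le> t \<longleftrightarrow> tr_top q p \<le> t" for t
    unfolding tr_top_le_iff[OF True] tr_top_le_iff[OF T]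
    using nadic_minus[of "\<lfloor>t\<rfloor>" "Re p - Re q"] by auto
  from this[of "tr_top p q"] this[of "tr_top q p"] show ?thesis by simp
next
  case False
  then have "Re q - Re p \<notin> nadics" using nadics_minus[of "Re p - Re q"] by simp
  then show ?thesis using False by (simp add: tr_top_def max.commute)
qed

lemma tr_diff: "p \<in> tr_points \<Longrightarrow> q \<in> tr_points \<Longrightarrow> Re p - Re q \<in> nadics"
  by (simp add: tr_points_def nadics_diff)

lemma tr_top_ultra:
  assumes "p \<in> tr_points" "q \<in> tr_points" "r \<in> tr_points"
  shows "tr_top p r \<le> max (tr_top p q) (tr_top q r)"
proof -
  define t where "t = max (tr_top p q) (tr_top q r)"
  have "tr_top p q \<le> t" "tr_top q r \<le> t" by (auto simp: t_def)
  then have "Im p \<le> t" "Im r \<le> t" "nadic \<lfloor>t\<rfloor> (Re p - Re q)" "nadic \<lfloor>t\<rfloor> (Re q - Re r)"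
    using assms by (simp_all add: tr_top_le_iff tr_diff)
  moreover from nadic_add[OF this(3,4)] have "nadic \<lfloor>t\<rfloor> (Re p - Re r)" by simp
  ultimately show ?thesis using assms by (simp add: tr_top_le_iff tr_diff flip: t_def)
qed

lemma tr_top_vertical:
  assumes "Re p = Re q"
  shows "tr_top p q = max (Im p) (Im q)"
proof -
  have z: "Re p - Re q \<in> nadics" using assms nadic_0 by (auto simp: nadics_def)
  have "tr_top p q \<le> t \<longleftrightarrow> max (Im p) (Im q) \<le> t" for t
    unfolding tr_top_le_iff[OF z] using assms nadic_0 by simp
  from this[of "tr_top p q"] this[of "max (Im p) (Im q)"] show ?thesis
    by (metis antisym order_refl)
qed

lemma tr_dist_vertical: "Re p = Re q \<Longrightarrow> tr_dist p q = \<bar>Im p - Im q\<bar>"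
  by (simp add: tr_dist_def tr_top_vertical max_def)

lemma pseudo_metric_tr: "pseudo_metric tr_points tr_dist"
proof
  show "0 \<le> tr_dist x y" for x y using tr_top_ge[of x y] by (simp add: tr_dist_def)
  show "tr_dist x y = tr_dist y x" for x y unfolding tr_dist_def tr_top_sym[of x y] by simp
  show "tr_dist x x = 0" for x by (simp add: tr_dist_vertical)
  show "tr_dist x z \<le> tr_dist x y + tr_dist y z"
    if "x \<in> tr_points" "y \<in> tr_points" "z \<in> tr_points" for x y z
    using tr_top_ultra[OF that] tr_top_ge[of x y] tr_top_ge[of y z] by (auto simp: tr_dist_def)
qed

sublocale tr: pseudo_metric tr_points tr_dist by (rule pseudo_metric_tr)

lemma tr_geodesic_up:
  assumes "x \<in> nadics" "h \<le> k"
  shows "tr.geodesic_pair (Complex x h) (Complex x k)"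
proof -
  have d: "tr_dist (Complex x s) (Complex x t) = \<bar>s - t\<bar>" for s t by (simp add: tr_dist_vertical)
  show ?thesis unfolding tr.geodesic_pair_def d
    by (rule exI[of _ "\<lambda>s. Complex x (h + s)"]) (use assms in \<open>auto simp: d tr_points_def\<close>)
qed

lemma tr_geodesic:
  assumes p: "p \<in> tr_points" and q: "q \<in> tr_points"
  shows "tr.geodesic_pair p q"
proof -
  define T where "T = tr_top p q"
  define p' where "p' = Complex (Re p) T"
  define q' where "q' = Complex (Re q) T"
  have T: "Im p \<le> T" "Im q \<le> T" using tr_top_ge[of p q] by (auto simp: T_def)
  have P: "p' \<in> tr_points" "q' \<in> tr_points" using p q by (auto simp: p'_def q'_def tr_points_def)
  have x: "Re p \<in> nadics" "Re q \<in> nadics" using p q by (auto simp: tr_points_def)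
  have g1: "tr.geodesic_pair p p'" using tr_geodesic_up[OF x(1) T(1)] by (simp add: p'_def)
  have g3: "tr.geodesic_pair q' q"
    using tr.geodesic_pair_sym[OF tr_geodesic_up[OF x(2) T(2)]] by (simp add: q'_def)
  have d1: "tr_dist p p' = T - Im p" and d3: "tr_dist q' q = T - Im q"
    using T by (simp_all add: p'_def q'_def tr_dist_vertical)
  have "nadic \<lfloor>T\<rfloor> (Re p - Re q)" using tr_top_le_iff[OF tr_diff[OF p q], of T] by (simp add: T_def)
  then have "tr_top p' q' \<le> T" using tr_diff[OF p q] by (subst tr_top_le_iff) (auto simp: p'_def q'_def)
  then have d2: "tr_dist p' q' = 0" using tr_top_ge[of p' q'] by (simp add: tr_dist_def p'_def q'_def)
  have d: "tr_dist p q = 2 * T - Im p - Im q" by (simp add: tr_dist_def T_def)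
  have d13: "tr_dist p' q = T - Im q"
    using d tr.triangle[OF p P(1) q] tr.triangle[OF P(1) P(2) q] d1 d2 d3 by linarith
  have g4: "tr.geodesic_pair p' q"
    by (rule tr.geodesic_pair_concat[OF P q _ tr.geodesic_pair_zero[OF P d2] g3]) (use d2 d3 d13 in simp)
  show ?thesis
    by (rule tr.geodesic_pair_concat[OF p P(1) q _ g1 g4]) (use d d1 d13 in simp)
qed

lemma tr_hyperbolic: "\<exists>\<delta>\<ge>0. gromov_hyperbolic \<delta> tr_points tr_dist"
  by (rule gromov_hyperbolic_of_quasi_ultrametric[of 0 0 tr_points tr_dist tr_top Im])
    (auto simp: tr_dist_def tr_top_ultra intro: tr_top_sym)

text \<open>Multiplication by \<open>real n powi m\<close> takes cosets of level \<open>j\<close> to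
  cosets of level \<open>j - m\<close>, so the height falls by \<open>m\<close>. In the plane the
  same element raises the height when \<open>m > 0\<close>: the two factors see opposite
  heights.\<close>

definition tr_act :: "int \<Rightarrow> real \<Rightarrow> complex \<Rightarrow> complex" where
  "tr_act m \<beta> z = Complex (real n powi m * Re z + \<beta>) (Im z - of_int m)"

lemma tr_act_closed: "\<beta> \<in> nadics \<Longrightarrow> z \<in> tr_points \<Longrightarrow> tr_act m \<beta> z \<in> tr_points"
  using nadics_diff[of "real n powi m * Re z" "- \<beta>"] nadics_scale nadics_minus
  by (simp add: tr_act_def tr_points_def)

lemma tr_act_isometry:
  assumes "p \<in> tr_points" "q \<in> tr_points"
  shows "tr_dist (tr_act m \<beta> p) (tr_act m \<beta> q) = tr_dist p q"
proof -
  define u where "u = Re p - Re q"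
  have u: "u \<in> nadics" using tr_diff[OF assms] by (simp add: u_def)
  have e: "Re (tr_act m \<beta> p) - Re (tr_act m \<beta> q) = real n powi m * u"
    by (simp add: tr_act_def u_def algebra_simps)
  have u': "Re (tr_act m \<beta> p) - Re (tr_act m \<beta> q) \<in> nadics" unfolding e by (rule nadics_scale[OF u])
  have "tr_top (tr_act m \<beta> p) (tr_act m \<beta> q) \<le> t \<longleftrightarrow> tr_top p q - of_int m \<le> t" for t
  proof -
    have "tr_top (tr_act m \<beta> p) (tr_act m \<beta> q) \<le> t \<longleftrightarrow>
        Im p - of_int m \<le> t \<and> Im q - of_int m \<le> t \<and> nadic \<lfloor>t\<rfloor> (real n powi m * u)"
      unfolding tr_top_le_iff[OF u'] e by (simp add: tr_act_def)
    also have "nadic \<lfloor>t\<rfloor> (real n powi m * u) \<longleftrightarrow> nadic \<lfloor>t + of_int m\<rfloor> u"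
      by (simp add: nadic_scale)
    also have "Im p - of_int m \<le> t \<and> Im q - of_int m \<le> t \<and> nadic \<lfloor>t + of_int m\<rfloor> u \<longleftrightarrow>
        tr_top p q \<le> t + of_int m"
      unfolding tr_top_le_iff[OF tr_diff[OF assms]] u_def by auto
    finally show ?thesis by auto
  qed
  from this[of "tr_top (tr_act m \<beta> p) (tr_act m \<beta> q)"] this[of "tr_top p q - of_int m"]
  have "tr_top (tr_act m \<beta> p) (tr_act m \<beta> q) = tr_top p q - of_int m" by simp
  then show ?thesis by (simp add: tr_dist_def tr_act_def)
qed

lemma tr_act_comp: "tr_act (m + m') (\<beta> + real n powi m * \<beta>') z = tr_act m \<beta> (tr_act m' \<beta>' z)"
  using n0 by (simp add: tr_act_def power_int_add algebra_simps)

lemma tr_act_id: "tr_act 0 0 z = z"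
  by (simp add: tr_act_def)

lemma tr_dist_origin_bound:
  assumes "tr_dist 0 q \<le> R" "q \<in> tr_points"
  shows "nadic \<lfloor>R\<rfloor> (Re q)"
proof -
  have "tr_top 0 q \<le> R" using assms(1) tr_top_ge[of 0 q] by (simp add: tr_dist_def)
  moreover have "Re 0 - Re q \<in> nadics" using assms(2) nadics_minus by (simp add: tr_points_def)
  ultimately show ?thesis using nadic_minus by (simp add: tr_top_le_iff)
qed

text \<open>For the Baumslag-Solitar group the plane controls the size of the translation part and
  the tree its denominator; together they leave finitely many values, which makes the product action
  proper.\<close>

lemma finite_nadic_bounded: "finite {u. nadic j u \<and> \<bar>u\<bar> \<le> B}"
proof -
  define e where "e = real n powi (- j)"
  have e: "e > 0" using n by (simp add: e_def)
  have "{u. nadic j u \<and> \<bar>u\<bar> \<le> B} \<subseteq> (\<lambda>k :: int. of_int k * e) ` {- \<lceil>B / e\<rceil>..\<lceil>B / e\<rceil>}"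
  proof clarify
    fix u assume u: "nadic j u" "\<bar>u\<bar> \<le> B"
    then obtain k :: int where k: "u = of_int k * e" unfolding nadic_def e_def by blast
    then have "\<bar>real_of_int k\<bar> \<le> B / e" using u e by (simp add: abs_mult field_simps)
    then have "\<bar>k\<bar> \<le> \<lceil>B / e\<rceil>" by linarith
    then show "u \<in> (\<lambda>k :: int. of_int k * e) ` {- \<lceil>B / e\<rceil>..\<lceil>B / e\<rceil>}"
      using k by (intro image_eqI[of _ _ k]) auto
  qed
  then show ?thesis using finite_subset by blast
qed

end

section \<open>Groups acting on a line by affine maps\<close>

lemma (in group) not_property_QT_of_exponential:
  fixes f :: "nat \<Rightarrow> nat"
  assumes a: "a \<in> carrier G" and inf: "inj (\<lambda>k :: nat. a [^] k)"
    and f: "\<And>i. 2 ^ i \<le> f i"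
    and len: "\<And>S. finite_generating_set G S \<Longrightarrow> \<exists>c. \<forall>i. word_length G S (a [^] f i) \<le> c * (i + 1)"
  shows "\<not> property_QT TYPE('x) TYPE('v) G"
proof (rule not_property_QT_of_distorted[OF a inf])
  fix S and \<epsilon> :: real and M :: nat
  assume S: "finite_generating_set G S" and \<epsilon>: "\<epsilon> > 0"
  obtain c where c: "\<And>i. word_length G S (a [^] f i) \<le> c * (i + 1)" using len[OF S] by blast
  obtain j0 where j0: "2 * real c / \<epsilon> < 2 ^ j0" using real_arch_pow[of 2 "2 * real c / \<epsilon>"] by auto
  \<comment> \<open>The witness will be \<open>f (2 * j)\<close>, at least
    \<open>2 ^ j * 2 ^ j\<close>: one factor beats the constant
    \<open>2 * real c / \<epsilon>\<close>, the other the linear growth of the length.\<close>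
  define j where "j = max j0 M"
  have pow: "real (j + 1) \<le> 2 ^ j"
  proof -
    have "j + 1 \<le> 2 ^ j" using less_exp[of j] by (simp add: Suc_le_eq)
    then have "real (j + 1) \<le> real (2 ^ j)" by (rule of_nat_mono)
    then show ?thesis by simp
  qed
  have "(2 :: real) ^ j0 \<le> 2 ^ j" by (intro power_increasing) (auto simp: j_def)
  then have "2 * real c / \<epsilon> \<le> 2 ^ j" using j0 by linarith
  then have c2: "2 * real c \<le> \<epsilon> * 2 ^ j" using \<epsilon> by (simp add: field_simps)
  have f2: "2 ^ j * 2 ^ j \<le> real (f (2 * j))"
  proof -
    have "real (2 ^ (2 * j)) \<le> real (f (2 * j))" using f[of "2 * j"] by (rule of_nat_mono)
    then show ?thesis by (simp add: mult_2 power_add)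
  qed
  show "\<exists>k\<ge>M. real (word_length G S (a [^] k)) \<le> \<epsilon> * real k"
  proof (intro exI[of _ "f (2 * j)"] conjI)
    have "real M \<le> real (j + 1)" by (simp add: j_def)
    also have "\<dots> \<le> 2 ^ j * 1" using pow by simp
    also have "\<dots> \<le> 2 ^ j * 2 ^ j" by (intro mult_left_mono) auto
    finally show "M \<le> f (2 * j)" using f2 by linarith
    have "real (word_length G S (a [^] f (2 * j))) \<le> real (c * (2 * j + 1))" using c[of "2 * j"] by (intro of_nat_mono) simp
    also have "\<dots> \<le> 2 * real c * real (j + 1)" by (simp add: algebra_simps)
    also have "\<dots> \<le> (\<epsilon> * 2 ^ j) * 2 ^ j" by (rule mult_mono[OF c2 pow]) (use \<epsilon> in auto)
    also have "\<dots> \<le> \<epsilon> * real (f (2 * j))" using f2 \<epsilon> by (simp add: mult.assoc)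
    finally show "real (word_length G S (a [^] f (2 * j))) \<le> \<epsilon> * real (f (2 * j))" .
  qed
qed

text \<open>A homomorphism to the affine group of the line, in coordinates: \<open>g\<close> scales
  by \<open>exp (of_int (m g) * \<rho>)\<close> and translates by \<open>\<beta> g\<close>, a
  cocycle.\<close>

locale affine_action = group G for G (structure) +
  fixes m :: "'a \<Rightarrow> int" and \<beta> :: "'a \<Rightarrow> real" and \<rho> :: real
  assumes m_mult: "g \<in> carrier G \<Longrightarrow> h \<in> carrier G \<Longrightarrow> m (g \<otimes> h) = m g + m h"
    and \<beta>_mult: "g \<in> carrier G \<Longrightarrow> h \<in> carrier G \<Longrightarrow> \<beta> (g \<otimes> h) = \<beta> g + exp (of_int (m g) * \<rho>) * \<beta> h"
begin

lemma m_one: "m \<one> = 0"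
  using m_mult[of \<one> \<one>] by simp

lemma \<beta>_one: "\<beta> \<one> = 0"
  using \<beta>_mult[of \<one> \<one>] by (simp add: m_one)

lemma m_inv: "g \<in> carrier G \<Longrightarrow> m (inv g) = - m g"
  using m_mult[of g "inv g"] by (simp add: m_one)

lemma \<beta>_inv: "g \<in> carrier G \<Longrightarrow> \<beta> (inv g) = - exp (- of_int (m g) * \<rho>) * \<beta> g"
  using \<beta>_mult[of "inv g" g] by (simp add: \<beta>_one m_inv)

definition hp_rep :: "'a \<Rightarrow> complex \<Rightarrow> complex" where
  "hp_rep g = hp_act (of_int (m g) * \<rho>) (\<beta> g)"

lemma hp_rep_mult: "g \<in> carrier G \<Longrightarrow> h \<in> carrier G \<Longrightarrow> hp_rep (g \<otimes> h) x = hp_rep g (hp_rep h x)"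
  by (simp add: hp_rep_def m_mult \<beta>_mult algebra_simps flip: hp_act_comp)

lemma hp_rep_one: "hp_rep \<one> x = x"
  by (simp add: hp_rep_def m_one \<beta>_one hp_act_id)

lemma hp_rep_isometry: "hp_dist (hp_rep g x) (hp_rep g y) = hp_dist x y"
  by (simp add: hp_rep_def hp_act_isometry)

lemma hp_rep_origin: "hp_rep g 0 = Complex (\<beta> g) (of_int (m g) * \<rho>)"
  by (simp add: hp_rep_def hp_act_def)

lemma hp_rep_cobounded:
  assumes "\<rho> \<noteq> 0" "b \<noteq> 0"
    and ex: "\<And>k j :: int. \<exists>g\<in>carrier G. m g = k \<and> \<beta> g = of_int j * (b * exp (of_int k * \<rho>))"
  shows "\<exists>\<epsilon>. \<forall>y. \<exists>g\<in>carrier G. hp_dist (hp_rep g 0) y \<le> \<epsilon>"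
proof (intro exI allI)
  fix y
  \<comment> \<open>\<rho> is negative for the contracting eigenvalue of an Anosov matrix, whereas
    the lattice lemma takes a positive step; the sign turns \<open>k\<close> into \<open>- k\<close>
    in that case.\<close>
  define s :: int where "s = (if \<rho> > 0 then 1 else - 1)"
  have s: "of_int s * \<rho> = \<bar>\<rho>\<bar>" "of_int s * \<bar>\<rho>\<bar> = \<rho>" using assms(1) by (auto simp: s_def)
  obtain k j :: int where kj:
    "hp_dist (Complex (of_int j * (b * exp (of_int k * \<bar>\<rho>\<bar>))) (of_int k * \<bar>\<rho>\<bar>)) y \<le> \<bar>\<rho>\<bar> + \<bar>b\<bar>"
    using hp_lattice_cobounded[of "\<bar>\<rho>\<bar>" b y] assms by auto
  have e: "of_int (s * k) * \<rho> = of_int k * \<bar>\<rho>\<bar>" using s by (metis mult.assoc mult.commute of_int_mult)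
  obtain g where "g \<in> carrier G" "m g = s * k" "\<beta> g = of_int j * (b * exp (of_int (s * k) * \<rho>))"
    using ex by blast
  then show "\<exists>g\<in>carrier G. hp_dist (hp_rep g 0) y \<le> \<bar>\<rho>\<bar> + \<bar>b\<bar>"
    using kj by (intro bexI[of _ g]) (simp_all add: hp_rep_origin e del: of_int_mult)
qed

end

section \<open>Solvable Baumslag-Solitar groups\<close>

locale baumslag_solitar = nadic_tree n for n :: nat +
  fixes G (structure)
  assumes BS1: "G = BS1 n"
begin

abbreviation R :: "(bs_gen word \<times> bs_gen word) set" where
  "R \<equiv> {([(Gen_t, True), (Gen_a, True), (Gen_t, False)], replicate n (Gen_a, True))}"

abbreviation cls :: "bs_gen word \<Rightarrow> bs_gen word set" where "cls u \<equiv> word_cong R `` {u}"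

lemma BS: "G = presented_group R"
  by (simp add: BS1 BS1_def)

sublocale group G
  unfolding BS by (rule group_presented_group)

lemma cls_mult: "cls u \<otimes> cls v = cls (u @ v)"
  unfolding BS by (rule presented_group_mult)

lemma one_cls: "\<one> = cls []"
  by (simp add: BS presented_group_def)

lemma cls_in: "cls u \<in> carrier G"
  by (simp add: BS presented_group_def quotientI)

lemma carrier_cls: "g \<in> carrier G \<Longrightarrow> \<exists>u. g = cls u"
  by (auto simp: BS presented_group_def elim: quotientE)

lemma cls_eqI: "(u, v) \<in> word_cong R \<Longrightarrow> cls u = cls v"
  by (rule equiv_class_eq[OF equiv_word_cong])

definition a where "a = cls [(Gen_a, True)]"
definition t where "t = cls [(Gen_t, True)]"

lemma a_in: "a \<in> carrier G" and t_in: "t \<in> carrier G"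
  by (simp_all add: a_def t_def cls_in)

lemma cls_inverse: "cls [(x, False)] = inv (cls [(x, True)])"
proof -
  have "([(x, False), (x, True)], []) \<in> word_cong R" using word_cong.cancel[of x False R] by simp
  then have "cls [(x, False)] \<otimes> cls [(x, True)] = \<one>"
    using cls_eqI by (simp add: cls_mult one_cls)
  then show ?thesis by (metis inv_equality cls_in)
qed

lemma a_pow: "a [^] k = cls (replicate k (Gen_a, True))"
proof (induction k)
  case 0
  show ?case by (simp add: one_cls)
next
  case (Suc k)
  then show ?case by (simp add: a_def cls_mult replicate_append_same)
qed

lemma relation: "t \<otimes> a \<otimes> inv t = a [^] n"
  unfolding a_pow
  by (simp add: t_def a_def cls_mult flip: cls_inverse) (intro cls_eqI word_cong.rel, simp)

section \<open>The affine representation of the Baumslag-Solitar group and its faithfulness\<close>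

fun letter_val :: "bs_gen \<times> bool \<Rightarrow> int \<times> real" where
  "letter_val (Gen_t, b) = (if b then 1 else - 1, 0)"
| "letter_val (Gen_a, b) = (0, if b then 1 else - 1)"

text \<open>Words act on the line, \<open>t\<close> scaling by \<open>n\<close> and \<open>a\<close>
  translating by 1; the pair records the exponent of the scaling and the translation part of the
  composite.\<close>

fun word_val :: "bs_gen word \<Rightarrow> int \<times> real" where
  "word_val [] = (0, 0)"
| "word_val (l # w) = (fst (letter_val l) + fst (word_val w),
     snd (letter_val l) + real n powi fst (letter_val l) * snd (word_val w))"

lemma word_val_append:
  "word_val (u @ v) = (fst (word_val u) + fst (word_val v),
     snd (word_val u) + real n powi fst (word_val u) * snd (word_val v))"
  using n0 by (induction u) (auto simp: power_int_add algebra_simps)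

lemma word_val_replicate: "word_val (replicate k (Gen_a, True)) = (0, real k)"
  by (induction k) auto

lemma word_val_cong: "(u, v) \<in> word_cong R \<Longrightarrow> word_val u = word_val v"
proof (induction rule: word_cong.induct)
  case (rel u v)
  then show ?case by (auto simp: word_val_replicate)
next
  case (cancel x b)
  then show ?case by (cases x) auto
qed (auto simp: word_val_append)

definition val :: "bs_gen word set \<Rightarrow> int \<times> real" where "val A = word_val (SOME u. u \<in> A)"

lemma val_cls: "val (cls u) = word_val u"
proof -
  have "u \<in> cls u" by (simp add: word_cong.refl)
  then have "(SOME v. v \<in> cls u) \<in> cls u" by (rule someI)
  then have "(u, SOME v. v \<in> cls u) \<in> word_cong R" by simp
  then show ?thesis unfolding val_def by (rule word_val_cong[symmetric])
qed

lemma exp_powi: "exp (of_int k * ln (real n)) = real n powi k"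
proof -
  have "real n powi k = real n powr of_int k" using n by (subst powr_real_of_int') auto
  then show ?thesis using n by (simp add: powr_def)
qed

sublocale affine_action G "\<lambda>g. fst (val g)" "\<lambda>g. snd (val g)" "ln (real n)"
proof
  fix g h assume "g \<in> carrier G" "h \<in> carrier G"
  then obtain u v where "g = cls u" "h = cls v" using carrier_cls by blast
  then show "fst (val (g \<otimes> h)) = fst (val g) + fst (val h)"
    "snd (val (g \<otimes> h)) = snd (val g) + exp (of_int (fst (val g)) * ln (real n)) * snd (val h)"
    by (simp_all add: cls_mult val_cls word_val_append exp_powi)
qed

lemma val_t: "val t = (1, 0)"
  by (simp add: t_def val_cls)

lemma val_a_nat_pow: "val (a [^] (k :: nat)) = (0, real k)"
  by (simp add: a_pow val_cls word_val_replicate)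

lemma conj_pow: "t [^] i \<otimes> a [^] k \<otimes> inv (t [^] i)
    = a [^] (int n ^ i * k)" for i :: nat and k :: int
proof -
  have one: "t \<otimes> a [^] k \<otimes> inv t = a [^] (int n * k)" for k :: int
  proof -
    define f where "f x = t \<otimes> x \<otimes> inv t" for x
    have "f \<in> hom G G"
    proof (rule homI)
      show "f x \<in> carrier G" if "x \<in> carrier G" for x using that t_in by (simp add: f_def)
      show "f (x \<otimes> y) = f x \<otimes> f y" if "x \<in> carrier G" "y \<in> carrier G" for x y
      proof -
        have "inv t \<otimes> (t \<otimes> z) = z" if "z \<in> carrier G" for z
          using that t_in by (simp flip: m_assoc)
        then show ?thesis using that t_in by (simp add: f_def m_assoc)
      qed
    qed
    then interpret f: group_hom G G f by unfold_locales
    have "f (a [^] k) = f a [^] k" using f.hom_int_pow a_in by blast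
    also have "\<dots> = (a [^] int n) [^] k" using relation by (simp add: f_def int_pow_int)
    also have "\<dots> = a [^] (int n * k)" using a_in by (simp add: int_pow_pow)
    finally show ?thesis by (simp add: f_def)
  qed
  show ?thesis
  proof (induction i arbitrary: k)
    case 0
    then show ?case using a_in by simp
  next
    case (Suc i)
    have "t [^] Suc i \<otimes> a [^] k \<otimes> inv (t [^] Suc i)
       = t [^] i \<otimes> (t \<otimes> a [^] k \<otimes> inv t) \<otimes> inv (t [^] i)"
      using a_in t_in by (simp add: m_assoc inv_mult_group)
    also have "\<dots> = a [^] (int n ^ i * (int n * k))" unfolding one by (rule Suc.IH)
    finally show ?case by (simp add: mult.assoc mult.left_commute)
  qed
qed

text \<open>The parameters are not unique. For the injectivity of \<open>val\<close> it is enough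
  that every element has some such form.\<close>

definition nf :: "nat \<Rightarrow> int \<Rightarrow> nat \<Rightarrow> bs_gen word set" where
  "nf i k j = inv (t [^] i) \<otimes> (a [^] k \<otimes> t [^] j)"

lemma nf_in: "nf i k j \<in> carrier G"
  using a_in t_in by (simp add: nf_def)

lemma a_nf: "a [^] e \<otimes> nf i k j = nf i (int n ^ i * e + k) j" for e :: int
proof -
  let ?T = "t [^] i"
  have T: "?T \<in> carrier G" "a [^] e \<in> carrier G" "a [^] k \<in> carrier G"
    "t [^] j \<in> carrier G" using a_in t_in by auto
  have "a [^] (int n ^ i * e + k) = (?T \<otimes> a [^] e \<otimes> inv ?T) \<otimes> a [^] k"
    unfolding conj_pow using a_in by (simp add: int_pow_mult)
  moreover have "inv ?T \<otimes> (?T \<otimes> z) = z" if "z \<in> carrier G" for z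
    using that T by (simp flip: m_assoc)
  ultimately show ?thesis using T by (simp add: nf_def m_assoc)
qed

lemma inv_t_nf: "inv t \<otimes> nf i k j = nf (Suc i) k j"
  using a_in t_in by (simp add: nf_def inv_mult_group m_assoc)

text \<open>For positive \<open>i\<close> the new \<open>t\<close> cancels; for \<open>i = 0\<close>
  the relation carries it past the power of \<open>a\<close>, whose exponent is multiplied by
  \<open>n\<close>.\<close>

lemma t_nf: "\<exists>i' k' j'. t \<otimes> nf i k j = nf i' k' j'"
proof (cases i)
  case 0
  have "t \<otimes> a [^] k = a [^] (int n * k) \<otimes> t"
    using conj_pow[of "Suc 0" k] a_in t_in
      inv_solve_right[of "a [^] (int n * k)" "t \<otimes> a [^] k" t] by simp
  then have "t \<otimes> nf i k j = a [^] (int n * k) \<otimes> t \<otimes> t [^] j"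
    using a_in t_in by (simp add: nf_def 0 flip: m_assoc)
  also have "\<dots> = a [^] (int n * k) \<otimes> (t \<otimes> t [^] j)" using a_in t_in by (simp add: m_assoc)
  also have "\<dots> = nf 0 (int n * k) (Suc j)"
    unfolding nat_pow_Suc2[OF t_in, symmetric] using a_in t_in by (simp add: nf_def del: nat_pow_Suc)
  finally have "t \<otimes> nf i k j = nf 0 (int n * k) (Suc j)" .
  then show ?thesis by blast
next
  case (Suc l)
  have "t \<otimes> nf i k j = t \<otimes> (inv t \<otimes> nf l k j)" by (simp add: Suc inv_t_nf)
  also have "\<dots> = nf l k j" using t_in nf_in by (simp flip: m_assoc)
  finally show ?thesis by blast
qed

lemma normal_form:
  assumes "g \<in> carrier G"
  shows "\<exists>i k j. g = nf i k j"
proof -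
  have "\<exists>i k j. cls u = nf i k j" for u
  proof (induction u)
    case Nil
    show ?case by (intro exI[of _ 0]) (simp add: nf_def flip: one_cls)
  next
    case (Cons l u)
    then obtain i k j where u: "cls u = nf i k j" by blast
    have lu: "cls (l # u) = cls [l] \<otimes> nf i k j" using cls_mult[of "[l]" u] by (simp add: u)
    obtain x b where l: "l = (x, b)" by force
    show ?case
    proof (cases x)
      case Gen_a
      define e :: int where "e = (if b then 1 else - 1)"
      have "cls [l] = a [^] e"
        using a_in cls_inverse[of Gen_a] int_pow_neg[OF a_in, of 1] by (auto simp: l Gen_a e_def a_def)
      then show ?thesis using lu a_nf by metis
    next
      case Gen_t
      then have "cls [l] = (if b then t else inv t)"
        using cls_inverse[of Gen_t] by (auto simp: l t_def)
      then show ?thesis using lu t_nf inv_t_nf by metis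
    qed
  qed
  then show ?thesis using carrier_cls[OF assms] by blast
qed

lemma val_a_int_pow: "val (a [^] k) = (0, of_int k)" for k :: int
proof (cases k rule: int_cases4)
  case (nonneg i)
  then show ?thesis by (simp add: int_pow_int val_a_nat_pow)
next
  case (neg i)
  have "a [^] k = inv (a [^] i)" unfolding neg by (rule int_pow_neg_int[OF a_in])
  then show ?thesis
    using m_inv[of "a [^] i"] \<beta>_inv[of "a [^] i"] a_in
    by (intro prod_eqI) (simp_all add: val_a_nat_pow neg)
qed

lemma val_t_pow: "val (t [^] (i :: nat)) = (int i, 0)"
proof (induction i)
  case 0
  show ?case using m_one \<beta>_one by (intro prod_eqI) simp_all
next
  case (Suc i)
  then show ?case using t_in m_mult[of "t [^] i" t] \<beta>_mult[of "t [^] i" t]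
    by (intro prod_eqI) (simp_all add: val_t)
qed

lemma val_nf: "val (nf i k j) = (int j - int i, of_int k * real n powi (- int i))"
proof (rule prod_eqI)
  have c: "t [^] i \<in> carrier G" "a [^] k \<in> carrier G" "t [^] j \<in> carrier G"
    using a_in t_in by auto
  show "fst (val (nf i k j)) = fst (int j - int i, of_int k * real n powi (- int i))"
    using c by (simp add: nf_def m_mult m_inv val_a_int_pow val_t_pow)
  have "snd (val (nf i k j)) = exp (of_int (- int i) * ln (real n)) * of_int k"
    using c by (simp add: nf_def m_inv \<beta>_mult \<beta>_inv val_a_int_pow val_t_pow)
  then show "snd (val (nf i k j)) = snd (int j - int i, of_int k * real n powi (- int i))"
    unfolding exp_powi by simp
qed

text \<open>A normal form of value zero has \<open>i = j\<close> and \<open>k = 0\<close> and is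
  therefore trivial; the rest is that \<open>val\<close> turns products into products of affine
  maps.\<close>

lemma val_inj: "inj_on val (carrier G)"
proof (rule inj_onI)
  fix g h assume g: "g \<in> carrier G" and h: "h \<in> carrier G" and e: "val g = val h"
  define x where "x = g \<otimes> inv h"
  have x: "x \<in> carrier G" "x \<otimes> h = g" using g h by (auto simp: x_def m_assoc)
  have mx: "fst (val x) = 0" using m_mult[OF x(1) h] x(2) e by simp
  have bx: "snd (val x) = 0" using \<beta>_mult[OF x(1) h] x(2) e mx by simp
  obtain i k j where nf: "x = nf i k j" using normal_form[OF x(1)] by blast
  have "i = j" "k = 0" using mx bx n by (auto simp: nf val_nf)
  then have "x = \<one>" using t_in by (simp add: nf nf_def)
  then show "g = h" using x(2) h by simp
qed

lemma val_surj:
  assumes "u \<in> nadics"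
  shows "\<exists>g\<in>carrier G. val g = (k, u)"
proof -
  obtain j0 where j0: "nadic j0 u" using assms by (auto simp: nadics_def)
  \<comment> \<open>Large enough to clear the denominator of \<open>u\<close> and to make the
    exponent \<open>int i + k\<close> of the last \<open>t\<close> nonnegative.\<close>
  define i where "i = nat (max (max j0 (- k)) 0)"
  have i: "j0 \<le> int i" "0 \<le> int i + k" by (auto simp: i_def)
  obtain l :: int where l: "u = of_int l * real n powi (- int i)"
    using nadic_mono[OF j0 i(1)] by (auto simp: nadic_def)
  have "val (nf i l (nat (int i + k))) = (k, u)" using i by (simp add: val_nf l)
  then show ?thesis using nf_in by blast
qed

lemma val_nadics:
  assumes "g \<in> carrier G"
  shows "snd (val g) \<in> nadics"
proof -
  obtain i k j where "g = nf i k j" using normal_form[OF assms] by blast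
  then have "nadic (int i) (snd (val g))" by (auto simp: val_nf nadic_def)
  then show ?thesis by (auto simp: nadics_def)
qed

definition tr_rep :: "bs_gen word set \<Rightarrow> complex \<Rightarrow> complex" where
  "tr_rep g = tr_act (fst (val g)) (snd (val g))"

lemma property_PH: "property_PH TYPE(complex) G"
proof -
  let ?P = "\<lambda>i :: nat. if i = 0 then UNIV else tr_points"
  let ?d = "\<lambda>i :: nat. if i = 0 then hp_dist else tr_dist"
  let ?a = "\<lambda>i :: nat. if i = 0 then hp_rep else tr_rep"
  show ?thesis
  proof (rule property_PH_of_pseudometric_actions[where n = 2 and P = ?P and d = ?d and p = "\<lambda>_. 0" and \<alpha> = ?a])
    show "group G" by (rule is_group)
    have z: "0 \<in> nadics" using nadic_0 by (auto simp: nadics_def)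
    have lat: "\<exists>g\<in>carrier G. fst (val g) = k \<and> snd (val g) = of_int j * (1 * exp (of_int k * ln (real n)))" for k j :: int
    proof -
      have "nadic (- k) (of_int j * real n powi k)" unfolding nadic_def by (intro exI[of _ j]) simp
      then have "of_int j * real n powi k \<in> nadics" by (auto simp: nadics_def)
      then obtain g where "g \<in> carrier G" "val g = (k, of_int j * real n powi k)" using val_surj by blast
      then show ?thesis unfolding exp_powi by (intro bexI[of _ g]) simp_all
    qed
    have ln0: "ln (real n) \<noteq> 0" using n by simp
    have hp_cob: "\<exists>\<epsilon>. \<forall>y. \<exists>g\<in>carrier G. hp_dist (hp_rep g 0) y \<le> \<epsilon>"
      by (rule hp_rep_cobounded[OF ln0 _ lat]) simp
    have tr_cob: "\<exists>g\<in>carrier G. tr_dist (tr_rep g 0) y \<le> 1" if y: "y \<in> tr_points" for y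
    proof -
      obtain g where g: "g \<in> carrier G" "val g = (- \<lfloor>Im y\<rfloor>, Re y)"
        using val_surj[of "Re y" "- \<lfloor>Im y\<rfloor>"] y by (auto simp: tr_points_def)
      have "tr_dist (tr_rep g 0) y = \<bar>of_int \<lfloor>Im y\<rfloor> - Im y\<bar>"
        using g(2) by (simp add: tr_rep_def tr_act_def tr_dist_vertical)
      also have "\<dots> \<le> 1" by linarith
      finally show ?thesis using g(1) by blast
    qed
    fix i :: nat
    show "pseudo_metric (?P i) (?d i)"
      using hp.pseudo_metric_axioms pseudo_metric_tr by simp
    show "0 \<in> ?P i" using z by (simp add: tr_points_def)
    show "pseudo_metric.geodesic_pair (?P i) (?d i) x y"
      if "x \<in> ?P i" "y \<in> ?P i" for x y
      using that hp_geodesic[of x y] tr_geodesic[of x y] by (cases "i = 0") simp_all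
    show "\<exists>\<delta>\<ge>0. gromov_hyperbolic \<delta> (?P i) (?d i)"
      using hp_hyperbolic tr_hyperbolic by (cases "i = 0") simp_all
    show "?a i g x \<in> ?P i"
      if "g \<in> carrier G" "x \<in> ?P i" for g x
      using that tr_act_closed[OF val_nadics[OF that(1)], of x] by (cases "i = 0") (simp_all add: tr_rep_def)
    show "?a i (g \<otimes> h) x
        = ?a i g (?a i h x)"
      if "g \<in> carrier G" "h \<in> carrier G" for g h x
      using that hp_rep_mult m_mult[of g h] \<beta>_mult[of g h] by (simp add: tr_rep_def exp_powi flip: tr_act_comp)
    show "?a i \<one> x = x" for x
      using hp_rep_one m_one \<beta>_one by (simp add: tr_rep_def tr_act_id)
    show "?d i (?a i g x) (?a i g y)
        = ?d i x y"
      if "x \<in> ?P i" "y \<in> ?P i" for g x y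
      using that by (cases "i = 0") (simp_all add: hp_rep_isometry tr_rep_def tr_act_isometry)
    show "\<exists>\<epsilon>. \<forall>y\<in>?P i. \<exists>g\<in>carrier G.
        ?d i (?a i g 0) y \<le> \<epsilon>"
      using hp_cob tr_cob by (cases "i = 0") auto
  next
    fix R' :: real
    let ?A = "{g \<in> carrier G. \<forall>i<2 :: nat. ?d i 0 (?a i g 0) \<le> R'}"
    \<comment> \<open>The tree bounds the scaling exponent and the denominator, the plane the
      absolute value of the translation part.\<close>
    let ?B = "{k. \<bar>k\<bar> \<le> \<lceil>R'\<rceil>} \<times> {u. nadic \<lfloor>R'\<rfloor> u \<and> \<bar>u\<bar> \<le> 2 * exp R'}"
    have "val ` ?A \<subseteq> ?B"
    proof (rule image_subsetI)
      fix g assume "g \<in> ?A"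
      then have g: "g \<in> carrier G"
        and le: "\<forall>i<2 :: nat. ?d i 0 (?a i g 0) \<le> R'" by blast+
      obtain k u where v: "val g = (k, u)" by (cases "val g")
      have hp: "hp_dist 0 (hp_rep g 0) \<le> R'" using le[rule_format, of 0] by simp
      have tr: "tr_dist 0 (tr_rep g 0) \<le> R'" using le[rule_format, of 1] by simp
      have v': "fst (val g) = k" "snd (val g) = u" using v by simp_all
      have t0: "tr_rep g 0 = Complex u (- of_int k)" by (simp add: tr_rep_def tr_act_def v')
      have "\<bar>u\<bar> \<le> 2 * exp R'" using hp_dist_origin_bound(2)[OF hp] by (simp add: hp_rep_origin v')
      moreover have "nadic \<lfloor>R'\<rfloor> u"
        using tr_dist_origin_bound[OF tr] val_nadics[OF g] by (simp add: t0 v' tr_points_def)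
      moreover have "\<bar>real_of_int k\<bar> \<le> R'"
        using tr tr_top_ge[of 0 "Complex u (- of_int k)"] by (auto simp: t0 tr_dist_def)
      then have "\<bar>k\<bar> \<le> \<lceil>R'\<rceil>" by linarith
      ultimately show "val g \<in> ?B" unfolding v by simp
    qed
    moreover have "finite ?B"
    proof (intro finite_cartesian_product finite_nadic_bounded)
      have "{k :: int. \<bar>k\<bar> \<le> \<lceil>R'\<rceil>} \<subseteq> {- \<lceil>R'\<rceil>..\<lceil>R'\<rceil>}" by auto
      then show "finite {k :: int. \<bar>k\<bar> \<le> \<lceil>R'\<rceil>}" using finite_subset by blast
    qed
    ultimately have "finite (val ` ?A)" using finite_subset by blast
    moreover have "inj_on val ?A" using val_inj by (rule inj_on_subset) auto
    ultimately show "finite ?A" using finite_imageD by blast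
  qed
qed

lemma not_property_QT: "\<not> property_QT TYPE('x) TYPE('v) G"
proof (rule not_property_QT_of_exponential[OF a_in, where f = "\<lambda>i. n ^ i"])
  show "inj (\<lambda>k :: nat. a [^] k)"
    by (rule injI) (metis val_a_nat_pow of_nat_eq_iff snd_conv)
  show "2 ^ i \<le> n ^ i" for i using n by (rule power_mono) simp
  fix S assume S: "finite_generating_set G S"
  let ?w = "word_length G S"
  let ?c = "?w t + ?w a + ?w (inv t)"
  have "?w (a [^] (n ^ i)) \<le> ?c * (i + 1)" for i
  proof -
    let ?T = "t [^] i"
    have "a [^] (n ^ i) = ?T \<otimes> a \<otimes> (inv t) [^] i"
      using conj_pow[of i 1] a_in t_in int_pow_int[of G a "n ^ i"] by (simp add: nat_pow_inv)
    then have "?w (a [^] (n ^ i)) \<le> ?w ?T + ?w a + ?w ((inv t) [^] i)"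
      using word_length_mult[OF S, of "?T \<otimes> a" "(inv t) [^] i"]
        word_length_mult[OF S, of ?T a] a_in t_in by simp
    also have "\<dots> \<le> i * ?w t + ?w a + i * ?w (inv t)"
      using word_length_pow[OF S t_in, of i] word_length_pow[OF S inv_closed[OF t_in], of i] by linarith
    also have "\<dots> \<le> ?c * (i + 1)" by (simp add: algebra_simps)
    finally show ?thesis .
  qed
  then show "\<exists>c. \<forall>i. ?w (a [^] (n ^ i)) \<le> c * (i + 1)" by blast
qed

end

section \<open>Anosov mapping tori\<close>

locale anosov_torus =
  fixes A :: "int ^ 2 ^ 2" and l :: real and G (structure)
  assumes torus: "G = mapping_torus_group A" and SL: "A \<in> SL2Z" and l: "l > 1" "l \<notin> \<rat>" and eig: "eigenvalue (real_matrix A) l"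
begin

definition power :: "int \<Rightarrow> int ^ 2 \<Rightarrow> int ^ 2" where
  "power k = (\<lambda>v. A *v v) [^]\<^bsub>AutoGroup Z2_group\<^esub> k"

definition tr :: int where "tr = A $ 1 $ 1 + A $ 2 $ 2"

lemma det_A: "A $ 1 $ 1 * A $ 2 $ 2 - A $ 1 $ 2 * A $ 2 $ 1 = 1"
  using SL by (simp add: SL2Z_def det_2)

lemma mulA: "(A *v v) $ 1 = A $ 1 $ 1 * v $ 1 + A $ 1 $ 2 * v $ 2"
  "(A *v v) $ 2 = A $ 2 $ 1 * v $ 1 + A $ 2 $ 2 * v $ 2"
  by (simp_all add: matrix_vector_mult_def sum_2)

lemma cayley_hamilton: "(A *v (A *v v)) $ i = tr * (A *v v) $ i - v $ i"
proof -
  have bc: "A $ 1 $ 2 * A $ 2 $ 1 = A $ 1 $ 1 * A $ 2 $ 2 - 1" using det_A by simp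
  have "(A *v (A *v v)) $ 1 = tr * (A *v v) $ 1 - v $ 1"
    "(A *v (A *v v)) $ 2 = tr * (A *v v) $ 2 - v $ 2"
    using bc unfolding mulA tr_def by algebra+
  then show ?thesis using exhaust_2[of i] by auto
qed

text \<open>Eliminating from the eigenvector equations leaves the characteristic polynomial times
  each entry of \<open>v\<close>. With lower left entry 0 the matrix would be triangular and
  \<open>l\<close> an integer diagonal entry, against irrationality; that this entry is nonzero
  later gives \<open>coeig\<close> a nonzero value at \<open>e\<close>.\<close>

lemma char_eq: "l * l = of_int tr * l - 1" and lower_left: "A $ 2 $ 1 \<noteq> 0"
proof -
  define a b c d where "a = real_of_int (A $ 1 $ 1)" "b = real_of_int (A $ 1 $ 2)"
    "c = real_of_int (A $ 2 $ 1)" "d = real_of_int (A $ 2 $ 2)"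
  obtain v where v: "v \<noteq> 0" "real_matrix A *v v = l *s v" using eig by (auto simp: eigenvalue_def)
  have e: "a * v $ 1 + b * v $ 2 = l * v $ 1" "c * v $ 1 + d * v $ 2 = l * v $ 2"
    using v(2) by (simp_all add: vec_eq_iff forall_2 matrix_vector_mult_def sum_2 real_matrix_def a_b_c_d_def)
  have "of_int (A $ 1 $ 1 * A $ 2 $ 2 - A $ 1 $ 2 * A $ 2 $ 1) = (1 :: real)" unfolding det_A by simp
  then have det: "a * d - b * c = 1" by (simp add: a_b_c_d_def)
  have "((a - l) * (d - l) - b * c) * v $ 1 = 0" "((a - l) * (d - l) - b * c) * v $ 2 = 0"
    using e by algebra+
  moreover have "v $ 1 \<noteq> 0 \<or> v $ 2 \<noteq> 0" using v(1) by (auto simp: vec_eq_iff forall_2)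
  ultimately have ch: "(a - l) * (d - l) - b * c = 0" by auto
  show "l * l = of_int tr * l - 1" using ch det by (simp add: tr_def a_b_c_d_def algebra_simps)
  show "A $ 2 $ 1 \<noteq> 0"
  proof
    assume "A $ 2 $ 1 = 0"
    then have "c = 0" by (simp add: a_b_c_d_def)
    then have "l = a \<or> l = d" using ch by auto
    then have "l \<in> \<rat>" by (auto simp: a_b_c_d_def)
    then show False using l by simp
  qed
qed

text \<open>\<open>tr\<close> is \<open>l + 1 / l\<close>, which exceeds 2 for
  \<open>l > 1\<close>.\<close>

lemma tr_ge: "tr \<ge> 3"
proof -
  have "0 < (l - 1) * (l - 1)" using l by simp
  then have "2 * l < l * l + 1" by (simp add: algebra_simps)
  then have "2 < real_of_int tr" using char_eq l by simp
  then show ?thesis by linarith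
qed

lemma power_hom: "power \<in> hom integer_group (AutoGroup Z2_group)"
  unfolding power_def
  by (rule group.hom_integer_group_pow[OF group.AutoGroup[OF group_Z2_group] SL2Z_in_AutoGroup[OF SL]])

lemma power_auto: "power k \<in> carrier (AutoGroup Z2_group)"
  using power_hom by (auto simp: hom_def)

lemma power_plus: "power (j + k) v = power j (power k v)"
proof -
  have "power (j + k) = power j \<otimes>\<^bsub>AutoGroup Z2_group\<^esub> power k"
    using hom_mult[OF power_hom, of j k] by simp
  also have "\<dots> = compose UNIV (power j) (power k)"
    using power_auto[of j] power_auto[of k] by (simp add: AutoGroup_def BijGroup_def auto_def Z2_group_def)
  finally show ?thesis by (simp add: compose_def)
qed

lemma power_add: "power k (v + w) = power k v + power k w"
  using power_auto[of k] by (auto simp: AutoGroup_def auto_def hom_def Z2_group_def)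

lemma power_0: "power 0 v = v"
proof -
  interpret Z: group Z2_group by (rule group_Z2_group)
  have "power 0 = \<one>\<^bsub>AutoGroup Z2_group\<^esub>" unfolding power_def by (rule int_pow_0)
  then show ?thesis by (simp add: AutoGroup_def BijGroup_def Z2_group_def)
qed

lemma power_1: "power 1 v = A *v v"
proof -
  interpret Au: group "AutoGroup Z2_group" by (rule group.AutoGroup[OF group_Z2_group])
  have "power 1 = (\<lambda>v. A *v v)" unfolding power_def by (rule Au.int_pow_1[OF SL2Z_in_AutoGroup[OF SL]])
  then show ?thesis by simp
qed

lemma carrier_G: "carrier G = UNIV"
  by (simp add: torus mapping_torus_group_def semidirect_product_def Z2_group_def)

lemma mult_G: "(x, j) \<otimes> (y, k) = (x + power j y, j + k)"
  by (simp add: torus mapping_torus_group_def semidirect_product_def Z2_group_def power_def)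

lemma one_G: "\<one> = (0, 0)"
  by (simp add: torus mapping_torus_group_def semidirect_product_def Z2_group_def)

sublocale group G
  unfolding torus by (rule group_mapping_torus_group[OF SL])

text \<open>The left eigenvector of \<open>A\<close> for an eigenvalue \<open>\<mu>\<close>.\<close>

definition coeig :: "real \<Rightarrow> int ^ 2 \<Rightarrow> real" where
  "coeig \<mu> v = of_int (A $ 2 $ 1) * of_int (v $ 1) + (\<mu> - of_int (A $ 1 $ 1)) * of_int (v $ 2)"

lemma coeig_add: "coeig \<mu> (v + w) = coeig \<mu> v + coeig \<mu> w"
  by (simp add: coeig_def algebra_simps)

lemma coeig_A:
  assumes "\<mu> * \<mu> = of_int tr * \<mu> - 1"
  shows "coeig \<mu> (A *v v) = \<mu> * coeig \<mu> v"
proof -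
  define a b c d where "a = real_of_int (A $ 1 $ 1)" "b = real_of_int (A $ 1 $ 2)"
    "c = real_of_int (A $ 2 $ 1)" "d = real_of_int (A $ 2 $ 2)"
  have "of_int (A $ 1 $ 1 * A $ 2 $ 2 - A $ 1 $ 2 * A $ 2 $ 1) = (1 :: real)" unfolding det_A by simp
  then have det: "a * d - b * c = 1" by (simp add: a_b_c_d_def)
  have ch: "\<mu> * \<mu> = (a + d) * \<mu> - 1" using assms by (simp add: tr_def a_b_c_d_def)
  have "c * (a * of_int (v $ 1) + b * of_int (v $ 2)) + (\<mu> - a) * (c * of_int (v $ 1) + d * of_int (v $ 2))
      = \<mu> * (c * of_int (v $ 1) + (\<mu> - a) * of_int (v $ 2))"
    using det ch by algebra
  then show ?thesis by (simp add: coeig_def mulA a_b_c_d_def)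
qed

lemma coeig_power:
  assumes \<mu>: "\<mu> * \<mu> = of_int tr * \<mu> - 1" "\<mu> > 0"
  shows "coeig \<mu> (power k v) = exp (of_int k * ln \<mu>) * coeig \<mu> v"
proof (induction k arbitrary: v rule: int_induct[where k = 0])
  case base
  show ?case by (simp add: power_0)
next
  case (step1 i)
  show ?case using step1(2)[of "A *v v"] \<mu>(2)
    by (simp add: power_plus power_1 coeig_A[OF \<mu>(1)] distrib_right exp_add)
next
  case (step2 i)
  define w where "w = power (- 1) v"
  have v: "v = A *v w" using power_plus[of 1 "- 1" v] by (simp add: w_def power_1 power_0)
  have "power (i - 1) v = power i w" using power_plus[of i "- 1" v] by (simp add: w_def)
  moreover have "coeig \<mu> v = \<mu> * coeig \<mu> w" unfolding v by (rule coeig_A[OF \<mu>(1)])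
  ultimately show ?case using step2(2)[of w] \<mu>(2)
    by (simp add: left_diff_distrib exp_diff)
qed

lemma inverse_char_eq: "inverse l * inverse l = of_int tr * inverse l - 1"
  using char_eq l by (simp add: field_simps)

lemma affine:
  assumes "\<mu> * \<mu> = of_int tr * \<mu> - 1" "\<mu> > 0"
  shows "affine_action G snd (\<lambda>g. coeig \<mu> (fst g)) (ln \<mu>)"
proof
  show "snd (g \<otimes> h) = snd g + snd h" for g h by (cases g; cases h) (simp add: mult_G)
  show "coeig \<mu> (fst (g \<otimes> h)) = coeig \<mu> (fst g) + exp (of_int (snd g) * ln \<mu>) * coeig \<mu> (fst h)" for g h
    by (cases g; cases h) (simp add: mult_G coeig_add coeig_power[OF assms])
qed

definition \<mu> :: "nat \<Rightarrow> real" where "\<mu> i = (if i = 0 then l else inverse l)"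

lemma \<mu>: "\<mu> i * \<mu> i = of_int tr * \<mu> i - 1" "\<mu> i > 0" "ln (\<mu> i) \<noteq> 0"
  using char_eq inverse_char_eq l by (auto simp: \<mu>_def ln_inverse)

sublocale aff: affine_action G snd "\<lambda>g. coeig (\<mu> i) (fst g)" "ln (\<mu> i)" for i
  by (rule affine[OF \<mu>(1,2)])

definition e :: "int ^ 2" where "e = axis 1 1"

lemma coeig_scale_e: "coeig x (j *s e) = of_int j * of_int (A $ 2 $ 1)"
  by (simp add: coeig_def e_def axis_def)

text \<open>The two eigencoordinates are independent: they differ by \<open>l - inverse l\<close>
  times the second entry. Bounds on both thus bound both entries of an integer vector.\<close>

lemma finite_bounded_coeig: "finite {v. \<bar>coeig l v\<bar> \<le> B \<and> \<bar>coeig (inverse l) v\<bar> \<le> B}"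
proof -
  define \<delta> where "\<delta> = l - inverse l"
  have "inverse l < 1" using l by (simp add: inverse_eq_divide)
  then have \<delta>: "\<delta> > 0" using l by (simp add: \<delta>_def)
  define c where "c = real_of_int (A $ 2 $ 1)"
  have c: "\<bar>c\<bar> \<ge> 1" using lower_left by (simp add: c_def)
  define K where "K = 2 * B / \<delta>"
  define M where "M = B + \<bar>l - of_int (A $ 1 $ 1)\<bar> * K"
  let ?f = "\<lambda>v :: int ^ 2. (v $ 1, v $ 2)"
  have "?f ` {v. \<bar>coeig l v\<bar> \<le> B \<and> \<bar>coeig (inverse l) v\<bar> \<le> B} \<subseteq> {- \<lceil>M\<rceil>..\<lceil>M\<rceil>} \<times> {- \<lceil>K\<rceil>..\<lceil>K\<rceil>}"
  proof clarify
    fix v assume v: "\<bar>coeig l v\<bar> \<le> B" "\<bar>coeig (inverse l) v\<bar> \<le> B"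
    have "\<delta> * of_int (v $ 2) = coeig l v - coeig (inverse l) v"
      by (simp add: coeig_def \<delta>_def algebra_simps)
    then have "\<bar>\<delta> * of_int (v $ 2)\<bar> \<le> 2 * B" using v by linarith
    then have "\<delta> * \<bar>real_of_int (v $ 2)\<bar> \<le> 2 * B" using \<delta> by (simp add: abs_mult)
    then have v2: "\<bar>real_of_int (v $ 2)\<bar> \<le> K" using \<delta> by (simp add: K_def field_simps)
    have "c * of_int (v $ 1) = coeig l v - (l - of_int (A $ 1 $ 1)) * of_int (v $ 2)" by (simp add: coeig_def c_def)
    then have "\<bar>c * of_int (v $ 1)\<bar> \<le> B + \<bar>(l - of_int (A $ 1 $ 1)) * of_int (v $ 2)\<bar>" using v(1) by linarith
    also have "\<dots> \<le> M" unfolding M_def abs_mult using v2 by (simp add: mult_left_mono)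
    finally have "\<bar>c\<bar> * \<bar>real_of_int (v $ 1)\<bar> \<le> M" by (simp add: abs_mult)
    moreover have "1 * \<bar>real_of_int (v $ 1)\<bar> \<le> \<bar>c\<bar> * \<bar>real_of_int (v $ 1)\<bar>" using c by (intro mult_right_mono) auto
    ultimately have v1: "\<bar>real_of_int (v $ 1)\<bar> \<le> M" by linarith
    have "\<bar>v $ 1\<bar> \<le> \<lceil>M\<rceil>" "\<bar>v $ 2\<bar> \<le> \<lceil>K\<rceil>" using v1 v2 by linarith+
    then show "v $ 1 \<in> {- \<lceil>M\<rceil>..\<lceil>M\<rceil>} \<and> v $ 2 \<in> {- \<lceil>K\<rceil>..\<lceil>K\<rceil>}" by auto
  qed
  then have "finite (?f ` {v. \<bar>coeig l v\<bar> \<le> B \<and> \<bar>coeig (inverse l) v\<bar> \<le> B})"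
    by (rule finite_subset) auto
  moreover have "inj ?f" by (rule injI) (simp add: vec_eq_iff forall_2)
  ultimately show ?thesis using finite_imageD inj_on_subset by blast
qed

lemma property_PH: "property_PH TYPE(complex) G"
proof (rule property_PH_of_pseudometric_actions[where n = 2 and P = "\<lambda>_. UNIV" and d = "\<lambda>_. hp_dist"
      and p = "\<lambda>_. 0" and \<alpha> = "\<lambda>i. aff.hp_rep i"])
  show "group G" by (rule is_group)
  show "pseudo_metric UNIV hp_dist" by (rule hp.pseudo_metric_axioms)
  show "pseudo_metric.geodesic_pair UNIV hp_dist x y" for x y by (rule hp_geodesic)
  show "\<exists>\<delta>\<ge>0. gromov_hyperbolic \<delta> UNIV hp_dist" by (rule hp_hyperbolic)
  show "aff.hp_rep i (g \<otimes> h) x = aff.hp_rep i g (aff.hp_rep i h x)"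
    if "g \<in> carrier G" "h \<in> carrier G" for i g h x using that by (rule aff.hp_rep_mult)
  show "aff.hp_rep i \<one> x = x" for i x by (rule aff.hp_rep_one)
  show "hp_dist (aff.hp_rep i g x) (aff.hp_rep i g y) = hp_dist x y" for i g x y by (rule aff.hp_rep_isometry)
  show "\<exists>\<epsilon>. \<forall>y\<in>UNIV. \<exists>g\<in>carrier G. hp_dist (aff.hp_rep i g 0) y \<le> \<epsilon>" for i
  proof -
    have "\<exists>\<epsilon>. \<forall>y. \<exists>g\<in>carrier G. hp_dist (aff.hp_rep i g 0) y \<le> \<epsilon>"
    proof (rule aff.hp_rep_cobounded[OF \<mu>(3), of "of_int (A $ 2 $ 1)"])
      show "real_of_int (A $ 2 $ 1) \<noteq> 0" using lower_left by simp
      fix k j :: int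
      show "\<exists>g\<in>carrier G. snd g = k \<and>
          coeig (\<mu> i) (fst g) = of_int j * (of_int (A $ 2 $ 1) * exp (of_int k * ln (\<mu> i)))"
        \<comment> \<open>The multiples of \<open>e\<close> have values spaced by the lower left
          entry, and \<open>power k\<close> rescales these to the height belonging to
          \<open>k\<close>.\<close>
        by (intro bexI[of _ "(power k (j *s e), k)"])
          (simp_all add: carrier_G coeig_power[OF \<mu>(1,2)] coeig_scale_e)
    qed
    then show ?thesis by simp
  qed
next
  fix R :: real
  let ?A = "{g \<in> carrier G. \<forall>i<2. hp_dist 0 (aff.hp_rep i g 0) \<le> R}"
  define B where "B = 2 * exp R"
  define K where "K = \<lceil>R / ln l\<rceil>"
  have "?A \<subseteq> {v. \<bar>coeig l v\<bar> \<le> B \<and> \<bar>coeig (inverse l) v\<bar> \<le> B} \<times> {- K..K}"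
  proof (rule subsetI)
    fix g assume "g \<in> ?A"
    moreover obtain v k where g: "g = (v, k)" by (cases g)
    ultimately have le: "\<forall>i<2. hp_dist 0 (aff.hp_rep i (v, k) 0) \<le> R" by blast
    have h: "\<bar>of_int k * ln (\<mu> i)\<bar> \<le> R" "\<bar>coeig (\<mu> i) v\<bar> \<le> B" if "i < 2" for i
      using hp_dist_origin_bound[of "aff.hp_rep i (v, k) 0" R] le that by (auto simp: aff.hp_rep_origin B_def)
    have "\<bar>of_int k * ln l\<bar> \<le> R" using h(1)[of 0] by (simp add: \<mu>_def)
    then have "\<bar>real_of_int k\<bar> \<le> R / ln l" using l by (simp add: abs_mult field_simps)
    then have "\<bar>k\<bar> \<le> K" unfolding K_def by linarith
    then show "g \<in> {v. \<bar>coeig l v\<bar> \<le> B \<and> \<bar>coeig (inverse l) v\<bar> \<le> B} \<times> {- K..K}"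
      using h(2)[of 0] h(2)[of 1] by (auto simp: \<mu>_def g)
  qed
  then show "finite ?A" using finite_bounded_coeig finite_subset by blast
qed auto

text \<open>The trace of the \<open>i\<close>-th power of \<open>A\<close>, computed by the
  Cayley-Hamilton recursion.\<close>

fun tr_pow :: "nat \<Rightarrow> int" where
  "tr_pow 0 = 2"
| "tr_pow (Suc 0) = tr"
| "tr_pow (Suc (Suc i)) = tr * tr_pow (Suc i) - tr_pow i"

text \<open>Monotonicity is carried along because it turns \<open>tr \<ge> 3\<close> into doubling:
  three times the current term minus the previous one is at least twice the current term.\<close>

lemma tr_pow_growth: "2 ^ i \<le> tr_pow i \<and> 2 ^ Suc i \<le> tr_pow (Suc i) \<and> tr_pow i \<le> tr_pow (Suc i)"
proof (induction i)
  case 0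
  then show ?case using tr_ge by simp
next
  case (Suc i)
  have "(0 :: int) \<le> 2 ^ Suc i" by simp
  then have "0 \<le> tr_pow (Suc i)" using Suc by linarith
  then have "3 * tr_pow (Suc i) \<le> tr * tr_pow (Suc i)" using tr_ge by (intro mult_right_mono)
  then have "2 * tr_pow (Suc i) \<le> tr_pow (Suc (Suc i))" using Suc by simp
  then show ?case using Suc \<open>0 \<le> tr_pow (Suc i)\<close> by simp
qed

lemma power_recursion: "power (k + 2) v $ i = tr * power (k + 1) v $ i - power k v $ i"
  using power_plus[of 1 "k + 1" v] power_plus[of 1 k v] cayley_hamilton[of "power k v" i]
  by (simp add: power_1 add.commute)

lemma power_plus_inverse: "power (int j) v + power (- int j) v = tr_pow j *s v"
proof (induction j rule: tr_pow.induct)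
  case 1
  show ?case by (simp add: power_0 vec_eq_iff)
next
  case 2
  have "power 1 v $ i + power (- 1) v $ i = tr * v $ i" for i
    using power_recursion[of "- 1" v i] by (simp add: power_0)
  then show ?case by (simp add: vec_eq_iff)
next
  case (3 j)
  have "power (int (Suc (Suc j))) v $ i + power (- int (Suc (Suc j))) v $ i = tr_pow (Suc (Suc j)) * v $ i" for i
  proof -
    have "power (int j + 2) v $ i = tr * power (int j + 1) v $ i - power (int j) v $ i"
      by (rule power_recursion)
    \<comment> \<open>The same recursion, based at \<open>- int j - 2\<close> so that it can be
      solved for the more negative power.\<close>
    moreover have "power (- int j) v $ i = tr * power (- int j - 1) v $ i - power (- int j - 2) v $ i"
    proof -
      have "- int j - 2 + 2 = - int j" "- int j - 2 + 1 = - int j - 1" by simp_all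
      with power_recursion[of "- int j - 2" v i] show ?thesis by (simp only:)
    qed
    moreover have "power (int j) v $ i + power (- int j) v $ i = tr_pow j * v $ i"
      using 3(2) by (simp add: vec_eq_iff)
    moreover have "power (int j + 1) v $ i + power (- int j - 1) v $ i = tr_pow (Suc j) * v $ i"
    proof -
      have "int (Suc j) = int j + 1" "- int (Suc j) = - int j - 1" by simp_all
      with 3(1) have "power (int j + 1) v + power (- int j - 1) v = tr_pow (Suc j) *s v" by (simp only:)
      then show ?thesis by (simp add: vec_eq_iff)
    qed
    ultimately have "power (int j + 2) v $ i + power (- int j - 2) v $ i = (tr * tr_pow (Suc j) - tr_pow j) * v $ i"
      by algebra
    moreover have "int (Suc (Suc j)) = int j + 2" "- int (Suc (Suc j)) = - int j - 2" by simp_all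
    ultimately show ?thesis by (simp only: tr_pow.simps)
  qed
  then show ?case by (simp add: vec_eq_iff left_diff_distrib)
qed

lemma power_zero: "power k 0 = 0"
  using power_add[of k 0 0] by simp

definition a :: "(int ^ 2) \<times> int" where "a = (e, 0)"
definition t :: "(int ^ 2) \<times> int" where "t = (0, 1)"

lemma a_pow: "a [^] (k :: nat) = (int k *s e, 0)"
proof (induction k)
  case 0
  show ?case by (simp add: one_G)
next
  case (Suc k)
  then show ?case by (simp add: a_def mult_G power_0 vec_eq_iff algebra_simps)
qed

lemma t_inv: "inv t = (0, - 1)"
  by (rule inv_equality) (simp_all add: t_def mult_G one_G power_zero carrier_G)

lemma t_pow: "t [^] (k :: nat) = (0, int k)" "(inv t) [^] (k :: nat) = (0, - int k)"
proof -
  show "t [^] (k :: nat) = (0, int k)"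
    by (induction k) (simp_all add: one_G t_def mult_G power_zero)
  show "(inv t) [^] (k :: nat) = (0, - int k)"
    unfolding t_inv by (induction k) (simp_all add: one_G mult_G power_zero)
qed

lemma not_property_QT: "\<not> property_QT TYPE('x) TYPE('v) G"
proof (rule not_property_QT_of_exponential[of a "\<lambda>j. nat (tr_pow j)"])
  show "a \<in> carrier G" by (simp add: carrier_G)
  show "inj (\<lambda>k :: nat. a [^] k)"
  proof (rule injI)
    fix j k :: nat
    assume "a [^] j = a [^] k"
    then have "(int j *s e) $ 1 = (int k *s e) $ 1" by (simp add: a_pow)
    then show "j = k" by (simp add: e_def axis_def)
  qed
  show "2 ^ j \<le> nat (tr_pow j)" for j
    using tr_pow_growth[of j] nat_mono[of "2 ^ j" "tr_pow j"] by (simp add: nat_power_eq)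
  fix S assume S: "finite_generating_set G S"
  let ?w = "word_length G S"
  define s where "s = inv t"
  define c where "c = 2 * (?w t + ?w a + ?w s)"
  have C: "g \<in> carrier G" for g by (simp add: carrier_G)
  have "?w (a [^] nat (tr_pow j)) \<le> c * (j + 1)" for j
  proof -
    let ?T = "t [^] j" and ?S = "s [^] j"
    have "(0 :: int) \<le> 2 ^ j" by simp
    then have "tr_pow j \<ge> 0" using tr_pow_growth[of j] by linarith
    then have "a [^] nat (tr_pow j) = (power (int j) e + power (- int j) e, 0)"
      by (simp add: a_pow power_plus_inverse)
    also have "\<dots> = (?T \<otimes> a \<otimes> ?S) \<otimes> (?S \<otimes> a \<otimes> ?T)"
      by (simp add: s_def t_pow a_def mult_G power_zero power_0)
    finally have eq: "a [^] nat (tr_pow j) = (?T \<otimes> a \<otimes> ?S) \<otimes> (?S \<otimes> a \<otimes> ?T)" .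
    have three: "?w (x \<otimes> y \<otimes> z) \<le> ?w x + ?w y + ?w z" for x y z
      using word_length_mult[OF S C C, of "x \<otimes> y" z] word_length_mult[OF S C C, of x y] by linarith
    have add_bound: "x \<le> 2 * (p + q + r)" if "x \<le> u + v" "u \<le> p + q + r" "v \<le> r + q + p" for p q r u v x :: nat
      using that by simp
    have "?w (a [^] nat (tr_pow j)) \<le> 2 * (?w ?T + ?w a + ?w ?S)"
      unfolding eq
      by (rule add_bound[OF word_length_mult[OF S C C] three three])
    also have "\<dots> \<le> 2 * (j * ?w t + ?w a + j * ?w s)"
      by (intro mult_le_mono2 add_mono word_length_pow[OF S C] order_refl)
    also have "\<dots> \<le> c * (j + 1)" by (simp add: c_def algebra_simps)
    finally show ?thesis .
  qed
  then show "\<exists>c. \<forall>j. ?w (a [^] nat (tr_pow j)) \<le> c * (j + 1)" by blast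
qed

end

theorem proposition1p8:
  shows "(\<forall>n::nat. n \<ge> 2 \<longrightarrow>
            property_PH TYPE(complex) (BS1 n) \<and>
            \<not> property_QT TYPE('x) TYPE('v) (BS1 n)) \<and>
         (\<forall>A. anosov A \<longrightarrow>
            property_PH TYPE(complex) (mapping_torus_group A) \<and>
            \<not> property_QT TYPE('x) TYPE('v) (mapping_torus_group A))"
proof (intro conjI allI impI)
  fix n :: nat
  assume "n \<ge> 2"
  then interpret baumslag_solitar n "BS1 n" by unfold_locales simp_all
  show "property_PH TYPE(complex) (BS1 n)" by (rule property_PH)
  show "\<not> property_QT TYPE('x) TYPE('v) (BS1 n)" by (rule not_property_QT)
next
  fix A :: "int ^ 2 ^ 2"
  assume "anosov A"
  then obtain l where "A \<in> SL2Z" "l > 1" "l \<notin> \<rat>" "eigenvalue (real_matrix A) l"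
    unfolding anosov_def by blast
  then interpret anosov_torus A l "mapping_torus_group A" by unfold_locales simp_all
  show "property_PH TYPE(complex) (mapping_torus_group A)" by (rule property_PH)
  show "\<not> property_QT TYPE('x) TYPE('v) (mapping_torus_group A)" by (rule not_property_QT)
qed

end
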